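(* Let $(M,\omega)$ be a symplectic manifold and let $L\subset M$ be a closed Lagrangian submanifold. Let $\mathcal{P}$ be any set of pairwise disjoint submanifolds of $M$ such that every element of $\mathcal{P}$ is Hamiltonian isotopic to $L$. Then $\mathcal{P}$ is at most countable.
   Context: All manifolds are smooth, boundaryless, Hausdorff and second-countable; a closed submanifold is a compact one (without boundary). $\operatorname{Ham}(M)$ denotes the group of compactly supported Hamiltonian diffeomorphisms of $M$, i.e. the diffeomorphisms which occur as the time-$1$ flow of a compactly supported smooth Hamiltonian function $H:[0,1]\times M\to\mathbb{R}$. Two closed submanifolds $L,L'\subset M$ are Hamiltonian isotopic if $L'=\phi(L)$ setwise for some $\phi\in\operatorname{Ham}(M)$. A set $\mathcal{P}$ as in the claim is called a Lagrangian packing. *)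

theory Defs
  imports "HOL-Analysis.Analysis"
begin

section \<open>Smooth functions\<close>

text \<open>
  \<open>V\<close> is the linear space of directions in which one differentiates at points of \<open>S\<close>.
  The derivatives are taken within \<open>S\<close>. In all uses \<open>S\<close> is relatively open either in \<open>V\<close> or
  in \<open>{0..1} \<times> E\<close> with \<open>V = UNIV \<times> E\<close>, so that the values in directions of \<open>V\<close> of the
  derivative within \<open>S\<close> are unique; at the end points of the time interval they are one-sided.
\<close>

primrec Ck_on :: "nat \<Rightarrow> 'a::real_normed_vector set \<Rightarrow> 'a set \<Rightarrow> ('a \<Rightarrow> 'b::real_normed_vector) \<Rightarrow> bool"
  where
    "Ck_on 0 V S f \<longleftrightarrow> continuous_on S f"
  | "Ck_on (Suc k) V S f \<longleftrightarrow>
       (\<forall>x\<in>S. f differentiable (at x within S)) \<and>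
       (\<forall>v\<in>V. Ck_on k V S (\<lambda>x. frechet_derivative f (at x within S) v))"

definition smooth_on :: "'a::real_normed_vector set \<Rightarrow> 'a set \<Rightarrow> ('a \<Rightarrow> 'b::real_normed_vector) \<Rightarrow> bool"
  where "smooth_on V S f \<longleftrightarrow> (\<forall>k. Ck_on k V S f)"


section \<open>Smooth manifolds\<close>

type_synonym ('m, 'e) chart = "'m set \<times> ('m \<Rightarrow> 'e)"

abbreviation cdom :: "('m, 'e) chart \<Rightarrow> 'm set" where "cdom c \<equiv> fst c"
abbreviation cmap :: "('m, 'e) chart \<Rightarrow> 'm \<Rightarrow> 'e" where "cmap c \<equiv> snd c"
abbreviation cimg :: "('m, 'e) chart \<Rightarrow> 'e set" where "cimg c \<equiv> snd c ` fst c"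
abbreviation cinv :: "('m, 'e) chart \<Rightarrow> 'e \<Rightarrow> 'm" where "cinv c \<equiv> inv_into (fst c) (snd c)"

definition coord_chart :: "'e set \<Rightarrow> ('m::topological_space, 'e::euclidean_space) chart \<Rightarrow> bool"
  where "coord_chart E c \<longleftrightarrow>
    open (cdom c) \<and> openin (top_of_set E) (cimg c) \<and>
    homeomorphism (cdom c) (cimg c) (cmap c) (cinv c)"

definition transition :: "('m, 'e) chart \<Rightarrow> ('m, 'e) chart \<Rightarrow> 'e \<Rightarrow> 'e"
  where "transition c d = cmap d \<circ> cinv c"

definition compatible :: "'e set \<Rightarrow> ('m, 'e::euclidean_space) chart \<Rightarrow> ('m, 'e) chart \<Rightarrow> bool"
  where "compatible E c d \<longleftrightarrow>
    smooth_on E (cmap c ` (cdom c \<inter> cdom d)) (transition c d) \<and>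
    smooth_on E (cmap d ` (cdom c \<inter> cdom d)) (transition d c)"

definition carrier :: "('m, 'e) chart set \<Rightarrow> 'm set"
  where "carrier A = (\<Union>c\<in>A. cdom c)"

text \<open>
  A smooth structure is a maximal atlas \<open>A\<close>; the manifold is the open set \<open>carrier A\<close>.
  The model space \<open>E\<close> is the whole type \<open>'e\<close>, or \<open>{0}\<close>: the latter provides the
  manifolds of dimension 0, since every type of class \<open>euclidean_space\<close> has positive dimension.
  The dimension of the manifold is \<open>dim E\<close>.
\<close>

definition smooth_manifold ::
    "'e set \<Rightarrow> ('m::{t2_space, second_countable_topology}, 'e::euclidean_space) chart set \<Rightarrow> bool"
  where "smooth_manifold E A \<longleftrightarrow>
    (E = UNIV \<or> E = {0}) \<and>
    (\<forall>c\<in>A. coord_chart E c) \<and>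
    (\<forall>c\<in>A. \<forall>d\<in>A. compatible E c d) \<and>
    (\<forall>c. coord_chart E c \<and> cdom c \<subseteq> carrier A \<and> (\<forall>d\<in>A. compatible E c d) \<longrightarrow> c \<in> A)"

text \<open>
  Tangent vectors at \<open>p\<close> are represented by their coordinates in a chart around \<open>p\<close>, ranging
  over \<open>E\<close>; \<open>coord_change c d p\<close> turns coordinates in \<open>c\<close> into coordinates in \<open>d\<close>.
\<close>

definition coord_change :: "('m, 'e::euclidean_space) chart \<Rightarrow> ('m, 'e) chart \<Rightarrow> 'm \<Rightarrow> 'e \<Rightarrow> 'e"
  where "coord_change c d p =
    frechet_derivative (transition c d) (at (cmap c p) within cmap c ` (cdom c \<inter> cdom d))"

definition smooth_map ::
    "'e set \<Rightarrow> ('m::topological_space, 'e::euclidean_space) chart set \<Rightarrow> ('m \<Rightarrow> 'm) \<Rightarrow> bool"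
  where "smooth_map E A f \<longleftrightarrow>
    f ` carrier A \<subseteq> carrier A \<and> continuous_on (carrier A) f \<and>
    (\<forall>c\<in>A. \<forall>d\<in>A.
       smooth_on E {x \<in> cimg c. f (cinv c x) \<in> cdom d} (\<lambda>x. cmap d (f (cinv c x))))"

definition diffeomorphism ::
    "'e set \<Rightarrow> ('m::topological_space, 'e::euclidean_space) chart set \<Rightarrow> ('m \<Rightarrow> 'm) \<Rightarrow> bool"
  where "diffeomorphism E A f \<longleftrightarrow>
    bij_betw f (carrier A) (carrier A) \<and>
    smooth_map E A f \<and> smooth_map E A (inv_into (carrier A) f)"


section \<open>Symplectic forms\<close>

text \<open>
  A 2-form is given by its local expressions: \<open>\<omega> c p u v\<close> is the value at \<open>p\<close> on the two tangent
  vectors with coordinates \<open>u\<close> and \<open>v\<close> in the chart \<open>c\<close>. Only the values at \<open>c \<in> A\<close>,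
  \<open>p \<in> cdom c\<close> and \<open>u, v \<in> E\<close> are meaningful. For \<open>E = {0}\<close> bilinearity on all of \<open>'e\<close> is
  no restriction on these values other than that they vanish.
\<close>

type_synonym ('m, 'e) two_form = "('m, 'e) chart \<Rightarrow> 'm \<Rightarrow> 'e \<Rightarrow> 'e \<Rightarrow> real"

definition smooth_two_form ::
    "'e set \<Rightarrow> ('m, 'e::euclidean_space) chart set \<Rightarrow> ('m, 'e) two_form \<Rightarrow> bool"
  where "smooth_two_form E A \<omega> \<longleftrightarrow>
    (\<forall>c\<in>A. \<forall>p\<in>cdom c. bilinear (\<omega> c p) \<and> (\<forall>u\<in>E. \<omega> c p u u = 0)) \<and>
    (\<forall>c\<in>A. \<forall>u\<in>E. \<forall>v\<in>E. smooth_on E (cimg c) (\<lambda>x. \<omega> c (cinv c x) u v)) \<and>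
    (\<forall>c\<in>A. \<forall>d\<in>A. \<forall>p\<in>cdom c \<inter> cdom d. \<forall>u\<in>E. \<forall>v\<in>E.
       \<omega> c p u v = \<omega> d p (coord_change c d p u) (coord_change c d p v))"

text \<open>
  The exterior derivative on coordinate vectors \<open>u, v, w\<close>, extended to constant (hence
  commuting) vector fields in the chart \<open>c\<close>.
\<close>

definition ext_deriv ::
    "('m, 'e::euclidean_space) two_form \<Rightarrow> ('m, 'e) chart \<Rightarrow> 'm \<Rightarrow> 'e \<Rightarrow> 'e \<Rightarrow> 'e \<Rightarrow> real"
  where "ext_deriv \<omega> c p u v w =
    frechet_derivative (\<lambda>x. \<omega> c (cinv c x) v w) (at (cmap c p) within cimg c) u +
    frechet_derivative (\<lambda>x. \<omega> c (cinv c x) w u) (at (cmap c p) within cimg c) v +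
    frechet_derivative (\<lambda>x. \<omega> c (cinv c x) u v) (at (cmap c p) within cimg c) w"

definition symplectic_manifold ::
    "'e set \<Rightarrow> ('m::{t2_space, second_countable_topology}, 'e::euclidean_space) chart set
      \<Rightarrow> ('m, 'e) two_form \<Rightarrow> bool"
  where "symplectic_manifold E A \<omega> \<longleftrightarrow>
    smooth_manifold E A \<and> smooth_two_form E A \<omega> \<and>
    (\<forall>c\<in>A. \<forall>p\<in>cdom c. \<forall>u\<in>E. \<forall>v\<in>E. \<forall>w\<in>E. ext_deriv \<omega> c p u v w = 0) \<and>
    (\<forall>c\<in>A. \<forall>p\<in>cdom c. \<forall>u\<in>E. (\<forall>v\<in>E. \<omega> c p u v = 0) \<longrightarrow> u = 0)"


section \<open>Lagrangian submanifolds\<close>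

definition slice_chart ::
    "'e set \<Rightarrow> ('m, 'e::euclidean_space) chart set \<Rightarrow> 'm set \<Rightarrow> ('m, 'e) chart \<Rightarrow> 'e set \<Rightarrow> bool"
  where "slice_chart E A L c W \<longleftrightarrow>
    c \<in> A \<and> subspace W \<and> W \<subseteq> E \<and> cmap c ` (L \<inter> cdom c) = W \<inter> cimg c"

definition submanifold_of_dim ::
    "'e set \<Rightarrow> ('m, 'e::euclidean_space) chart set \<Rightarrow> nat \<Rightarrow> 'm set \<Rightarrow> bool"
  where "submanifold_of_dim E A k L \<longleftrightarrow>
    L \<subseteq> carrier A \<and> (\<forall>p\<in>L. \<exists>c W. slice_chart E A L c W \<and> p \<in> cdom c \<and> dim W = k)"

definition submanifold :: "'e set \<Rightarrow> ('m, 'e::euclidean_space) chart set \<Rightarrow> 'm set \<Rightarrow> bool"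
  where "submanifold E A L \<longleftrightarrow> (\<exists>k. submanifold_of_dim E A k L)"

text \<open>
  The tangent space of \<open>L\<close> at \<open>p\<close> in the coordinates of \<open>c\<close>: in a slice chart \<open>d\<close> it is the
  linear space \<open>W\<close> of the slice. All slice charts around \<open>p\<close> yield the same space.
\<close>

definition tangent_space ::
    "'e set \<Rightarrow> ('m, 'e::euclidean_space) chart set \<Rightarrow> 'm set \<Rightarrow> ('m, 'e) chart \<Rightarrow> 'm \<Rightarrow> 'e set"
  where "tangent_space E A L c p =
    {coord_change d c p w | d W w. slice_chart E A L d W \<and> p \<in> cdom d \<and> w \<in> W}"

definition lagrangian ::
    "'e set \<Rightarrow> ('m, 'e::euclidean_space) chart set \<Rightarrow> ('m, 'e) two_form \<Rightarrow> 'm set \<Rightarrow> bool"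
  where "lagrangian E A \<omega> L \<longleftrightarrow>
    (\<exists>k. submanifold_of_dim E A k L \<and> 2 * k = dim E) \<and>
    (\<forall>p\<in>L. \<forall>c\<in>A. p \<in> cdom c \<longrightarrow>
       (\<forall>u\<in>tangent_space E A L c p. \<forall>v\<in>tangent_space E A L c p. \<omega> c p u v = 0))"


section \<open>Hamiltonian diffeomorphisms\<close>

definition smooth_hamiltonian ::
    "'e set \<Rightarrow> ('m, 'e::euclidean_space) chart set \<Rightarrow> (real \<Rightarrow> 'm \<Rightarrow> real) \<Rightarrow> bool"
  where "smooth_hamiltonian E A H \<longleftrightarrow>
    (\<forall>c\<in>A. smooth_on (UNIV \<times> E) ({0..1} \<times> cimg c) (\<lambda>(t, x). H t (cinv c x)))"

definition compactly_supported ::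
    "('m::topological_space, 'e) chart set \<Rightarrow> (real \<Rightarrow> 'm \<Rightarrow> real) \<Rightarrow> bool"
  where "compactly_supported A H \<longleftrightarrow>
    (\<exists>K \<subseteq> carrier A. compact K \<and> (\<forall>t\<in>{0..1}. \<forall>p \<in> carrier A - K. H t p = 0))"

definition differential :: "('m \<Rightarrow> real) \<Rightarrow> ('m, 'e::euclidean_space) chart \<Rightarrow> 'm \<Rightarrow> 'e \<Rightarrow> real"
  where "differential h c p =
    frechet_derivative (\<lambda>x. h (cinv c x)) (at (cmap c p) within cimg c)"

text \<open>
  Sign convention: \<open>\<omega> (X\<^sub>h, \<cdot>) = dh\<close>. The opposite convention amounts to replacing \<open>h\<close> by
  \<open>- h\<close> and yields the same Hamiltonian diffeomorphisms.
\<close>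

definition ham_vector_field ::
    "'e set \<Rightarrow> ('m, 'e::euclidean_space) two_form \<Rightarrow> ('m \<Rightarrow> real) \<Rightarrow> ('m, 'e) chart \<Rightarrow> 'm \<Rightarrow> 'e"
  where "ham_vector_field E \<omega> h c p =
    (THE u. u \<in> E \<and> (\<forall>v\<in>E. \<omega> c p u v = differential h c p v))"

definition smooth_isotopy ::
    "'e set \<Rightarrow> ('m::topological_space, 'e::euclidean_space) chart set \<Rightarrow> (real \<Rightarrow> 'm \<Rightarrow> 'm) \<Rightarrow> bool"
  where "smooth_isotopy E A \<Phi> \<longleftrightarrow>
    continuous_on ({0..1} \<times> carrier A) (\<lambda>(t, p). \<Phi> t p) \<and>
    (\<forall>c\<in>A. \<forall>d\<in>A.
       smooth_on (UNIV \<times> E) {(t, x). t \<in> {0..1} \<and> x \<in> cimg c \<and> \<Phi> t (cinv c x) \<in> cdom d}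
         (\<lambda>(t, x). cmap d (\<Phi> t (cinv c x)))) \<and>
    (\<forall>t\<in>{0..1}. diffeomorphism E A (\<Phi> t))"

definition ham_flow ::
    "'e set \<Rightarrow> ('m::topological_space, 'e::euclidean_space) chart set \<Rightarrow> ('m, 'e) two_form
      \<Rightarrow> (real \<Rightarrow> 'm \<Rightarrow> real) \<Rightarrow> (real \<Rightarrow> 'm \<Rightarrow> 'm) \<Rightarrow> bool"
  where "ham_flow E A \<omega> H \<Phi> \<longleftrightarrow>
    smooth_isotopy E A \<Phi> \<and>
    (\<forall>p\<in>carrier A. \<Phi> 0 p = p) \<and>
    (\<forall>p\<in>carrier A. \<forall>t\<in>{0..1}. \<forall>c\<in>A. \<Phi> t p \<in> cdom c \<longrightarrow>
       ((\<lambda>s. cmap c (\<Phi> s p)) has_vector_derivative ham_vector_field E \<omega> (H t) c (\<Phi> t p))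
         (at t within {0..1}))"

text \<open>Elements of \<open>Ham\<close> are arbitrary outside \<open>carrier A\<close>.\<close>

definition Ham ::
    "'e set \<Rightarrow> ('m::topological_space, 'e::euclidean_space) chart set \<Rightarrow> ('m, 'e) two_form
      \<Rightarrow> ('m \<Rightarrow> 'm) set"
  where "Ham E A \<omega> =
    {\<phi>. diffeomorphism E A \<phi> \<and>
      (\<exists>H \<Phi>. smooth_hamiltonian E A H \<and> compactly_supported A H \<and> ham_flow E A \<omega> H \<Phi> \<and>
        (\<forall>p\<in>carrier A. \<phi> p = \<Phi> 1 p))}"

definition hamiltonian_isotopic ::
    "'e set \<Rightarrow> ('m::topological_space, 'e::euclidean_space) chart set \<Rightarrow> ('m, 'e) two_form
      \<Rightarrow> 'm set \<Rightarrow> 'm set \<Rightarrow> bool"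
  where "hamiltonian_isotopic E A \<omega> L L' \<longleftrightarrow> (\<exists>\<phi>\<in>Ham E A \<omega>. L' = \<phi> ` L)"

end

theory Submission
  imports Defs
begin

text \<open>
  Suppose that a packing \<open>P\<close> were uncountable. Each element is \<open>\<phi>\<^sub>1(L)\<close> for a Hamiltonian flow \<open>\<phi>\<close>.
  The flows are points of a space with a countable base, in the topology of locally uniform
  convergence of the flows and of their first derivatives, so uncountably many of them
  accumulate at one of themselves (\<open>isotopies_accumulate\<close>): there are a flow \<open>\<phi>\<close> and flows \<open>\<zeta>\<^sub>k\<close> of
  other elements of \<open>P\<close> with \<open>\<zeta>\<^sub>k \<rightarrow> \<phi>\<close>. Then \<open>\<psi>\<^sub>k = \<phi>\<^sup>-\<^sup>1 \<zeta>\<^sub>k\<close> tends to the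
  identity, and \<open>\<psi>\<^sub>k(L) \<inter> L = {}\<close> at time 1 because distinct elements of \<open>P\<close> are disjoint. The claim
  is therefore that Hamiltonian isotopies which tend to the identity cannot all displace a
  compact Lagrangian (\<open>no_displacement_near_id\<close>). Comparing whole isotopies, rather than their
  end points only, makes any discussion of flux unnecessary.

  The reason is a function whose critical points are intersections. For \<open>m \<in> L\<close> the orbit
  \<open>\<psi>\<^sub>t(m)\<close> stays in a slice chart in which \<open>L\<close> is a linear subspace \<open>W\<close>. Its action is the
  symplectic area of the surface obtained by retracting the orbit orthogonally onto \<open>W\<close>, plus
  the integral of the generating Hamiltonian along the orbit. Stokes' theorem on a box, applied
  to a one-parameter family of such surfaces, expresses the change of the action along \<open>L\<close> by
  data at time 1 alone (\<open>action_variation\<close>): the pairing by \<open>\<omega>\<close> of the displacement normal to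
  \<open>W\<close> with directions close to \<open>W\<close>. Since \<open>W\<close> is its own \<open>\<omega>\<close>-orthogonal, this pairing is
  nondegenerate, so the gradient of the action at \<open>m\<close> has at least the size of the normal
  displacement \<open>d\<close> of \<open>m\<close> at time 1.

  The action depends on the slice chart, but only to second order: another application of Stokes'
  theorem, to the linear homotopy between two retractions, bounds the difference for two
  charts by a multiple of \<open>d\<^sup>2\<close> (\<open>local_comparison\<close>). Take a maximum of the action over the
  points of \<open>L\<close> and over finitely many slice charts. If the displacement \<open>d\<close> at the maximum were positive, moving
  the point by \<open>R d\<close> in a suitable direction would gain a multiple of \<open>R d\<^sup>2\<close> (\<open>action_gain\<close>),
  while the normal displacement would stay below \<open>2 d\<close>, so that changing to the chart used at
  the new point costs at most a fixed multiple of \<open>d\<^sup>2\<close>. For large \<open>R\<close> this contradicts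
  maximality; hence \<open>d = 0\<close>, which is an intersection point.

  In dimension zero the manifold is a countable set.
\<close>

section \<open>Maps of class $C^1$ and $C^2$\<close>

text \<open>
  The derivative as a map into bounded operators allows a uniform treatment of first and second
  derivatives: \<open>D (D f) x u v\<close> is the second derivative in the directions \<open>u\<close> and \<open>v\<close>.
\<close>

definition D :: "('a::real_normed_vector \<Rightarrow> 'b::real_normed_vector) \<Rightarrow> 'a \<Rightarrow> 'a \<Rightarrow>\<^sub>L 'b"
  where "D f x = Blinfun (frechet_derivative f (at x))"

definition C1_on :: "'a::real_normed_vector set \<Rightarrow> ('a \<Rightarrow> 'b::real_normed_vector) \<Rightarrow> bool"
  where "C1_on S f \<longleftrightarrow> (\<forall>x\<in>S. (f has_derivative D f x) (at x)) \<and> continuous_on S (D f)"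

definition C2_on :: "'a::real_normed_vector set \<Rightarrow> ('a \<Rightarrow> 'b::real_normed_vector) \<Rightarrow> bool"
  where "C2_on S f \<longleftrightarrow> (\<forall>x\<in>S. (f has_derivative D f x) (at x)) \<and> C1_on S (D f)"

lemma D_unique:
  assumes "(f has_derivative f') (at x)"
  shows "blinfun_apply (D f x) = f'"
  using assms unfolding D_def
  by (metis bounded_linear_Blinfun_apply frechet_derivative_at has_derivative_bounded_linear)

lemma D_apply: "(f has_derivative f') (at x) \<Longrightarrow> D f x v = f' v"
  by (simp add: D_unique)

lemma D_eq:
  assumes "(f has_derivative blinfun_apply F) (at x)"
  shows "D f x = F"
  using D_unique[OF assms] blinfun_apply_inject by blast

lemma C1_onI:
  assumes "\<And>x. x \<in> S \<Longrightarrow> (f has_derivative blinfun_apply (F x)) (at x)"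
    and "continuous_on S F"
  shows "C1_on S f"
proof -
  have *: "D f x = F x" if "x \<in> S" for x using D_eq[OF assms(1)[OF that]] .
  have "continuous_on S (D f)" using continuous_on_cong[of S S "D f" F] * assms(2) by blast
  then show ?thesis using assms(1) * unfolding C1_on_def by simp
qed

lemma C1_onD:
  assumes "C1_on S f"
  shows "x \<in> S \<Longrightarrow> (f has_derivative D f x) (at x)" "continuous_on S (D f)" "continuous_on S f"
  using assms unfolding C1_on_def
  by (auto intro: continuous_at_imp_continuous_on has_derivative_continuous)

lemma has_derivative_cong_on:
  assumes "open S" "x \<in> S" "\<And>y. y \<in> S \<Longrightarrow> f y = g y" "(f has_derivative f') (at x)"
  shows "(g has_derivative f') (at x)"
  using has_derivative_transform_within_open[OF assms(4,1,2)] assms(3) by simp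

lemma C1_on_cong:
  assumes "open S" "\<And>x. x \<in> S \<Longrightarrow> f x = g x" "C1_on S f"
  shows "C1_on S g"
proof (rule C1_onI[where F="D f"])
  show "(g has_derivative blinfun_apply (D f x)) (at x)" if "x \<in> S" for x
    using has_derivative_cong_on[where f=f and g=g, OF assms(1) that _ C1_onD(1)[OF assms(3) that]] assms(2) by simp
qed (rule C1_onD(2)[OF assms(3)])

lemma C2_onI:
  assumes "\<And>x. x \<in> S \<Longrightarrow> (f has_derivative blinfun_apply (F x)) (at x)"
    and "C1_on S F" "open S"
  shows "C2_on S f"
proof -
  have *: "D f x = F x" if "x \<in> S" for x using D_eq[OF assms(1)[OF that]] .
  have "C1_on S (D f)" using C1_on_cong[where f=F and g="D f", OF assms(3) _ assms(2)] * by simp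
  then show ?thesis using assms(1) * unfolding C2_on_def by simp
qed

lemma C2_onD:
  assumes "C2_on S f"
  shows "x \<in> S \<Longrightarrow> (f has_derivative D f x) (at x)" "C1_on S (D f)" "continuous_on S (D f)"
    "continuous_on S f" "C1_on S f"
  using assms C1_onD(3)[of S "D f"] unfolding C2_on_def
  by (auto intro: continuous_at_imp_continuous_on has_derivative_continuous simp: C1_on_def)

lemma C2_on_cong:
  assumes "open S" "\<And>x. x \<in> S \<Longrightarrow> f x = g x" "C2_on S f"
  shows "C2_on S g"
proof (rule C2_onI[where F="D f"])
  show "(g has_derivative blinfun_apply (D f x)) (at x)" if "x \<in> S" for x
    using has_derivative_cong_on[where f=f and g=g, OF assms(1) that _ C2_onD(1)[OF assms(3) that]] assms(2) by simp
qed (simp_all add: C2_onD(2)[OF assms(3)] assms(1))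

lemma C1_on_subset: "C1_on S f \<Longrightarrow> T \<subseteq> S \<Longrightarrow> C1_on T f"
  unfolding C1_on_def using continuous_on_subset by blast

lemma C2_on_subset: "C2_on S f \<Longrightarrow> T \<subseteq> S \<Longrightarrow> C2_on T f"
  unfolding C2_on_def using C1_on_subset by blast

lemma C1_on_linear:
  assumes "bounded_linear f"
  shows "C1_on S f"
proof (rule C1_onI[where F="\<lambda>x. Blinfun f"])
  show "(f has_derivative blinfun_apply (Blinfun f)) (at x)" for x
    by (simp add: bounded_linear_Blinfun_apply[OF assms] bounded_linear_imp_has_derivative assms)
qed simp

lemma C1_on_const: "C1_on S (\<lambda>x. c)"
  by (rule C1_onI[where F="\<lambda>x. 0"]) (auto simp: zero_blinfun.rep_eq[abs_def])

lemma C2_on_linear: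
  assumes "bounded_linear f" "open S"
  shows "C2_on S f"
proof (rule C2_onI[where F="\<lambda>x. Blinfun f"])
  show "(f has_derivative blinfun_apply (Blinfun f)) (at x)" for x
    by (simp add: bounded_linear_Blinfun_apply[OF assms(1)] bounded_linear_imp_has_derivative assms)
qed (auto intro: C1_on_const assms)

lemma C2_on_const: "open S \<Longrightarrow> C2_on S (\<lambda>x. c)"
  by (rule C2_onI[where F="\<lambda>x. 0"]) (auto intro: C1_on_const simp: zero_blinfun.rep_eq[abs_def])

lemma C1_on_compose:
  assumes "C1_on T g" "C1_on S f" "\<And>x. x \<in> S \<Longrightarrow> f x \<in> T"
  shows "C1_on S (\<lambda>x. g (f x))"
proof (rule C1_onI[where F="\<lambda>x. D g (f x) o\<^sub>L D f x"])
  fix x assume x: "x \<in> S"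
  have "(g has_derivative D g (f x)) (at (f x))" using C1_onD(1)[OF assms(1)] assms(3) x by blast
  from has_derivative_compose[OF C1_onD(1)[OF assms(2) x] this]
  show "((\<lambda>x. g (f x)) has_derivative blinfun_apply (D g (f x) o\<^sub>L D f x)) (at x)"
    by (simp add: blinfun_apply_blinfun_compose[abs_def] o_def)
next
  have "continuous_on S (\<lambda>x. D g (f x))"
    using continuous_on_compose2[OF C1_onD(2)[OF assms(1)] C1_onD(3)[OF assms(2)]] assms(3) by blast
  then show "continuous_on S (\<lambda>x. D g (f x) o\<^sub>L D f x)"
    using C1_onD(2)[OF assms(2)] by (intro continuous_intros)
qed

lemma (in bounded_bilinear) C1_on_bilinear:
  assumes "C1_on S f" "C1_on S g"
  shows "C1_on S (\<lambda>x. prod (f x) (g x))"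
proof (rule C1_onI[where F="\<lambda>x. (prod_right (f x) o\<^sub>L D g x) + (prod_left (g x) o\<^sub>L D f x)"])
  fix x assume x: "x \<in> S"
  show "((\<lambda>x. prod (f x) (g x)) has_derivative
      blinfun_apply ((prod_right (f x) o\<^sub>L D g x) + (prod_left (g x) o\<^sub>L D f x))) (at x)"
    using FDERIV[OF C1_onD(1)[OF assms(1) x] C1_onD(1)[OF assms(2) x]]
    by (rule has_derivative_eq_rhs)
       (auto simp: blinfun.bilinear_simps prod_right.rep_eq prod_left.rep_eq)
next
  show "continuous_on S (\<lambda>x. (prod_right (f x) o\<^sub>L D g x) + (prod_left (g x) o\<^sub>L D f x))"
    using C1_onD(2,3)[OF assms(1)] C1_onD(2,3)[OF assms(2)]
    by (intro continuous_intros bounded_linear.continuous_on[OF bounded_linear_prod_right]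
        bounded_linear.continuous_on[OF bounded_linear_prod_left])
qed

lemma C2_on_compose:
  assumes "C2_on T g" "C2_on S f" "\<And>x. x \<in> S \<Longrightarrow> f x \<in> T" "open S"
  shows "C2_on S (\<lambda>x. g (f x))"
proof (rule C2_onI[where F="\<lambda>x. D g (f x) o\<^sub>L D f x"])
  fix x assume x: "x \<in> S"
  have "(g has_derivative D g (f x)) (at (f x))" using C2_onD(1)[OF assms(1)] assms(3) x by blast
  from has_derivative_compose[OF C2_onD(1)[OF assms(2) x] this]
  show "((\<lambda>x. g (f x)) has_derivative blinfun_apply (D g (f x) o\<^sub>L D f x)) (at x)"
    by (simp add: blinfun_apply_blinfun_compose[abs_def] o_def)
next
  have "C1_on S (\<lambda>x. D g (f x))"
    using C1_on_compose[OF C2_onD(2)[OF assms(1)] C2_onD(5)[OF assms(2)] assms(3)] .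
  then show "C1_on S (\<lambda>x. D g (f x) o\<^sub>L D f x)"
    by (rule bounded_bilinear.C1_on_bilinear[OF bounded_bilinear_blinfun_compose _ C2_onD(2)[OF assms(2)]])
qed fact

lemma C1_on_add:
  assumes "C1_on S f" "C1_on S g" shows "C1_on S (\<lambda>x. f x + g x)"
proof (rule C1_onI[where F="\<lambda>x. D f x + D g x"])
  show "((\<lambda>x. f x + g x) has_derivative blinfun_apply (D f x + D g x)) (at x)" if "x \<in> S" for x
    using has_derivative_add[OF C1_onD(1)[OF assms(1) that] C1_onD(1)[OF assms(2) that]]
    by (simp add: plus_blinfun.rep_eq)
  show "continuous_on S (\<lambda>x. D f x + D g x)"
    by (intro continuous_on_add C1_onD(2) assms)
qed

lemma C1_on_linear_compose:
  assumes "bounded_linear h" "C1_on S f" shows "C1_on S (\<lambda>x. h (f x))"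
  using C1_on_compose[OF C1_on_linear[OF assms(1), of UNIV] assms(2)] by simp

lemma C2_on_linear_compose:
  assumes "bounded_linear h" "C2_on S f" "open S" shows "C2_on S (\<lambda>x. h (f x))"
  using C2_on_compose[OF C2_on_linear[OF assms(1) open_UNIV] assms(2) _ assms(3)] by simp

lemma C1_on_sum:
  assumes "finite I" "\<And>i. i \<in> I \<Longrightarrow> C1_on S (f i)"
  shows "C1_on S (\<lambda>x. \<Sum>i\<in>I. f i x)"
  using assms by (induction I rule: finite_induct) (auto intro: C1_on_const C1_on_add)

lemma C2_on_add:
  assumes "C2_on S f" "C2_on S g" "open S" shows "C2_on S (\<lambda>x. f x + g x)"
proof (rule C2_onI[where F="\<lambda>x. D f x + D g x"])
  show "((\<lambda>x. f x + g x) has_derivative blinfun_apply (D f x + D g x)) (at x)" if "x \<in> S" for x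
    using has_derivative_add[OF C2_onD(1)[OF assms(1) that] C2_onD(1)[OF assms(2) that]]
    by (simp add: plus_blinfun.rep_eq)
  show "C1_on S (\<lambda>x. D f x + D g x)"
    by (intro C1_on_add C2_onD(2) assms)
qed fact

lemma (in bounded_bilinear) C2_on_bilinear:
  assumes "C2_on S f" "C2_on S g" "open S"
  shows "C2_on S (\<lambda>x. prod (f x) (g x))"
proof (rule C2_onI[where F="\<lambda>x. (prod_right (f x) o\<^sub>L D g x) + (prod_left (g x) o\<^sub>L D f x)"])
  fix x assume x: "x \<in> S"
  show "((\<lambda>x. prod (f x) (g x)) has_derivative
      blinfun_apply ((prod_right (f x) o\<^sub>L D g x) + (prod_left (g x) o\<^sub>L D f x))) (at x)"
    using FDERIV[OF C2_onD(1)[OF assms(1) x] C2_onD(1)[OF assms(2) x]]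
    by (rule has_derivative_eq_rhs)
       (auto simp: blinfun.bilinear_simps prod_right.rep_eq prod_left.rep_eq)
next
  note bounded_bilinear.C1_on_bilinear[OF bounded_bilinear_blinfun_compose]
  from C1_on_add[OF this[OF C1_on_linear_compose[OF bounded_linear_prod_right C2_onD(5)[OF assms(1)]]
        C2_onD(2)[OF assms(2)]] this[OF C1_on_linear_compose[OF bounded_linear_prod_left
        C2_onD(5)[OF assms(2)]] C2_onD(2)[OF assms(1)]]]
  show "C1_on S (\<lambda>x. (prod_right (f x) o\<^sub>L D g x) + (prod_left (g x) o\<^sub>L D f x))" .
qed fact

lemma bounded_linear_inject:
  "bounded_linear (\<lambda>y. (y, 0))" "bounded_linear (\<lambda>y. (0, y))"
  by (auto intro!: bounded_linear_Pair bounded_linear_ident bounded_linear_zero)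

lemma C2_on_Pair:
  assumes "C2_on S f" "C2_on S g" "open S" shows "C2_on S (\<lambda>x. (f x, g x))"
  using C2_on_add[OF C2_on_linear_compose[OF bounded_linear_inject(1) assms(1,3)]
      C2_on_linear_compose[OF bounded_linear_inject(2) assms(2,3)] assms(3)] by simp

lemma C2_on_uminus: "C2_on S f \<Longrightarrow> open S \<Longrightarrow> C2_on S (\<lambda>x. - f x)"
  by (rule C2_on_linear_compose[OF bounded_linear_minus[OF bounded_linear_ident]])

lemma C2_on_diff:
  assumes "C2_on S f" "C2_on S g" "open S" shows "C2_on S (\<lambda>x. f x - g x)"
  using C2_on_add[OF assms(1) C2_on_uminus[OF assms(2,3)] assms(3)] by simp

lemmas C2_on_scaleR = bounded_bilinear.C2_on_bilinear[OF bounded_bilinear_scaleR]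

lemma C2_on_local:
  assumes "\<And>x. x \<in> S \<Longrightarrow> \<exists>T. open T \<and> x \<in> T \<and> C2_on (T \<inter> S) f" "open S"
  shows "C2_on S f"
proof -
  have 1: "(f has_derivative D f x) (at x)" if "x \<in> S" for x
    using assms(1)[OF that] C2_onD(1) that by blast
  have 2: "(D f has_derivative D (D f) x) (at x)" if "x \<in> S" for x
    using assms(1)[OF that] C1_onD(1)[OF C2_onD(2)] that by blast
  have 3: "continuous (at x) (D (D f))" if x: "x \<in> S" for x
  proof -
    obtain T where "open T" "x \<in> T" "C2_on (T \<inter> S) f" using assms(1)[OF x] by blast
    moreover then have "continuous_on (T \<inter> S) (D (D f))" using C1_onD(2)[OF C2_onD(2)] by blast
    ultimately show ?thesis using continuous_on_eq_continuous_at[of "T \<inter> S"] assms(2) x by auto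
  qed
  show ?thesis unfolding C2_on_def C1_on_def using 1 2 3 by (auto intro: continuous_at_imp_continuous_on)
qed

text \<open>
  Two applications of the mean value theorem to the second difference on a small parallelogram,
  which is symmetric in \<open>v\<close> and \<open>w\<close>; this yields the symmetry of second derivatives below.
\<close>

lemma second_difference_mvt:
  fixes f :: "'a::real_normed_vector \<Rightarrow> real"
  assumes "\<And>a b. a \<in> {0..h} \<Longrightarrow> b \<in> {0..h} \<Longrightarrow> x + a *\<^sub>R v + b *\<^sub>R w \<in> S" "C2_on S f" "h > 0"
  shows "\<exists>a\<in>{0..h}. \<exists>b\<in>{0..h}.
     f (x + h *\<^sub>R v + h *\<^sub>R w) - f (x + h *\<^sub>R v) - f (x + h *\<^sub>R w) + f x
       = h * h * (D (D f) (x + a *\<^sub>R v + b *\<^sub>R w) w) v"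
proof -
  define g where "g a = f (x + a *\<^sub>R v + h *\<^sub>R w) - f (x + a *\<^sub>R v)" for a
  have inS: "x + a *\<^sub>R v \<in> S" "x + a *\<^sub>R v + h *\<^sub>R w \<in> S" if "a \<in> {0..h}" for a
    using assms(1)[of a 0] assms(1)[of a h] that assms(3) by auto
  have dg: "(g has_real_derivative D f (x + a *\<^sub>R v + h *\<^sub>R w) v - D f (x + a *\<^sub>R v) v) (at a)"
    if a: "a \<in> {0..h}" for a
  proof -
    have "(g has_derivative (\<lambda>t. D f (x + a *\<^sub>R v + h *\<^sub>R w) (t *\<^sub>R v) - D f (x + a *\<^sub>R v) (t *\<^sub>R v))) (at a)"
      unfolding g_def
      by (rule derivative_eq_intros has_derivative_compose[OF _ C2_onD(1)[OF assms(2)]] inS a refl | simp)+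
    then show ?thesis unfolding has_field_derivative_def
      by (rule has_derivative_eq_rhs) (auto simp: blinfun.bilinear_simps algebra_simps)
  qed
  obtain a where a: "0 < a" "a < h"
    and ga: "g h - g 0 = h * (D f (x + a *\<^sub>R v + h *\<^sub>R w) v - D f (x + a *\<^sub>R v) v)"
    using MVT2[of 0 h g "\<lambda>a. D f (x + a *\<^sub>R v + h *\<^sub>R w) v - D f (x + a *\<^sub>R v) v"] dg assms(3) by auto
  define k where "k b = D f (x + a *\<^sub>R v + b *\<^sub>R w) v" for b
  have dk: "(k has_real_derivative D (D f) (x + a *\<^sub>R v + b *\<^sub>R w) w v) (at b)"
    if b: "b \<in> {0..h}" for b
  proof -
    have S: "x + a *\<^sub>R v + b *\<^sub>R w \<in> S" using assms(1) a b by auto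
    have "((\<lambda>b. x + a *\<^sub>R v + b *\<^sub>R w) has_derivative (\<lambda>t. t *\<^sub>R w)) (at b)"
      by (auto intro!: derivative_eq_intros)
    from has_derivative_compose[OF this C1_onD(1)[OF C2_onD(2)[OF assms(2)] S]]
    have "((\<lambda>b. D f (x + a *\<^sub>R v + b *\<^sub>R w)) has_derivative (\<lambda>t. D (D f) (x + a *\<^sub>R v + b *\<^sub>R w) (t *\<^sub>R w))) (at b)" .
    from bounded_linear.has_derivative[OF blinfun.bounded_linear_left this]
    show ?thesis unfolding has_field_derivative_def k_def
      by (rule has_derivative_eq_rhs) (auto simp: blinfun.bilinear_simps algebra_simps)
  qed
  obtain b where b: "0 < b" "b < h" and kb: "k h - k 0 = h * D (D f) (x + a *\<^sub>R v + b *\<^sub>R w) w v"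
    using MVT2[of 0 h k "\<lambda>b. D (D f) (x + a *\<^sub>R v + b *\<^sub>R w) w v"] dk assms(3) by auto
  have "f (x + h *\<^sub>R v + h *\<^sub>R w) - f (x + h *\<^sub>R v) - f (x + h *\<^sub>R w) + f x = g h - g 0"
    unfolding g_def by simp
  also have "\<dots> = h * (k h - k 0)" unfolding ga k_def by simp
  also have "\<dots> = h * h * (D (D f) (x + a *\<^sub>R v + b *\<^sub>R w) w) v" unfolding kb by simp
  finally show ?thesis using a b by (intro bexI[of _ a] bexI[of _ b]) auto
qed

lemma second_derivative_symmetric_real:
  fixes f :: "'a::real_normed_vector \<Rightarrow> real"
  assumes "C2_on S f" "open S" "x \<in> S"
  shows "(D (D f) x v) w = (D (D f) x w) v"
proof (rule ccontr)
  let ?A = "D (D f)"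
  define e where "e = \<bar>?A x v w - ?A x w v\<bar> / 3"
  assume "?A x v w \<noteq> ?A x w v"
  then have e: "e > 0" unfolding e_def by simp
  have c: "continuous (at x) (\<lambda>y. ?A y v w)" "continuous (at x) (\<lambda>y. ?A y w v)"
    using C1_onD(2)[OF C2_onD(2)[OF assms(1)]] assms(2,3)
    by (auto simp: continuous_on_eq_continuous_at intro!: continuous_intros)
  have "\<forall>\<^sub>F y in nhds x. \<bar>?A y v w - ?A x v w\<bar> < e \<and> \<bar>?A y w v - ?A x w v\<bar> < e \<and> y \<in> S"
    using c e assms(2,3) unfolding continuous_at_eps_delta
    by (intro eventually_conj eventually_nhds_in_open) (auto simp: eventually_nhds_metric dist_real_def)
  then obtain d where d: "d > 0" "\<And>y. dist y x < d \<Longrightarrow>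
      \<bar>?A y v w - ?A x v w\<bar> < e \<and> \<bar>?A y w v - ?A x w v\<bar> < e \<and> y \<in> S"
    unfolding eventually_nhds_metric by blast
  define h where "h = d / (2 * (norm v + norm w + 1))"
  have np: "norm v + norm w + 1 > 0" by (smt (verit) norm_ge_zero)
  have h: "h > 0" unfolding h_def using d np by simp
  have near: "dist (x + a *\<^sub>R v + b *\<^sub>R w) x < d" if "a \<in> {0..h}" "b \<in> {0..h}" for a b
  proof -
    have "norm (a *\<^sub>R v + b *\<^sub>R w) \<le> a * norm v + b * norm w"
      using that norm_triangle_ineq[of "a *\<^sub>R v" "b *\<^sub>R w"] by simp
    also have "\<dots> \<le> h * norm v + h * norm w" using that by (intro add_mono mult_right_mono) auto
    also have "\<dots> < h * (2 * (norm v + norm w + 1))" using h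
      by (simp add: algebra_simps add_strict_increasing add_nonneg_pos)
    also have "\<dots> = d" unfolding h_def using np by simp
    finally show ?thesis by (simp add: dist_norm add.assoc)
  qed
  have near': "dist (x + a *\<^sub>R w + b *\<^sub>R v) x < d" if "a \<in> {0..h}" "b \<in> {0..h}" for a b
    using near[OF that(2,1)] by (simp add: algebra_simps)
  obtain a b where 1: "a \<in> {0..h}" "b \<in> {0..h}"
    "f (x + h *\<^sub>R v + h *\<^sub>R w) - f (x + h *\<^sub>R v) - f (x + h *\<^sub>R w) + f x
       = h * h * (?A (x + a *\<^sub>R v + b *\<^sub>R w) w) v"
    using second_difference_mvt[OF _ assms(1) h, of x v w] near d(2) by meson
  obtain a' b' where 2: "a' \<in> {0..h}" "b' \<in> {0..h}"
    "f (x + h *\<^sub>R w + h *\<^sub>R v) - f (x + h *\<^sub>R w) - f (x + h *\<^sub>R v) + f x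
       = h * h * (?A (x + a' *\<^sub>R w + b' *\<^sub>R v) v) w"
    using second_difference_mvt[OF _ assms(1) h, of x w v] near' d(2) by meson
  have "h * h * (?A (x + a *\<^sub>R v + b *\<^sub>R w) w) v = h * h * (?A (x + a' *\<^sub>R w + b' *\<^sub>R v) v) w"
    using 1(3) 2(3) by (simp add: algebra_simps)
  then have "?A (x + a *\<^sub>R v + b *\<^sub>R w) w v = ?A (x + a' *\<^sub>R w + b' *\<^sub>R v) v w" using h by simp
  then show False using d(2)[OF near[OF 1(1,2)]] d(2)[OF near'[OF 2(1,2)]] e unfolding e_def
    by argo
qed

lemma second_derivative_symmetric:
  fixes f :: "'a::real_normed_vector \<Rightarrow> 'b::real_inner"
  assumes "C2_on S f" "open S" "x \<in> S"
  shows "(D (D f) x v) w = (D (D f) x w) v"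
proof -
  have "(D (D f) x v) w \<bullet> b = (D (D f) x w) v \<bullet> b" for b
  proof -
    have C2: "C2_on S (\<lambda>y. f y \<bullet> b)"
      by (rule C2_on_linear_compose[OF bounded_linear_inner_left assms(1,2)])
    have D1: "D (\<lambda>y. f y \<bullet> b) y = blinfun_inner_left b o\<^sub>L D f y" if "y \<in> S" for y
      by (rule D_eq) (use bounded_linear.has_derivative[OF bounded_linear_inner_left C2_onD(1)[OF assms(1) that]] in
        \<open>simp add: blinfun_apply_blinfun_compose[abs_def] blinfun_inner_left.rep_eq\<close>)
    have "((\<lambda>y. blinfun_inner_left b o\<^sub>L D f y) has_derivative (\<lambda>v. blinfun_inner_left b o\<^sub>L D (D f) x v)) (at x)"
      by (rule bounded_linear.has_derivative[OF bounded_bilinear.bounded_linear_right[OF bounded_bilinear_blinfun_compose]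
            C1_onD(1)[OF C2_onD(2)[OF assms(1)] assms(3)]])
    then have "(D (\<lambda>y. f y \<bullet> b) has_derivative (\<lambda>v. blinfun_inner_left b o\<^sub>L D (D f) x v)) (at x)"
      using has_derivative_cong_on[where g="D (\<lambda>y. f y \<bullet> b)" and f="\<lambda>y. blinfun_inner_left b o\<^sub>L D f y", OF assms(2,3)] D1 by simp
    then have *: "D (D (\<lambda>y. f y \<bullet> b)) x v = blinfun_inner_left b o\<^sub>L D (D f) x v" for v
      using D_unique by metis
    show ?thesis using second_derivative_symmetric_real[OF C2 assms(2,3), of v w]
      unfolding * by (simp add: blinfun_inner_left.rep_eq)
  qed
  then show ?thesis using vector_eq_rdot by blast
qed

section \<open>Functions defined implicitly\<close>

definition blinfun_inv :: "('a::euclidean_space \<Rightarrow>\<^sub>L 'a) \<Rightarrow> 'a \<Rightarrow>\<^sub>L 'a"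
  where "blinfun_inv A = Blinfun (inv (blinfun_apply A))"

lemma blinfun_inv:
  fixes A :: "'a::euclidean_space \<Rightarrow>\<^sub>L 'a"
  assumes "inj (blinfun_apply A)"
  shows "blinfun_inv A o\<^sub>L A = id_blinfun" "A o\<^sub>L blinfun_inv A = id_blinfun"
proof -
  have lin: "linear (blinfun_apply A)" by (rule bounded_linear.linear[OF blinfun.bounded_linear_right])
  have bij: "bij (blinfun_apply A)" using assms linear_inj_imp_surj[OF lin] by (simp add: bij_def)
  have "bounded_linear (inv (blinfun_apply A))"
    using lin assms inj_linear_imp_inv_linear linear_conv_bounded_linear by blast
  then have "blinfun_apply (blinfun_inv A) = inv (blinfun_apply A)"
    unfolding blinfun_inv_def by (rule bounded_linear_Blinfun_apply)
  then show "blinfun_inv A o\<^sub>L A = id_blinfun" "A o\<^sub>L blinfun_inv A = id_blinfun"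
    using bij by (auto intro!: blinfun_eqI simp: bij_is_inj bij_is_surj surj_f_inv_f)
qed

lemma blinfun_inv_apply:
  fixes A :: "'a::euclidean_space \<Rightarrow>\<^sub>L 'a"
  assumes "inj (blinfun_apply A)"
  shows "blinfun_inv A (A x) = x" "A (blinfun_inv A x) = x"
  using blinfun_inv[OF assms] by (metis blinfun_apply_blinfun_compose blinfun_apply_id_blinfun)+

lemma tendsto_blinfun_inv:
  fixes A :: "'b \<Rightarrow> 'a::euclidean_space \<Rightarrow>\<^sub>L 'a"
  assumes "(A \<longlongrightarrow> A0) F" "inj (blinfun_apply A0)" "\<forall>\<^sub>F y in F. inj (blinfun_apply (A y))"
  shows "((\<lambda>y. blinfun_inv (A y)) \<longlongrightarrow> blinfun_inv A0) F"
proof -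
  let ?B = "\<lambda>y. blinfun_inv (A y)"
  have "linear (blinfun_apply A0)" by (rule bounded_linear.linear[OF blinfun.bounded_linear_right])
  then obtain m where m: "m > 0" "\<And>x. m * norm x \<le> norm (A0 x)"
    using linear_inj_bounded_below_pos assms(2) by blast
  have ev: "\<forall>\<^sub>F y in F. dist (A y) A0 < m / 2" using assms(1) m(1) by (intro tendstoD) auto
  have bd: "\<forall>\<^sub>F y in F. norm (?B y) \<le> 2 / m"
    using ev assms(3)
  proof eventually_elim
    case (elim y)
    have below: "m / 2 * norm x \<le> norm (A y x)" for x
    proof -
      have "norm (A0 x) \<le> norm (A y x) + norm ((A0 - A y) x)"
        by (metis add.commute blinfun.diff_left diff_add_cancel norm_triangle_ineq)
      moreover have "norm ((A0 - A y) x) \<le> m / 2 * norm x"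
        using norm_blinfun[of "A0 - A y" x] elim(1) mult_right_mono[of "norm (A0 - A y)" "m/2" "norm x"]
        by (simp add: dist_norm norm_minus_commute)
      ultimately show ?thesis using m(2)[of x] by simp
    qed
    show ?case
    proof (rule norm_blinfun_bound)
      fix x
      have "m / 2 * norm (?B y x) \<le> norm (A y (?B y x))" by (rule below)
      also have "A y (?B y x) = x" using blinfun_inv(2)[OF elim(2)]
        by (metis blinfun_apply_blinfun_compose blinfun_apply_id_blinfun)
      finally show "norm (?B y x) \<le> 2 / m * norm x" using m(1) by (simp add: field_simps)
    qed (use m in simp)
  qed
  have eq: "\<forall>\<^sub>F y in F. ?B y - blinfun_inv A0 = ?B y o\<^sub>L ((A0 - A y) o\<^sub>L blinfun_inv A0)"
    using assms(3)
  proof eventually_elim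
    case (elim y)
    show ?case
      by (intro blinfun_eqI)
         (simp add: blinfun.bilinear_simps blinfun_inv_apply[OF elim] blinfun_inv_apply[OF assms(2)])
  qed
  have "((\<lambda>y. norm (?B y o\<^sub>L ((A0 - A y) o\<^sub>L blinfun_inv A0))) \<longlongrightarrow> 0) F"
  proof (rule tendsto_sandwich[OF _ _ tendsto_const])
    show "\<forall>\<^sub>F y in F. norm (?B y o\<^sub>L ((A0 - A y) o\<^sub>L blinfun_inv A0))
        \<le> 2 / m * (norm (A0 - A y) * norm (blinfun_inv A0))"
      using bd
    proof eventually_elim
      case (elim y)
      show ?case
        by (rule order_trans[OF norm_blinfun_compose], rule mult_mono[OF elim norm_blinfun_compose]) (use m in simp_all)
    qed
    have "((\<lambda>y. 2 / m * (norm (A0 - A y) * norm (blinfun_inv A0))) \<longlongrightarrow>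
        2 / m * (norm (A0 - A0) * norm (blinfun_inv A0))) F"
      by (intro tendsto_intros assms)
    then show "((\<lambda>y. 2 / m * (norm (A0 - A y) * norm (blinfun_inv A0))) \<longlongrightarrow> 0) F" by simp
  qed simp
  then have "((\<lambda>y. ?B y o\<^sub>L ((A0 - A y) o\<^sub>L blinfun_inv A0)) \<longlongrightarrow> 0) F"
    by (simp add: tendsto_norm_zero_iff)
  then have "((\<lambda>y. ?B y - blinfun_inv A0) \<longlongrightarrow> 0) F" using eq by (simp cong: tendsto_cong)
  then show ?thesis by (simp add: LIM_zero_iff)
qed

text \<open>
  With \<open>B = A\<^sup>-\<^sup>1\<close> one has \<open>B z - B y = - B z (A z - A y) B y\<close>. Since \<open>B\<close> is continuous, replacing
  the first factor by \<open>B y\<close> changes the right-hand side by \<open>o(z - y)\<close>.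
\<close>

lemma C1_on_blinfun_inv:
  fixes A :: "'b::real_normed_vector \<Rightarrow> 'a::euclidean_space \<Rightarrow>\<^sub>L 'a"
  assumes "C1_on S A" "open S" "\<And>y. y \<in> S \<Longrightarrow> inj (blinfun_apply (A y))"
  shows "C1_on S (\<lambda>y. blinfun_inv (A y))"
proof -
  let ?B = "\<lambda>y. blinfun_inv (A y)"
  define F where "F y = - (bounded_bilinear.prod_right (o\<^sub>L) (?B y) o\<^sub>L (bounded_bilinear.prod_left (o\<^sub>L) (?B y) o\<^sub>L D A y))" for y
  have cont: "continuous (at y) ?B" if "y \<in> S" for y
    unfolding continuous_within
  proof (rule tendsto_blinfun_inv)
    show "(A \<longlongrightarrow> A y) (at y)"
      using C1_onD(3)[OF assms(1)] that assms(2)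
      by (metis continuous_at continuous_on_eq_continuous_at)
    show "\<forall>\<^sub>F z in at y. inj (blinfun_apply (A z))"
      using eventually_at_in_open'[OF assms(2) that] assms(3) by (auto elim: eventually_mono)
  qed (use assms that in auto)
  show ?thesis
  proof (rule C1_onI[where F=F])
    fix y assume y: "y \<in> S"
    define Q where "Q z = (A z - A y) o\<^sub>L ?B y" for z
    have Q0: "Q y = 0" unfolding Q_def by simp
    have dQ: "(Q has_derivative (\<lambda>h. D A y h o\<^sub>L ?B y)) (at y)"
      unfolding Q_def
      by (rule derivative_eq_intros bounded_bilinear.FDERIV[OF bounded_bilinear_blinfun_compose]
          C1_onD(1)[OF assms(1) y] refl | simp)+
    have rep: "?B z - ?B y = - (?B z o\<^sub>L Q z)" if "z \<in> S" for z
      unfolding Q_def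
      by (intro blinfun_eqI)
         (simp add: blinfun.bilinear_simps blinfun_inv_apply[OF assms(3)[OF that]] blinfun_inv_apply[OF assms(3)[OF y]])
    have "((\<lambda>z. - ((?B z - ?B y) o\<^sub>L Q z)) has_derivative (\<lambda>h. 0)) (at y)"
    proof -
      have lim: "((\<lambda>z. norm (?B z - ?B y) * (norm (Q z) / norm (z - y))) \<longlongrightarrow> 0) (at y)"
      proof -
        have b: "\<forall>\<^sub>F z in at y. norm (Q z) / norm (z - y) \<le> onorm (\<lambda>h. D A y h o\<^sub>L ?B y) + 1"
        proof -
          have "((\<lambda>z. (Q z - Q y - (D A y (z - y) o\<^sub>L ?B y)) /\<^sub>R norm (z - y)) \<longlongrightarrow> 0) (at y)"
            using dQ unfolding has_derivative_at_within by blast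
          from tendsto_norm[OF this]
          have "((\<lambda>z. norm (Q z - Q y - (D A y (z - y) o\<^sub>L ?B y)) / norm (z - y)) \<longlongrightarrow> 0) (at y)"
            by (simp add: divide_inverse mult.commute)
          then have "\<forall>\<^sub>F z in at y. norm (Q z - Q y - (D A y (z - y) o\<^sub>L ?B y)) / norm (z - y) < 1"
            by (rule order_tendstoD) simp
          moreover have "\<forall>\<^sub>F z in at y. z \<noteq> y" by (simp add: eventually_neq_at_within)
          ultimately show ?thesis
          proof eventually_elim
            case (elim z)
            have "norm (Q z) \<le> norm (D A y (z - y) o\<^sub>L ?B y) + norm (Q z - Q y - (D A y (z - y) o\<^sub>L ?B y))"
              using norm_triangle_sub[of "Q z" "D A y (z - y) o\<^sub>L ?B y"] by (simp add: Q0)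
            also have "norm (D A y (z - y) o\<^sub>L ?B y) \<le> onorm (\<lambda>h. D A y h o\<^sub>L ?B y) * norm (z - y)"
              by (rule onorm[OF has_derivative_bounded_linear[OF dQ]])
            finally show ?case using elim by (simp add: field_simps)
          qed
        qed
        have z: "((\<lambda>z. norm (?B z - ?B y) * (onorm (\<lambda>h. D A y h o\<^sub>L ?B y) + 1)) \<longlongrightarrow> 0) (at y)"
        proof -
          have "((\<lambda>z. norm (?B z - ?B y) * (onorm (\<lambda>h. D A y h o\<^sub>L ?B y) + 1)) \<longlongrightarrow>
            norm (?B y - ?B y) * (onorm (\<lambda>h. D A y h o\<^sub>L ?B y) + 1)) (at y)"
            using cont[OF y] unfolding continuous_within by (intro tendsto_intros)
          then show ?thesis by simp
        qed
        show ?thesis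
        proof (rule tendsto_sandwich[OF _ _ tendsto_const z])
          show "\<forall>\<^sub>F z in at y. norm (?B z - ?B y) * (norm (Q z) / norm (z - y))
              \<le> norm (?B z - ?B y) * (onorm (\<lambda>h. D A y h o\<^sub>L ?B y) + 1)"
            using b by (rule eventually_mono) (intro mult_left_mono norm_ge_zero)
        qed simp
      qed
      have "((\<lambda>z. norm (- ((?B z - ?B y) o\<^sub>L Q z)) / norm (z - y)) \<longlongrightarrow> 0) (at y)"
      proof (rule tendsto_sandwich[OF _ _ tendsto_const lim])
        show "\<forall>\<^sub>F z in at y. norm (- ((?B z - ?B y) o\<^sub>L Q z)) / norm (z - y)
            \<le> norm (?B z - ?B y) * (norm (Q z) / norm (z - y))"
        proof (rule always_eventually, rule allI)
          fix z
          have "norm ((?B z - ?B y) o\<^sub>L Q z) / norm (z - y) \<le> norm (?B z - ?B y) * norm (Q z) / norm (z - y)"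
            by (intro divide_right_mono norm_blinfun_compose norm_ge_zero)
          then show "norm (- ((?B z - ?B y) o\<^sub>L Q z)) / norm (z - y)
            \<le> norm (?B z - ?B y) * (norm (Q z) / norm (z - y))" by simp
        qed
      qed simp
      then have n0: "((\<lambda>z. norm ((- ((?B z - ?B y) o\<^sub>L Q z)) /\<^sub>R norm (z - y))) \<longlongrightarrow> 0) (at y)"
        by (simp add: divide_inverse mult.commute)
      show ?thesis
      proof (rule has_derivativeI[OF bounded_linear_zero])
        show "((\<lambda>z. (- ((?B z - ?B y) o\<^sub>L Q z) - - ((?B y - ?B y) o\<^sub>L Q y) - 0) /\<^sub>R norm (z - y)) \<longlongrightarrow> 0) (at y)"
          using tendsto_norm_zero_cancel[OF n0] unfolding Q0 by simp
      qed
    qed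
    from has_derivative_diff[OF this has_derivative_compose[OF dQ bounded_linear_imp_has_derivative[OF
      bounded_bilinear.bounded_linear_right[OF bounded_bilinear_blinfun_compose, of "?B y"]]]]
    have "((\<lambda>z. - (?B z o\<^sub>L Q z)) has_derivative (\<lambda>h. - (?B y o\<^sub>L (D A y h o\<^sub>L ?B y)))) (at y)"
      by (simp add: bounded_bilinear.diff_left[OF bounded_bilinear_blinfun_compose])
    from has_derivative_add[OF this has_derivative_const[of "?B y"]]
    have "((\<lambda>z. - (?B z o\<^sub>L Q z) + ?B y) has_derivative F y) (at y)"
      by (rule has_derivative_eq_rhs)
         (auto simp: F_def blinfun.bilinear_simps bounded_bilinear.prod_right.rep_eq[OF bounded_bilinear_blinfun_compose] bounded_bilinear.prod_left.rep_eq[OF bounded_bilinear_blinfun_compose])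
    then show "(?B has_derivative F y) (at y)"
      by (rule has_derivative_cong_on[OF assms(2) y, rotated]) (metis rep diff_add_cancel)
  next
    have c: "continuous_on S ?B" using cont by (auto intro: continuous_at_imp_continuous_on)
    show "continuous_on S F" unfolding F_def
      by (intro continuous_intros C1_onD(2)[OF assms(1)]
          bounded_linear.continuous_on[OF bounded_bilinear.bounded_linear_prod_left[OF bounded_bilinear_blinfun_compose] c]
          bounded_linear.continuous_on[OF bounded_bilinear.bounded_linear_prod_right[OF bounded_bilinear_blinfun_compose] c])
  qed
qed

text \<open>
  As \<open>w\<close> is given and continuous, only its regularity is at stake. It agrees locally with the inverse
  of \<open>\<Theta>\<close> composed with \<open>G\<close>, and its derivative \<open>D \<Theta> (w y)\<^sup>-\<^sup>1 D G y\<close> is then as regular as claimed.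
\<close>

lemma implicit_C2:
  fixes \<Theta> :: "'a::euclidean_space \<Rightarrow> 'a" and w G :: "'b::real_normed_vector \<Rightarrow> 'a"
  assumes \<Theta>: "C2_on S \<Theta>" "open S" "\<And>z. z \<in> S \<Longrightarrow> inj (blinfun_apply (D \<Theta> z))"
    and w: "open T" "continuous_on T w" "\<And>y. y \<in> T \<Longrightarrow> w y \<in> S"
    and G: "C2_on T G" "\<And>y. y \<in> T \<Longrightarrow> \<Theta> (w y) = G y"
  shows "C2_on T w" "\<And>y v. y \<in> T \<Longrightarrow> D \<Theta> (w y) (D w y v) = D G y v"
proof -
  define F where "F y = blinfun_inv (D \<Theta> (w y)) o\<^sub>L D G y" for y
  have dw: "(w has_derivative F y) (at y)" if y: "y \<in> T" for y
  proof -
    have inj: "inj (blinfun_apply (D \<Theta> (w y)))" using \<Theta>(3) w(3) y by blast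
    obtain U' V g g' where U': "open U'" "U' \<subseteq> S" "w y \<in> U'" "open V" "\<Theta> (w y) \<in> V"
      and hom: "homeomorphism U' V \<Theta> g"
      and g: "\<And>z. z \<in> V \<Longrightarrow> (g has_derivative (g' z)) (at z)"
        "\<And>z. z \<in> V \<Longrightarrow> g' z = inv (blinfun_apply (D \<Theta> (g z)))"
      using inverse_function_theorem[OF \<Theta>(2) C2_onD(1)[OF \<Theta>(1)] C2_onD(3)[OF \<Theta>(1)] w(3)[OF y] blinfun_inv(1)[OF inj]]
      by metis
    have gw: "g (\<Theta> (w y)) = w y" using hom U'(3) by (simp add: homeomorphism_def)
    have "g' (G y) = inv (blinfun_apply (D \<Theta> (w y)))" using g(2)[OF U'(5)] gw G(2)[OF y] by simp
    moreover have "inv (blinfun_apply (D \<Theta> (w y))) = blinfun_inv (D \<Theta> (w y))"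
      by (rule ext, rule inv_f_eq[OF inj]) (simp add: blinfun_inv_apply[OF inj])
    ultimately have "(g has_derivative blinfun_inv (D \<Theta> (w y))) (at (G y))"
      using g(1)[OF U'(5)] G(2)[OF y] by simp
    from has_derivative_compose[OF C2_onD(1)[OF G(1) y] this]
    have d: "((\<lambda>z. g (G z)) has_derivative F y) (at y)"
      unfolding F_def by (simp add: blinfun_apply_blinfun_compose[abs_def])
    have o: "open (T \<inter> w -` U')" using w(1,2) U'(1) by (simp add: continuous_open_preimage)
    show ?thesis
      by (rule has_derivative_cong_on[OF o _ _ d])
         (use y U'(3) G(2) hom in \<open>auto simp: homeomorphism_def\<close>)
  qed
  have C1w: "C1_on T w"
  proof (rule C1_onI[OF dw])
    have "continuous_on T (\<lambda>y. blinfun_inv (D \<Theta> (w y)))"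
    proof -
      have c: "continuous_on T (\<lambda>y. D \<Theta> (w y))"
        using continuous_on_compose2[OF C2_onD(3)[OF \<Theta>(1)] w(2)] w(3) by blast
      show ?thesis unfolding continuous_on_def
      proof
        fix y assume y: "y \<in> T"
        show "((\<lambda>y. blinfun_inv (D \<Theta> (w y))) \<longlongrightarrow> blinfun_inv (D \<Theta> (w y))) (at y within T)"
          by (rule tendsto_blinfun_inv)
             (use c y \<Theta>(3) w(3) in \<open>auto simp: continuous_on_def eventually_at_filter\<close>)
      qed
    qed
    then show "continuous_on T F" unfolding F_def using C2_onD(3)[OF G(1)] by (intro continuous_intros)
  qed
  have "C1_on T (\<lambda>y. D \<Theta> (w y))" using C1_on_compose[OF C2_onD(2)[OF \<Theta>(1)] C1w w(3)] .
  then have "C1_on T (\<lambda>y. blinfun_inv (D \<Theta> (w y)))"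
    by (rule C1_on_blinfun_inv[OF _ w(1)]) (use \<Theta>(3) w(3) in blast)
  then have "C1_on T F" unfolding F_def
    by (rule bounded_bilinear.C1_on_bilinear[OF bounded_bilinear_blinfun_compose _ C2_onD(2)[OF G(1)]])
  then show "C2_on T w" using C2_onI[OF dw _ w(1)] by blast
  show "D \<Theta> (w y) (D w y v) = D G y v" if y: "y \<in> T" for y v
    using D_eq[OF dw[OF y]] blinfun_inv(2)[OF \<Theta>(3)[OF w(3)[OF y]]] unfolding F_def
    by (metis blinfun_apply_blinfun_compose blinfun_apply_id_blinfun)
qed

section \<open>Stokes' theorem on a box\<close>

text \<open>
  The value of the pulled back form \<open>\<sigma>\<^sup>*\<omega>\<close> on constant vector fields.
\<close>

definition pull :: "('a::real_normed_vector \<Rightarrow> 'a \<Rightarrow>\<^sub>L 'a \<Rightarrow>\<^sub>L real) \<Rightarrow> ('b::real_normed_vector \<Rightarrow> 'a) \<Rightarrow> 'b \<Rightarrow> 'b \<Rightarrow> 'b \<Rightarrow> real"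
  where "pull \<omega> \<sigma> u v p = \<omega> (\<sigma> p) (D \<sigma> p u) (D \<sigma> p v)"

lemma pull_C1:
  assumes "C1_on U \<omega>" "C2_on S \<sigma>" "\<And>p. p \<in> S \<Longrightarrow> \<sigma> p \<in> U"
  shows "C1_on S (pull \<omega> \<sigma> u v)"
    "\<And>p w. p \<in> S \<Longrightarrow> D (pull \<omega> \<sigma> u v) p w =
        D \<omega> (\<sigma> p) (D \<sigma> p w) (D \<sigma> p u) (D \<sigma> p v) +
        \<omega> (\<sigma> p) (D (D \<sigma>) p w u) (D \<sigma> p v) + \<omega> (\<sigma> p) (D \<sigma> p u) (D (D \<sigma>) p w v)"
proof -
  have 1: "C1_on S (\<lambda>p. \<omega> (\<sigma> p))" using C1_on_compose[OF assms(1) C2_onD(5)[OF assms(2)] assms(3)] .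
  have 2: "C1_on S (\<lambda>p. D \<sigma> p w)" for w
    by (rule C1_on_linear_compose[OF blinfun.bounded_linear_left C2_onD(2)[OF assms(2)]])
  note b = bounded_bilinear.C1_on_bilinear[OF bounded_bilinear_blinfun_apply]
  show C: "C1_on S (pull \<omega> \<sigma> u v)" unfolding pull_def[abs_def] by (rule b[OF b[OF 1 2] 2])
  fix p w assume p: "p \<in> S"
  have d1: "((\<lambda>p. \<omega> (\<sigma> p)) has_derivative (\<lambda>w. D \<omega> (\<sigma> p) (D \<sigma> p w))) (at p)"
    by (rule has_derivative_compose[OF C2_onD(1)[OF assms(2) p] C1_onD(1)[OF assms(1) assms(3)[OF p]]])
  have d2: "((\<lambda>p. D \<sigma> p a) has_derivative (\<lambda>w. D (D \<sigma>) p w a)) (at p)" for a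
    by (rule bounded_linear.has_derivative[OF blinfun.bounded_linear_left C1_onD(1)[OF C2_onD(2)[OF assms(2)] p]])
  have "(pull \<omega> \<sigma> u v has_derivative (\<lambda>w. \<omega> (\<sigma> p) (D \<sigma> p u) (D (D \<sigma>) p w v) +
     (\<omega> (\<sigma> p) (D (D \<sigma>) p w u) + D \<omega> (\<sigma> p) (D \<sigma> p w) (D \<sigma> p u)) (D \<sigma> p v))) (at p)"
    unfolding pull_def[abs_def]
    by (rule bounded_bilinear.FDERIV[OF bounded_bilinear_blinfun_apply
          bounded_bilinear.FDERIV[OF bounded_bilinear_blinfun_apply d1 d2] d2])
  from fun_cong[OF D_unique[OF this], of w]
  show "D (pull \<omega> \<sigma> u v) p w =
        D \<omega> (\<sigma> p) (D \<sigma> p w) (D \<sigma> p u) (D \<sigma> p v) +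
        \<omega> (\<sigma> p) (D (D \<sigma>) p w u) (D \<sigma> p v) + \<omega> (\<sigma> p) (D \<sigma> p u) (D (D \<sigma>) p w v)"
    by (simp add: blinfun.bilinear_simps)
qed

definition closed_form :: "'a::real_normed_vector set \<Rightarrow> ('a \<Rightarrow> 'a \<Rightarrow>\<^sub>L 'a \<Rightarrow>\<^sub>L real) \<Rightarrow> bool"
  where "closed_form U \<omega> \<longleftrightarrow> C1_on U \<omega> \<and> (\<forall>x\<in>U. \<forall>u. \<omega> x u u = 0) \<and>
    (\<forall>x\<in>U. \<forall>u v w. D \<omega> x u v w + D \<omega> x v w u + D \<omega> x w u v = 0)"

lemma closed_form_skew:
  assumes "closed_form U \<omega>" "x \<in> U"
  shows "\<omega> x u v = - \<omega> x v u"
proof -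
  have "\<omega> x (u + v) (u + v) = 0" "\<omega> x u u = 0" "\<omega> x v v = 0" using assms unfolding closed_form_def by simp_all
  then show ?thesis by (simp add: blinfun.bilinear_simps)
qed

text \<open>
  This is \<open>d(\<sigma>\<^sup>*\<omega>) = \<sigma>\<^sup>*d\<omega> = 0\<close> on constant vector fields. The terms with second derivatives of
  \<open>\<sigma>\<close> cancel in pairs because \<open>\<omega>\<close> is skew.
\<close>

lemma pull_closed:
  fixes \<sigma> :: "'b::real_normed_vector \<Rightarrow> 'a::real_inner"
  assumes "closed_form U \<omega>" "C2_on S \<sigma>" "open S" "\<And>p. p \<in> S \<Longrightarrow> \<sigma> p \<in> U" "p \<in> S"
  shows "D (pull \<omega> \<sigma> u v) p w + D (pull \<omega> \<sigma> v w) p u + D (pull \<omega> \<sigma> w u) p v = 0"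
proof -
  have C: "C1_on U \<omega>" using assms(1) unfolding closed_form_def by simp
  have U: "\<sigma> p \<in> U" using assms by blast
  note sym = second_derivative_symmetric[OF assms(2,3,5)]
  note skew = closed_form_skew[OF assms(1) U]
  have dd: "D \<omega> (\<sigma> p) (D \<sigma> p w) (D \<sigma> p u) (D \<sigma> p v) + D \<omega> (\<sigma> p) (D \<sigma> p u) (D \<sigma> p v) (D \<sigma> p w)
    + D \<omega> (\<sigma> p) (D \<sigma> p v) (D \<sigma> p w) (D \<sigma> p u) = 0"
    using assms(1) U unfolding closed_form_def by blast
  have e: "D (pull \<omega> \<sigma> a b) p c =
        D \<omega> (\<sigma> p) (D \<sigma> p c) (D \<sigma> p a) (D \<sigma> p b) +
        \<omega> (\<sigma> p) (D (D \<sigma>) p c a) (D \<sigma> p b) + \<omega> (\<sigma> p) (D \<sigma> p a) (D (D \<sigma>) p c b)" for a b c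
    using pull_C1(2)[OF C assms(2) _ assms(5)] assms(4) by simp
  show ?thesis
    using e[of u v w] e[of v w u] e[of w u v] dd sym[of u v] sym[of v w] sym[of w u]
      skew[of "D (D \<sigma>) p w u" "D \<sigma> p v"] skew[of "D (D \<sigma>) p u v" "D \<sigma> p w"] skew[of "D (D \<sigma>) p v w" "D \<sigma> p u"]
    by simp
qed

lemma FTC_line:
  fixes g :: "'a::real_normed_vector \<Rightarrow> real"
  assumes "\<And>s. s \<in> {0..S} \<Longrightarrow> (g has_derivative blinfun_apply (g' (p + s *\<^sub>R e))) (at (p + s *\<^sub>R e))" "0 \<le> S"
  shows "((\<lambda>s. g' (p + s *\<^sub>R e) e) has_integral g (p + S *\<^sub>R e) - g p) {0..S}"
proof -
  have "((\<lambda>s. g (p + s *\<^sub>R e)) has_vector_derivative g' (p + s *\<^sub>R e) e) (at s within {0..S})" if "s \<in> {0..S}" for s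
  proof -
    have "((\<lambda>s. p + s *\<^sub>R e) has_derivative (\<lambda>t. t *\<^sub>R e)) (at s)" by (auto intro!: derivative_eq_intros)
    from has_derivative_compose[OF this assms(1)[OF that]]
    have "((\<lambda>s. g (p + s *\<^sub>R e)) has_vector_derivative g' (p + s *\<^sub>R e) e) (at s)"
      unfolding has_vector_derivative_def by (simp add: blinfun.bilinear_simps)
    then show ?thesis by (rule has_vector_derivative_at_within)
  qed
  from fundamental_theorem_of_calculus[OF assms(2) this] show ?thesis by simp
qed

text \<open>
  Each partial derivative is integrated first in its own direction. The
  faces in the third direction are kept apart since they become the areas that are compared
  later.
\<close>

lemma box_divergence:
  fixes G1 G2 G3 :: "real \<times> real \<times> real \<Rightarrow> real"
  assumes C: "C1_on S G1" "C1_on S G2" "C1_on S G3"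
    and box: "{0..R} \<times> {0..T} \<times> {0..Z} \<subseteq> S" "0 \<le> R" "0 \<le> T" "0 \<le> Z"
    and div: "\<And>p. p \<in> S \<Longrightarrow> D G1 p (0,0,1) + D G2 p (1,0,0) + D G3 p (0,1,0) = 0"
  shows "integral {0..R} (\<lambda>r. integral {0..T} (\<lambda>t. G1 (r,t,Z))) - integral {0..R} (\<lambda>r. integral {0..T} (\<lambda>t. G1 (r,t,0)))
    + integral {0..T} (\<lambda>t. integral {0..Z} (\<lambda>s. G2 (R,t,s) - G2 (0,t,s)))
    + integral {0..R} (\<lambda>r. integral {0..Z} (\<lambda>s. G3 (r,T,s) - G3 (r,0,s))) = 0"
proof -
  let ?B = "{0..R} \<times> {0..T} \<times> {0..Z}"
  define g1 where "g1 p = D G1 p (0,0,1)" for p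
  define g2 where "g2 p = D G2 p (1,0,0)" for p
  define g3 where "g3 p = D G3 p (0,1,0)" for p
  have cg: "continuous_on ?B g1" "continuous_on ?B g2" "continuous_on ?B g3"
    unfolding g1_def g2_def g3_def
    by (intro continuous_intros continuous_on_subset[OF C1_onD(2)[OF C(1)] box(1)]
      continuous_on_subset[OF C1_onD(2)[OF C(2)] box(1)] continuous_on_subset[OF C1_onD(2)[OF C(3)] box(1)])+
  have cG: "continuous_on ?B G1" "continuous_on ?B G2" "continuous_on ?B G3"
    by (intro continuous_on_subset[OF C1_onD(3)[OF C(1)] box(1)]
      continuous_on_subset[OF C1_onD(3)[OF C(2)] box(1)] continuous_on_subset[OF C1_onD(3)[OF C(3)] box(1)])+
  have i1: "integral {0..Z} (\<lambda>s. g1 (r,t,s)) = G1 (r,t,Z) - G1 (r,t,0)" if "r \<in> {0..R}" "t \<in> {0..T}" for r t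
    using FTC_line[of Z G1 "D G1" "(r,t,0)" "(0,0,1)"] C1_onD(1)[OF C(1)] box that
    by (auto simp: g1_def subset_iff intro!: integral_unique)
  have i2: "integral {0..R} (\<lambda>r. g2 (r,t,s)) = G2 (R,t,s) - G2 (0,t,s)" if "s \<in> {0..Z}" "t \<in> {0..T}" for s t
    using FTC_line[of R G2 "D G2" "(0,t,s)" "(1,0,0)"] C1_onD(1)[OF C(2)] box that
    by (auto simp: g2_def subset_iff intro!: integral_unique)
  have i3: "integral {0..T} (\<lambda>t. g3 (r,t,s)) = G3 (r,T,s) - G3 (r,0,s)" if "r \<in> {0..R}" "s \<in> {0..Z}" for r s
    using FTC_line[of T G3 "D G3" "(r,0,s)" "(0,1,0)"] C1_onD(1)[OF C(3)] box that
    by (auto simp: g3_def subset_iff intro!: integral_unique)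
  have cb: "cbox (0::real, 0::real) (T, Z) = {0..T} \<times> {0..Z}" "cbox (0::real, 0::real, 0::real) (R, T, Z) = ?B"
    by (auto simp: cbox_Pair_eq)
  have sl: "continuous_on ({0..T} \<times> {0..Z}) (\<lambda>q. g (r, q))" if "continuous_on ?B g" "r \<in> {0..R}" for g :: "real \<times> real \<times> real \<Rightarrow> real" and r
    by (rule continuous_on_compose2[OF that(1)]) (use that(2) in \<open>auto intro!: continuous_intros\<close>)
  have inner: "integral ({0..T} \<times> {0..Z}) (\<lambda>q. g (r, q)) = integral {0..T} (\<lambda>t. integral {0..Z} (\<lambda>s. g (r, t, s)))"
    if "continuous_on ?B g" "r \<in> {0..R}" for g :: "real \<times> real \<times> real \<Rightarrow> real" and r
    using integral_prod_continuous[of 0 0 T Z "\<lambda>q. g (r, q)"] sl[OF that] by (simp add: cb)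
  have inner': "integral {0..T} (\<lambda>t. integral {0..Z} (\<lambda>s. g (r, t, s))) = integral {0..Z} (\<lambda>s. integral {0..T} (\<lambda>t. g (r, t, s)))"
    if "continuous_on ?B g" "r \<in> {0..R}" for g :: "real \<times> real \<times> real \<Rightarrow> real" and r
    using integral_swap_continuous[of 0 0 T Z "\<lambda>t s. g (r, t, s)"] sl[OF that] by (simp add: cb split_def)
  have 1: "integral ?B g1 = integral {0..R} (\<lambda>r. integral {0..T} (\<lambda>t. G1 (r,t,Z) - G1 (r,t,0)))"
  proof -
    have "integral ?B g1 = integral {0..R} (\<lambda>r. integral ({0..T} \<times> {0..Z}) (\<lambda>q. g1 (r, q)))"
      using integral_prod_continuous[of 0 "(0,0)" R "(T,Z)" g1] cg(1) by (simp add: cb)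
    also have "\<dots> = integral {0..R} (\<lambda>r. integral {0..T} (\<lambda>t. integral {0..Z} (\<lambda>s. g1 (r, t, s))))"
      by (intro integral_cong inner cg)
    also have "\<dots> = integral {0..R} (\<lambda>r. integral {0..T} (\<lambda>t. G1 (r,t,Z) - G1 (r,t,0)))"
      by (intro integral_cong i1)
    finally show ?thesis .
  qed
  have 3: "integral ?B g3 = integral {0..R} (\<lambda>r. integral {0..Z} (\<lambda>s. G3 (r,T,s) - G3 (r,0,s)))"
  proof -
    have "integral ?B g3 = integral {0..R} (\<lambda>r. integral ({0..T} \<times> {0..Z}) (\<lambda>q. g3 (r, q)))"
      using integral_prod_continuous[of 0 "(0,0)" R "(T,Z)" g3] cg(3) by (simp add: cb)
    also have "\<dots> = integral {0..R} (\<lambda>r. integral {0..Z} (\<lambda>s. integral {0..T} (\<lambda>t. g3 (r, t, s))))"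
      using inner inner' cg(3) by (intro integral_cong) metis
    also have "\<dots> = integral {0..R} (\<lambda>r. integral {0..Z} (\<lambda>s. G3 (r,T,s) - G3 (r,0,s)))"
      by (intro integral_cong i3)
    finally show ?thesis .
  qed
  have 2: "integral ?B g2 = integral {0..T} (\<lambda>t. integral {0..Z} (\<lambda>s. G2 (R,t,s) - G2 (0,t,s)))"
  proof -
    have c2: "continuous_on ({0..T} \<times> {0..Z}) (\<lambda>q. G2 (r, q))" if "r \<in> {0..R}" for r
      by (rule continuous_on_compose2[OF cG(2)]) (use that in \<open>auto intro!: continuous_intros\<close>)
    have "integral ?B g2 = integral {0..R} (\<lambda>r. integral ({0..T} \<times> {0..Z}) (\<lambda>q. g2 (r, q)))"
      using integral_prod_continuous[of 0 "(0,0)" R "(T,Z)" g2] cg(2) by (simp add: cb)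
    also have "\<dots> = integral ({0..T} \<times> {0..Z}) (\<lambda>q. integral {0..R} (\<lambda>r. g2 (r, q)))"
      using integral_swap_continuous[of 0 "(0,0)" R "(T,Z)" "\<lambda>r q. g2 (r, q)"] cg(2) by (simp add: cb)
    also have "\<dots> = integral ({0..T} \<times> {0..Z}) (\<lambda>q. G2 (R, q) - G2 (0, q))"
      by (intro integral_cong) (use i2 in auto)
    also have "\<dots> = integral {0..T} (\<lambda>t. integral {0..Z} (\<lambda>s. G2 (R,t,s) - G2 (0,t,s)))"
      using integral_prod_continuous[of 0 0 T Z "\<lambda>q. G2 (R, q) - G2 (0, q)"] box
      by (simp add: cb continuous_on_diff c2)
    finally show ?thesis .
  qed
  have sum0: "integral ?B g1 + integral ?B g2 + integral ?B g3 = 0"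
  proof -
    have int: "g1 integrable_on ?B" "g2 integrable_on ?B" "g3 integrable_on ?B"
      using cg integrable_continuous[of "(0,0,0)" "(R,T,Z)" g1] integrable_continuous[of "(0,0,0)" "(R,T,Z)" g2]
        integrable_continuous[of "(0,0,0)" "(R,T,Z)" g3] by (simp_all add: cb)
    have "integral ?B g1 + integral ?B g2 + integral ?B g3 = integral ?B (\<lambda>p. g1 p + g2 p + g3 p)"
      using int by (simp add: integral_add integrable_add)
    also have "\<dots> = integral ?B (\<lambda>p. 0)"
      using box(1) div unfolding g1_def g2_def g3_def by (intro integral_cong) blast
    finally show ?thesis by simp
  qed
  have fc: "continuous_on ({0..R} \<times> {0..T}) (\<lambda>(r,t). G1 (r,t,s))" if "s \<in> {0..Z}" for s
    unfolding split_def by (rule continuous_on_compose2[OF cG(1)]) (use that in \<open>auto intro!: continuous_intros\<close>)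
  have fi: "(\<lambda>t. G1 (r,t,s)) integrable_on {0..T}" if "s \<in> {0..Z}" "r \<in> {0..R}" for s r
    by (intro integrable_continuous_real continuous_on_compose2[OF cG(1)]) (use that in \<open>auto intro!: continuous_intros\<close>)
  have fo: "(\<lambda>r. integral {0..T} (\<lambda>t. G1 (r,t,s))) integrable_on {0..R}" if "s \<in> {0..Z}" for s
    using integral_continuous_on_param[of "{0..R}" 0 T "\<lambda>r t. G1 (r,t,s)"] fc[OF that]
    by (intro integrable_continuous_real) simp
  have "integral {0..R} (\<lambda>r. integral {0..T} (\<lambda>t. G1 (r,t,Z) - G1 (r,t,0)))
    = integral {0..R} (\<lambda>r. integral {0..T} (\<lambda>t. G1 (r,t,Z)) - integral {0..T} (\<lambda>t. G1 (r,t,0)))"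
    using box fi by (intro integral_cong integral_diff) auto
  also have "\<dots> = integral {0..R} (\<lambda>r. integral {0..T} (\<lambda>t. G1 (r,t,Z))) - integral {0..R} (\<lambda>r. integral {0..T} (\<lambda>t. G1 (r,t,0)))"
    using fo box by (intro integral_diff) auto
  finally show ?thesis using sum0 1 2 3 by linarith
qed

lemma stokes_box:
  fixes \<sigma> :: "real \<times> real \<times> real \<Rightarrow> 'a::real_inner"
  assumes "closed_form U \<omega>" "C2_on S \<sigma>" "open S" "\<And>p. p \<in> S \<Longrightarrow> \<sigma> p \<in> U"
    and box: "{0..R} \<times> {0..T} \<times> {0..Z} \<subseteq> S" "0 \<le> R" "0 \<le> T" "0 \<le> Z"
  defines "G \<equiv> pull \<omega> \<sigma>"
  shows "integral {0..R} (\<lambda>r. integral {0..T} (\<lambda>t. G (1,0,0) (0,1,0) (r,t,Z)))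
       - integral {0..R} (\<lambda>r. integral {0..T} (\<lambda>t. G (1,0,0) (0,1,0) (r,t,0)))
    + integral {0..T} (\<lambda>t. integral {0..Z} (\<lambda>s. G (0,1,0) (0,0,1) (R,t,s) - G (0,1,0) (0,0,1) (0,t,s)))
    + integral {0..R} (\<lambda>r. integral {0..Z} (\<lambda>s. G (0,0,1) (1,0,0) (r,T,s) - G (0,0,1) (1,0,0) (r,0,s))) = 0"
proof -
  have C: "C1_on U \<omega>" using assms(1) unfolding closed_form_def by simp
  show ?thesis unfolding G_def
    by (rule box_divergence[OF pull_C1(1)[OF C assms(2,4)] pull_C1(1)[OF C assms(2,4)] pull_C1(1)[OF C assms(2,4)] box
      pull_closed[OF assms(1-4)]])
qed

section \<open>Smooth functions are of class $C^2$\<close>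

lemma linear_as_blinfun_sum:
  fixes f :: "'a::euclidean_space \<Rightarrow> 'b::real_normed_vector"
  assumes "linear f"
  shows "f v = (\<Sum>b\<in>Basis. blinfun_scaleR_left (f b) o\<^sub>L blinfun_inner_left b) v"
proof -
  have "f v = f (\<Sum>b\<in>Basis. (v \<bullet> b) *\<^sub>R b)" by (simp add: euclidean_representation)
  also have "\<dots> = (\<Sum>b\<in>Basis. (v \<bullet> b) *\<^sub>R f b)"
    using assms by (simp add: linear_sum linear_cmul)
  finally show ?thesis by (simp add: blinfun.sum_left blinfun_inner_left.rep_eq)
qed

text \<open>
  At boundary points of the time interval the derivative within \<open>S\<close> is used. Assembling it from
  its values on a basis transfers the regularity of directional derivatives to the operator.
\<close>

definition partials :: "('a::euclidean_space \<Rightarrow> 'b::real_normed_vector) \<Rightarrow> 'a set \<Rightarrow> 'a \<Rightarrow> 'a \<Rightarrow>\<^sub>L 'b"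
  where "partials f S x =
    (\<Sum>b\<in>Basis. blinfun_scaleR_left (frechet_derivative f (at x within S) b) o\<^sub>L blinfun_inner_left b)"

lemma partials_compose:
  fixes f :: "'a::euclidean_space \<Rightarrow> 'b::real_normed_vector" and g :: "'c::real_normed_vector \<Rightarrow> 'a"
  assumes "f differentiable (at (g y) within S)" "open T" "y \<in> T" "(g has_derivative blinfun_apply g') (at y)"
    "\<And>y. y \<in> T \<Longrightarrow> g y \<in> S"
  shows "((\<lambda>y. f (g y)) has_derivative (partials f S (g y) o\<^sub>L g')) (at y)"
proof -
  have fd: "(f has_derivative frechet_derivative f (at (g y) within S)) (at (g y) within S)"
    using assms(1) frechet_derivative_works by blast
  then have lin: "linear (frechet_derivative f (at (g y) within S))"
    by (rule has_derivative_linear)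
  have "frechet_derivative f (at (g y) within S) = partials f S (g y)"
    unfolding partials_def by (rule ext) (rule linear_as_blinfun_sum[OF lin])
  then have "(f has_derivative partials f S (g y)) (at (g y) within g ` T)"
    using has_derivative_subset[OF fd, of "g ` T"] assms(5) by auto
  moreover have "(g has_derivative g') (at y within T)" using assms(4) by (rule has_derivative_at_withinI)
  ultimately have "((\<lambda>y. f (g y)) has_derivative (\<lambda>v. partials f S (g y) (g' v))) (at y within T)"
    using has_derivative_in_compose by blast
  moreover have "blinfun_apply (partials f S (g y) o\<^sub>L g') = (\<lambda>v. partials f S (g y) (g' v))"
    by (rule ext) simp
  ultimately show ?thesis by (simp only: at_within_open[OF assms(3,2)])
qed

lemma continuous_on_partials:
  fixes f :: "'a::euclidean_space \<Rightarrow> 'b::real_normed_vector" and g :: "'c::real_normed_vector \<Rightarrow> 'a"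
  assumes "\<And>b. b \<in> Basis \<Longrightarrow> continuous_on T (\<lambda>y. frechet_derivative f (at (g y) within S) b)"
  shows "continuous_on T (\<lambda>y. partials f S (g y))"
  unfolding partials_def
  by (intro continuous_intros bounded_linear.continuous_on[OF bounded_linear_blinfun_scaleR_left] assms)

lemma Ck_on_compose_C1:
  fixes f :: "'a::euclidean_space \<Rightarrow> 'b::real_normed_vector" and g :: "'c::real_normed_vector \<Rightarrow> 'a"
  assumes "Ck_on (Suc 0) UNIV S f" "C1_on T g" "open T" "\<And>y. y \<in> T \<Longrightarrow> g y \<in> S"
  shows "C1_on T (\<lambda>y. f (g y))"
proof (rule C1_onI[where F="\<lambda>y. partials f S (g y) o\<^sub>L D g y"])
  show "((\<lambda>y. f (g y)) has_derivative (partials f S (g y) o\<^sub>L D g y)) (at y)" if "y \<in> T" for y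
    by (rule partials_compose[OF _ assms(3) that C1_onD(1)[OF assms(2) that] assms(4)])
       (use assms(1,4) that in auto)
  have "continuous_on T (\<lambda>y. frechet_derivative f (at (g y) within S) b)" for b
    by (rule continuous_on_compose2[OF _ C1_onD(3)[OF assms(2)]]) (use assms(1,4) in auto)
  then have "continuous_on T (\<lambda>y. partials f S (g y))" by (rule continuous_on_partials)
  then show "continuous_on T (\<lambda>y. partials f S (g y) o\<^sub>L D g y)"
    using C1_onD(2)[OF assms(2)] by (intro continuous_intros)
qed

text \<open>
  The inner function \<open>g\<close> maps an open set into \<open>S\<close>, so the composition has two-sided derivatives
  even where those of \<open>f\<close> are one-sided.
\<close>

lemma Ck_on_compose_C2:
  fixes f :: "'a::euclidean_space \<Rightarrow> 'b::real_normed_vector" and g :: "'c::real_normed_vector \<Rightarrow> 'a"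
  assumes "Ck_on (Suc (Suc 0)) UNIV S f" "C2_on T g" "open T" "\<And>y. y \<in> T \<Longrightarrow> g y \<in> S"
  shows "C2_on T (\<lambda>y. f (g y))"
proof (rule C2_onI[where F="\<lambda>y. partials f S (g y) o\<^sub>L D g y"])
  show "((\<lambda>y. f (g y)) has_derivative (partials f S (g y) o\<^sub>L D g y)) (at y)" if "y \<in> T" for y
    by (rule partials_compose[OF _ assms(3) that C2_onD(1)[OF assms(2) that] assms(4)])
       (use assms(1,4) that in auto)
  have p: "C1_on T (\<lambda>y. frechet_derivative f (at (g y) within S) b)" for b
    by (rule Ck_on_compose_C1[OF _ C2_onD(5)[OF assms(2)] assms(3,4)]) (use assms(1) in auto)
  have "C1_on T (\<lambda>y. blinfun_scaleR_left (frechet_derivative f (at (g y) within S) b) o\<^sub>L blinfun_inner_left b)" for b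
    by (rule bounded_bilinear.C1_on_bilinear[OF bounded_bilinear_blinfun_compose
      C1_on_linear_compose[OF bounded_linear_blinfun_scaleR_left p] C1_on_const])
  then have "C1_on T (\<lambda>y. partials f S (g y))"
    unfolding partials_def by (rule C1_on_sum[OF finite_Basis])
  then show "C1_on T (\<lambda>y. partials f S (g y) o\<^sub>L D g y)"
    by (rule bounded_bilinear.C1_on_bilinear[OF bounded_bilinear_blinfun_compose _ C2_onD(2)[OF assms(2)]])
qed (rule assms(3))

lemma smooth_on_compose_C2:
  fixes f :: "'a::euclidean_space \<Rightarrow> 'b::real_normed_vector" and g :: "'c::real_normed_vector \<Rightarrow> 'a"
  assumes "smooth_on UNIV S f" "C2_on T g" "open T" "\<And>y. y \<in> T \<Longrightarrow> g y \<in> S"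
  shows "C2_on T (\<lambda>y. f (g y))"
  by (rule Ck_on_compose_C2[OF _ assms(2-4)]) (use assms(1) in \<open>simp only: smooth_on_def\<close>)

lemma smooth_on_C2:
  fixes f :: "'a::euclidean_space \<Rightarrow> 'b::real_normed_vector"
  assumes "smooth_on UNIV S f" "open S"
  shows "C2_on S f"
  using smooth_on_compose_C2[OF assms(1) C2_on_linear[OF bounded_linear_ident assms(2)] assms(2)] by simp

lemma C2_on_real:
  fixes f :: "real \<Rightarrow> real"
  assumes "\<And>s. (f has_real_derivative f1 s) (at s)" "\<And>s. (f1 has_real_derivative f2 s) (at s)"
    "continuous_on UNIV f2"
  shows "C2_on UNIV f"
proof (rule C2_onI[where F="\<lambda>s. blinfun_scaleR_left (f1 s)"])
  show "(f has_derivative blinfun_apply (blinfun_scaleR_left (f1 s))) (at s)" for s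
    using assms(1)[of s] unfolding has_field_derivative_def
    by (rule has_derivative_eq_rhs) (auto simp: mult.commute)
  have "C1_on UNIV f1"
  proof (rule C1_onI[where F="\<lambda>s. blinfun_scaleR_left (f2 s)"])
    show "(f1 has_derivative blinfun_apply (blinfun_scaleR_left (f2 s))) (at s)" for s
      using assms(2)[of s] unfolding has_field_derivative_def
      by (rule has_derivative_eq_rhs) (auto simp: mult.commute)
    show "continuous_on UNIV (\<lambda>s. blinfun_scaleR_left (f2 s))"
      by (rule bounded_linear.continuous_on[OF bounded_linear_blinfun_scaleR_left assms(3)])
  qed
  then show "C1_on UNIV (\<lambda>s. blinfun_scaleR_left (f1 s))"
    by (rule C1_on_linear_compose[OF bounded_linear_blinfun_scaleR_left])
qed simp

section \<open>Symplectic manifolds in local coordinates\<close>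

locale symplectic =
  fixes A :: "('m::{t2_space, second_countable_topology}, 'e::euclidean_space) chart set"
    and \<omega> :: "('m, 'e) two_form"
  assumes symp: "symplectic_manifold UNIV A \<omega>"
begin

abbreviation "M \<equiv> carrier A"

lemma chart:
  assumes "c \<in> A"
  shows "open (cdom c)" "open (cimg c)" "continuous_on (cdom c) (cmap c)" "continuous_on (cimg c) (cinv c)"
    "\<And>p. p \<in> cdom c \<Longrightarrow> cinv c (cmap c p) = p" "\<And>x. x \<in> cimg c \<Longrightarrow> cmap c (cinv c x) = x"
    "\<And>x. x \<in> cimg c \<Longrightarrow> cinv c x \<in> cdom c" "cdom c \<subseteq> M"
proof -
  have "coord_chart UNIV c" using symp assms unfolding symplectic_manifold_def smooth_manifold_def by simp
  then have h: "open (cdom c)" "open (cimg c)" "homeomorphism (cdom c) (cimg c) (cmap c) (cinv c)"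
    unfolding coord_chart_def by (simp_all add: openin_open_eq)
  show "open (cdom c)" "open (cimg c)" by (fact h)+
  show "continuous_on (cdom c) (cmap c)" "continuous_on (cimg c) (cinv c)"
    using h(3) by (simp_all add: homeomorphism_def)
  show "\<And>p. p \<in> cdom c \<Longrightarrow> cinv c (cmap c p) = p" "\<And>x. x \<in> cimg c \<Longrightarrow> cmap c (cinv c x) = x"
    "\<And>x. x \<in> cimg c \<Longrightarrow> cinv c x \<in> cdom c"
    using h(3) unfolding homeomorphism_def by blast+
  show "cdom c \<subseteq> M" using assms unfolding carrier_def by blast
qed

lemma ex_chart: "p \<in> M \<Longrightarrow> \<exists>c\<in>A. p \<in> cdom c"
  unfolding carrier_def by blast

lemma open_M: "open M"
  unfolding carrier_def using chart(1) by (intro open_UN) blast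

definition overlap :: "('m, 'e) chart \<Rightarrow> ('m, 'e) chart \<Rightarrow> 'e set"
  where "overlap c d = {x \<in> cimg c. cinv c x \<in> cdom d}"

lemma overlap_image: "c \<in> A \<Longrightarrow> cmap c ` (cdom c \<inter> cdom d) = overlap c d"
  unfolding overlap_def using chart(5,6,7)[of c] by force

lemma open_overlap:
  assumes "c \<in> A" "d \<in> A" shows "open (overlap c d)"
proof -
  have "overlap c d = cimg c \<inter> cinv c -` cdom d" unfolding overlap_def by blast
  then show ?thesis using continuous_open_preimage[OF chart(4,2)[OF assms(1)] chart(1)[OF assms(2)]] by simp
qed

lemma transition_C2:
  assumes "c \<in> A" "d \<in> A" shows "C2_on (overlap c d) (transition c d)"
proof -
  have "compatible UNIV c d" using symp assms unfolding symplectic_manifold_def smooth_manifold_def by blast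
  then have "smooth_on UNIV (overlap c d) (transition c d)"
    unfolding compatible_def overlap_image[OF assms(1)] by blast
  then show ?thesis using smooth_on_C2 open_overlap[OF assms] by blast
qed

lemma coord_change_D:
  assumes "c \<in> A" "d \<in> A" "p \<in> cdom c" "p \<in> cdom d"
  shows "coord_change c d p = D (transition c d) (cmap c p)"
proof -
  have x: "cmap c p \<in> overlap c d" using assms chart(5)[OF assms(1)] unfolding overlap_def by auto
  have "coord_change c d p = frechet_derivative (transition c d) (at (cmap c p) within overlap c d)"
    unfolding coord_change_def overlap_image[OF assms(1)] ..
  also have "at (cmap c p) within overlap c d = at (cmap c p)"
    using x open_overlap[OF assms(1,2)] by (rule at_within_open)
  also have "frechet_derivative (transition c d) (at (cmap c p)) = D (transition c d) (cmap c p)"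
    using frechet_derivative_at[OF C2_onD(1)[OF transition_C2[OF assms(1,2)] x]] by simp
  finally show ?thesis .
qed

text \<open>
  The form in a chart as an operator valued function of the coordinates, so that it can be
  differentiated as such. On the image of the chart it represents \<open>\<omega>\<close>, see \<open>om_apply\<close>.
\<close>

definition om :: "('m, 'e) chart \<Rightarrow> 'e \<Rightarrow> 'e \<Rightarrow>\<^sub>L 'e \<Rightarrow>\<^sub>L real"
  where "om c x = (\<Sum>i\<in>Basis. \<Sum>j\<in>Basis. \<omega> c (cinv c x) i j *\<^sub>R
     (blinfun_scaleR_left (blinfun_inner_left j) o\<^sub>L blinfun_inner_left i))"

lemma om_apply:
  assumes "c \<in> A" "x \<in> cimg c"
  shows "om c x u v = \<omega> c (cinv c x) u v"
proof -
  let ?w = "\<omega> c (cinv c x)"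
  have bil: "bilinear ?w" using symp chart(7)[OF assms] assms(1)
    unfolding symplectic_manifold_def smooth_two_form_def by blast
  have "?w u v = ?w (\<Sum>i\<in>Basis. (u \<bullet> i) *\<^sub>R i) (\<Sum>j\<in>Basis. (v \<bullet> j) *\<^sub>R j)"
    by (simp add: euclidean_representation)
  also have "\<dots> = (\<Sum>i\<in>Basis. \<Sum>j\<in>Basis. (u \<bullet> i) * ((v \<bullet> j) * ?w i j))"
    using bil by (simp add: bilinear_sum sum.cartesian_product bilinear_lmul bilinear_rmul)
  also have "\<dots> = om c x u v"
    unfolding om_def
    by (simp add: blinfun.sum_left blinfun.bilinear_simps blinfun_inner_left.rep_eq mult_ac)
  finally show ?thesis ..
qed

lemma om_C2:
  assumes "c \<in> A" shows "C2_on (cimg c) (om c)"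
proof -
  have o: "open (cimg c)" by (rule chart(2)[OF assms])
  have "smooth_on UNIV (cimg c) (\<lambda>x. \<omega> c (cinv c x) i j)" for i j
    using symp assms unfolding symplectic_manifold_def smooth_two_form_def by blast
  then have s: "C2_on (cimg c) (\<lambda>x. \<omega> c (cinv c x) i j)" for i j using smooth_on_C2[OF _ o] by blast
  have sum: "C2_on (cimg c) (\<lambda>x. \<Sum>i\<in>I. f i x)"
    if "finite I" "\<And>i. C2_on (cimg c) (f i)" for I :: "'e set" and f :: "'e \<Rightarrow> 'e \<Rightarrow> 'e \<Rightarrow>\<^sub>L 'e \<Rightarrow>\<^sub>L real"
    using that(1)
  proof induction
    case (insert i I)
    then show ?case using C2_on_add[OF that(2) _ o] by simp
  qed (simp add: C2_on_const[OF o])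
  show ?thesis unfolding om_def[abs_def]
    by (intro sum finite_Basis C2_on_scaleR[OF s C2_on_const[OF o] o])
qed

lemma om_alt:
  assumes "c \<in> A" "x \<in> cimg c" shows "om c x u u = 0"
proof -
  have "\<forall>c\<in>A. \<forall>p\<in>cdom c. \<forall>u. \<omega> c p u u = 0"
    using symp unfolding symplectic_manifold_def smooth_two_form_def by blast
  then show ?thesis using chart(7)[OF assms] assms(1) by (simp add: om_apply[OF assms])
qed

lemma om_closed:
  assumes "c \<in> A" shows "closed_form (cimg c) (om c)"
proof -
  have e: "frechet_derivative (\<lambda>x. \<omega> c (cinv c x) v w) (at (cmap c (cinv c x)) within cimg c) u = D (om c) x u v w"
    if x: "x \<in> cimg c" for x u v w
  proof -
    have "((\<lambda>x. om c x v w) has_derivative (\<lambda>u. D (om c) x u v w)) (at x)"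
      by (intro bounded_linear.has_derivative[OF blinfun.bounded_linear_left] C2_onD(1)[OF om_C2[OF assms]] x)
    then have "((\<lambda>x. \<omega> c (cinv c x) v w) has_derivative (\<lambda>u. D (om c) x u v w)) (at x)"
      by (rule has_derivative_cong_on[OF chart(2)[OF assms] x, rotated]) (simp add: om_apply[OF assms])
    from fun_cong[OF frechet_derivative_at[OF this], of u] show ?thesis
      by (simp only: chart(6)[OF assms x] at_within_open[OF x chart(2)[OF assms]])
  qed
  have "D (om c) x u v w + D (om c) x v w u + D (om c) x w u v = 0" if x: "x \<in> cimg c" for x u v w
  proof -
    have "ext_deriv \<omega> c (cinv c x) u v w = 0"
      using symp assms chart(7)[OF assms x] unfolding symplectic_manifold_def by blast
    then show ?thesis unfolding ext_deriv_def using e[OF x] by simp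
  qed
  then show ?thesis
    unfolding closed_form_def using om_alt[OF assms] C2_onD(5)[OF om_C2[OF assms]] by simp
qed

lemma om_nondeg:
  assumes "c \<in> A" "x \<in> cimg c" "\<And>v. om c x u v = 0" shows "u = 0"
proof -
  have "\<forall>v. \<omega> c (cinv c x) u v = 0" using assms(3) om_apply[OF assms(1,2)] by simp
  then show ?thesis using symp assms(1) chart(7)[OF assms(1,2)] unfolding symplectic_manifold_def by blast
qed

text \<open>
  The isomorphism from vectors to covectors given by \<open>\<omega>\<close>, with covectors identified with
  vectors by the inner product.
\<close>

lemma om_dual:
  assumes "c \<in> A" "x \<in> cimg c"
  obtains F where "linear F" "inj F" "\<And>u v. F u \<bullet> v = om c x u v"
proof -
  define F where "F u = (\<Sum>b\<in>Basis. om c x u b *\<^sub>R b)" for u :: 'e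
  have Fv: "F u \<bullet> v = om c x u v" for u v
  proof -
    have "F u \<bullet> v = om c x u (\<Sum>b\<in>Basis. (v \<bullet> b) *\<^sub>R b)"
      unfolding F_def by (simp add: inner_sum_left inner_sum_right blinfun.bilinear_simps blinfun.sum_right inner_commute mult_ac)
    then show ?thesis by (simp add: euclidean_representation)
  qed
  have linF: "linear F"
    unfolding F_def by (rule linearI) (simp_all add: blinfun.bilinear_simps scaleR_left_distrib sum.distrib scaleR_sum_right)
  have "inj F"
  proof (rule linear_injective_0[OF linF, THEN iffD2], intro allI impI)
    fix u assume "F u = 0"
    then show "u = 0" using om_nondeg[OF assms] Fv[of u] by simp
  qed
  then show ?thesis using that linF Fv by blast
qed

lemma om_transition:
  assumes "c \<in> A" "d \<in> A" "x \<in> overlap c d"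
  shows "om c x u v = om d (transition c d x) (D (transition c d) x u) (D (transition c d) x v)"
proof -
  have x: "x \<in> cimg c" "cinv c x \<in> cdom c" "cinv c x \<in> cdom d"
    using assms(3) chart(7)[OF assms(1)] unfolding overlap_def by auto
  have t: "transition c d x \<in> cimg d" "cinv d (transition c d x) = cinv c x"
    using x chart(5)[OF assms(2)] unfolding transition_def by auto
  have "\<omega> c (cinv c x) u v = \<omega> d (cinv c x) (coord_change c d (cinv c x) u) (coord_change c d (cinv c x) v)"
    using symp assms(1,2) x unfolding symplectic_manifold_def smooth_two_form_def by blast
  then show ?thesis
    using x t by (simp add: om_apply[OF assms(1)] om_apply[OF assms(2)] coord_change_D[OF assms(1,2)] chart(6)[OF assms(1)])
qed

section \<open>Hamiltonian isotopies in local coordinates\<close>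

definition loc :: "(real \<Rightarrow> 'm \<Rightarrow> 'm) \<Rightarrow> ('m, 'e) chart \<Rightarrow> ('m, 'e) chart \<Rightarrow> real \<times> 'e \<Rightarrow> 'e"
  where "loc \<phi> c d = (\<lambda>(s, x). cmap d (\<phi> s (cinv c x)))"

definition ldom :: "(real \<Rightarrow> 'm \<Rightarrow> 'm) \<Rightarrow> ('m, 'e) chart \<Rightarrow> ('m, 'e) chart \<Rightarrow> (real \<times> 'e) set"
  where "ldom \<phi> c d = {(s, x). x \<in> cimg c \<and> \<phi> s (cinv c x) \<in> cdom d}"

definition hloc :: "(real \<Rightarrow> 'm \<Rightarrow> real) \<Rightarrow> ('m, 'e) chart \<Rightarrow> real \<times> 'e \<Rightarrow> real"
  where "hloc h c = (\<lambda>(s, x). h s (cinv c x))"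

text \<open>
  Hamiltonian isotopies with time ranging over all of \<open>\<real>\<close>. The last clause is Hamilton's equation:
  \<open>\<omega>\<close> paired with the velocity is the spatial differential of the Hamiltonian.
\<close>

definition ham_iso :: "(real \<Rightarrow> 'm \<Rightarrow> 'm) \<Rightarrow> (real \<Rightarrow> 'm \<Rightarrow> real) \<Rightarrow> bool"
  where "ham_iso \<phi> h \<longleftrightarrow>
    (\<forall>s. bij_betw (\<phi> s) M M) \<and> (\<forall>p\<in>M. \<phi> 0 p = p) \<and>
    continuous_on (UNIV \<times> M) (\<lambda>(s, p). \<phi> s p) \<and>
    (\<forall>c\<in>A. \<forall>d\<in>A. C2_on (ldom \<phi> c d) (loc \<phi> c d)) \<and>
    (\<forall>c\<in>A. C2_on (UNIV \<times> cimg c) (hloc h c)) \<and>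
    (\<forall>c\<in>A. \<forall>d\<in>A. \<forall>q\<in>ldom \<phi> c d. \<forall>v.
       om d (loc \<phi> c d q) (D (loc \<phi> c d) q (1, 0)) v = D (hloc h d) (fst q, loc \<phi> c d q) (0, v))"

lemma open_ldom:
  assumes "continuous_on (UNIV \<times> M) (\<lambda>(s, p). \<phi> s p)" "c \<in> A" "d \<in> A"
  shows "open (ldom \<phi> c d)"
proof -
  have "continuous_on (UNIV \<times> cimg c) (\<lambda>q. \<phi> (fst q) (cinv c (snd q)))"
  proof -
    have "continuous_on ((UNIV :: real set) \<times> cimg c) (\<lambda>q. cinv c (snd q))"
      by (rule continuous_on_compose2[OF chart(4)[OF assms(2)] continuous_on_snd[OF continuous_on_id]]) auto
    then have "continuous_on ((UNIV :: real set) \<times> cimg c) (\<lambda>q. (fst q, cinv c (snd q)))"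
      by (intro continuous_intros)
    moreover have "(\<lambda>q. (fst q, cinv c (snd q))) ` ((UNIV :: real set) \<times> cimg c) \<subseteq> UNIV \<times> M"
      using chart(7,8)[OF assms(2)] by fastforce
    ultimately show ?thesis using continuous_on_compose2[OF assms(1)] by fastforce
  qed
  moreover have "open ((UNIV :: real set) \<times> cimg c)" using chart(2)[OF assms(2)] by (simp add: open_Times)
  ultimately have "open ((UNIV \<times> cimg c) \<inter> (\<lambda>q. \<phi> (fst q) (cinv c (snd q))) -` cdom d)"
    using chart(1)[OF assms(3)] by (rule continuous_open_preimage)
  moreover have "(UNIV \<times> cimg c) \<inter> (\<lambda>q. \<phi> (fst q) (cinv c (snd q))) -` cdom d = ldom \<phi> c d"
    unfolding ldom_def by auto
  ultimately show ?thesis by simp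
qed

lemma ham_vector_field_eq:
  assumes "c \<in> A" "p \<in> cdom c" "linear (differential k c p)"
  shows "\<omega> c p (ham_vector_field UNIV \<omega> k c p) v = differential k c p v"
proof -
  let ?l = "differential k c p"
  have x: "cmap c p \<in> cimg c" "cinv c (cmap c p) = p" using assms chart(5) by auto
  obtain T where linT: "linear T" and "inj T" and Tv: "\<And>u v. T u \<bullet> v = om c (cmap c p) u v"
    using om_dual[OF assms(1) x(1)] by blast
  have w: "\<omega> c p u v = om c (cmap c p) u v" for u v using om_apply[OF assms(1) x(1)] x(2) by simp
  have "surj T" using linear_inj_imp_surj[OF linT \<open>inj T\<close>] by blast
  then obtain u where u: "T u = (\<Sum>b\<in>Basis. ?l b *\<^sub>R b)" by (metis surjD)
  have lu: "om c (cmap c p) u v = ?l v" for v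
  proof -
    have "om c (cmap c p) u v = (\<Sum>b\<in>Basis. (v \<bullet> b) *\<^sub>R ?l b)"
      unfolding Tv[symmetric] u by (simp add: inner_sum_left inner_commute[of v] mult.commute)
    also have "\<dots> = ?l (\<Sum>b\<in>Basis. (v \<bullet> b) *\<^sub>R b)" using assms(3) by (simp add: linear_sum linear_cmul)
    finally show ?thesis by (simp add: euclidean_representation)
  qed
  have "ham_vector_field UNIV \<omega> k c p = u"
    unfolding ham_vector_field_def
  proof (rule the_equality)
    show "u \<in> UNIV \<and> (\<forall>v\<in>UNIV. \<omega> c p u v = ?l v)" using lu w by simp
    fix u' assume "u' \<in> UNIV \<and> (\<forall>v\<in>UNIV. \<omega> c p u' v = ?l v)"
    then have "om c (cmap c p) (u' - u) v = 0" for v using lu w by (simp add: blinfun.bilinear_simps)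
    from om_nondeg[OF assms(1) x(1) this] show "u' = u" by simp
  qed
  then show ?thesis using lu w by simp
qed

text \<open>
  A flow \<open>\<Phi>\<^sub>t\<close>, \<open>t \<in> [0,1]\<close>, is reparametrized as \<open>\<Phi>\<close> at time \<open>sin\<^sup>2 s\<close>, which is defined for
  all real \<open>s\<close> and has the Hamiltonian \<open>2 sin s cos s H\<close>. This removes one-sided derivatives; the time
  1 of \<open>\<Phi>\<close> becomes \<open>s = \<pi>/2\<close>.
\<close>

lemma Ham_ham_iso:
  assumes "\<zeta> \<in> Ham UNIV A \<omega>"
  shows "\<exists>\<phi> h. ham_iso \<phi> h \<and> (\<forall>p\<in>M. \<zeta> p = \<phi> (pi / 2) p)"
proof -
  obtain H \<Phi> where H: "smooth_hamiltonian UNIV A H" "ham_flow UNIV A \<omega> H \<Phi>" "\<And>p. p \<in> M \<Longrightarrow> \<zeta> p = \<Phi> 1 p"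
    using assms unfolding Ham_def by blast
  have iso: "continuous_on ({0..1} \<times> M) (\<lambda>(t, p). \<Phi> t p)"
    "\<And>c d. c \<in> A \<Longrightarrow> d \<in> A \<Longrightarrow> smooth_on (UNIV \<times> UNIV) {(t, x). t \<in> {0..1} \<and> x \<in> cimg c \<and> \<Phi> t (cinv c x) \<in> cdom d}
         (\<lambda>(t, x). cmap d (\<Phi> t (cinv c x)))"
    "\<And>t. t \<in> {0..1} \<Longrightarrow> bij_betw (\<Phi> t) M M"
    and start: "\<And>p. p \<in> M \<Longrightarrow> \<Phi> 0 p = p"
    and flow: "\<And>p t c. p \<in> M \<Longrightarrow> t \<in> {0..1} \<Longrightarrow> c \<in> A \<Longrightarrow> \<Phi> t p \<in> cdom c \<Longrightarrow>
       ((\<lambda>s. cmap c (\<Phi> s p)) has_vector_derivative ham_vector_field UNIV \<omega> (H t) c (\<Phi> t p)) (at t within {0..1})"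
    using H(2) unfolding ham_flow_def smooth_isotopy_def diffeomorphism_def by blast+
  define \<tau> where "\<tau> s = sin s ^ 2" for s :: real
  define \<tau>' where "\<tau>' s = 2 * sin s * cos s" for s :: real
  have \<tau>01: "\<tau> s \<in> {0..1}" for s unfolding \<tau>_def by (simp add: abs_square_le_1)
  have d\<tau>: "(\<tau> has_real_derivative \<tau>' s) (at s)" for s
    unfolding \<tau>_def \<tau>'_def by (auto intro!: derivative_eq_intros)
  have d\<tau>': "(\<tau>' has_real_derivative 2 * (cos s * cos s - sin s * sin s)) (at s)" for s
    unfolding \<tau>'_def by (auto intro!: derivative_eq_intros simp: algebra_simps)
  have C\<tau>: "C2_on UNIV \<tau>"
    by (rule C2_on_real[OF d\<tau> d\<tau>']) (intro continuous_intros)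
  have C\<tau>': "C2_on UNIV \<tau>'"
    by (rule C2_on_real[OF d\<tau>', of "\<lambda>s. 2 * (- 2 * (cos s * sin s) - 2 * (sin s * cos s))"])
       (auto intro!: derivative_eq_intros continuous_intros simp: algebra_simps)
  have op: "open (UNIV \<times> U)" if "open U" for U :: "'e set" using that by (simp add: open_Times)
  have Cg: "C2_on S (\<lambda>q. (\<tau> (fst q), snd q))" if "open S" for S :: "(real \<times> 'e) set"
    by (intro C2_on_Pair that C2_on_compose[OF C\<tau>] C2_on_linear bounded_linear_fst bounded_linear_snd UNIV_I)
  define \<phi> where "\<phi> s = \<Phi> (\<tau> s)" for s
  define h where "h s p = \<tau>' s * H (\<tau> s) p" for s p
  have cont: "continuous_on (UNIV \<times> M) (\<lambda>(s, p). \<phi> s p)"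
  proof -
    have "continuous_on (UNIV \<times> M) (\<lambda>q. (\<tau> (fst q), snd q))"
      unfolding \<tau>_def by (intro continuous_intros)
    moreover have "(\<lambda>q. (\<tau> (fst q), snd q)) ` (UNIV \<times> M) \<subseteq> {0..1} \<times> M"
      using \<tau>01 by auto
    ultimately show ?thesis using continuous_on_compose2[OF iso(1)] unfolding \<phi>_def by (fastforce simp: split_def)
  qed
  have C2loc: "C2_on (ldom \<phi> c d) (loc \<phi> c d)" if c: "c \<in> A" "d \<in> A" for c d
  proof -
    have "C2_on (ldom \<phi> c d) (\<lambda>q. (\<lambda>(t, x). cmap d (\<Phi> t (cinv c x))) (\<tau> (fst q), snd q))"
      by (rule smooth_on_compose_C2[OF iso(2)[OF c, unfolded UNIV_Times_UNIV] Cg])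
         (use open_ldom[OF cont c] \<tau>01 in \<open>auto simp: ldom_def \<phi>_def\<close>)
    then show ?thesis unfolding loc_def \<phi>_def split_def by simp
  qed
  have C2k: "C2_on (UNIV \<times> cimg c) (\<lambda>q. H (\<tau> (fst q)) (cinv c (snd q)))" if c: "c \<in> A" for c
  proof -
    have "smooth_on UNIV ({0..1} \<times> cimg c) (\<lambda>(t, x). H t (cinv c x))"
      using H(1) c unfolding smooth_hamiltonian_def by simp
    from smooth_on_compose_C2[OF this Cg[OF op[OF chart(2)[OF c]]] op[OF chart(2)[OF c]]]
    show ?thesis using \<tau>01 by (auto simp: split_def)
  qed
  have C2h: "C2_on (UNIV \<times> cimg c) (hloc h c)" if c: "c \<in> A" for c
  proof -
    have o: "open ((UNIV :: real set) \<times> cimg c)" using op[OF chart(2)[OF c]] .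
    have "C2_on (UNIV \<times> cimg c) (\<lambda>q. \<tau>' (fst q))"
      by (rule C2_on_compose[OF C\<tau>' C2_on_linear[OF bounded_linear_fst o] _ o]) simp
    from bounded_bilinear.C2_on_bilinear[OF bounded_bilinear_mult this C2k[OF c] o]
    show ?thesis unfolding hloc_def h_def split_def .
  qed
  have ode: "om d (loc \<phi> c d q) (D (loc \<phi> c d) q (1, 0)) v = D (hloc h d) (fst q, loc \<phi> c d q) (0, v)"
    if c: "c \<in> A" "d \<in> A" and q: "q \<in> ldom \<phi> c d" for c d q v
  proof -
    obtain s x where sx: "q = (s, x)" by (metis surj_pair)
    define p where "p = cinv c x"
    define z where "z = loc \<phi> c d q"
    have x: "x \<in> cimg c" "p \<in> cdom c" "p \<in> M" "\<phi> s p \<in> cdom d"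
      using q chart(7,8)[OF c(1)] unfolding sx ldom_def p_def by auto
    have z: "z = cmap d (\<phi> s p)" "z \<in> cimg d" "cinv d z = \<phi> s p"
      using x chart(5)[OF c(2)] unfolding z_def sx loc_def p_def by auto
    let ?X = "ham_vector_field UNIV \<omega> (H (\<tau> s)) d (\<phi> s p)"
    have "((\<lambda>s. cmap d (\<Phi> (\<tau> s) p)) has_vector_derivative \<tau>' s *\<^sub>R ?X) (at s)"
    proof -
      have "((\<lambda>t. cmap d (\<Phi> t p)) has_derivative (\<lambda>t. t *\<^sub>R ?X)) (at (\<tau> s) within {0..1})"
        using flow[OF x(3) \<tau>01[of s] c(2)] x(4) unfolding \<phi>_def has_vector_derivative_def by blast
      then have "((\<lambda>t. cmap d (\<Phi> t p)) has_derivative (\<lambda>t. t *\<^sub>R ?X)) (at (\<tau> s) within range \<tau>)"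
        by (rule has_derivative_subset) (use \<tau>01 in auto)
      from has_derivative_in_compose[OF d\<tau>[of s, unfolded has_field_derivative_def] this]
      show ?thesis unfolding has_vector_derivative_def by (simp add: mult.commute)
    qed
    moreover have "((\<lambda>s. cmap d (\<Phi> (\<tau> s) p)) has_vector_derivative D (loc \<phi> c d) q (1, 0)) (at s)"
    proof -
      have "((\<lambda>t. (t, x)) has_derivative (\<lambda>t. (t, 0))) (at s)" by (auto intro!: derivative_eq_intros)
      from has_derivative_compose[OF this, of "loc \<phi> c d" "D (loc \<phi> c d) q"] C2_onD(1)[OF C2loc[OF c] q]
      have "((\<lambda>t. loc \<phi> c d (t, x)) has_derivative (\<lambda>t. D (loc \<phi> c d) q (t, 0))) (at s)" unfolding sx by blast
      moreover have "(\<lambda>t. D (loc \<phi> c d) q (t, 0)) = (\<lambda>t. t *\<^sub>R D (loc \<phi> c d) q (1, 0))"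
      proof
        fix t
        show "D (loc \<phi> c d) q (t, 0) = t *\<^sub>R D (loc \<phi> c d) q (1, 0)"
          using blinfun.scaleR_right[of "D (loc \<phi> c d) q" t "(1, 0)"]
          by (simp only: scaleR_Pair real_scaleR_def mult_1_right scaleR_zero_right)
      qed
      ultimately have "((\<lambda>t. loc \<phi> c d (t, x)) has_vector_derivative D (loc \<phi> c d) q (1, 0)) (at s)"
        unfolding has_vector_derivative_def by simp
      moreover have "(\<lambda>t. loc \<phi> c d (t, x)) = (\<lambda>s. cmap d (\<Phi> (\<tau> s) p))"
        by (simp add: loc_def \<phi>_def p_def)
      ultimately show ?thesis by simp
    qed
    ultimately have dz: "D (loc \<phi> c d) q (1, 0) = \<tau>' s *\<^sub>R ?X" by (rule vector_derivative_unique_at[symmetric])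
    let ?k = "\<lambda>x. H (\<tau> s) (cinv d x)"
    let ?K = "\<lambda>q. H (\<tau> (fst q)) (cinv d (snd q))"
    have sz: "(s, z) \<in> UNIV \<times> cimg d" using z by simp
    have dk: "(?k has_derivative (\<lambda>v. D ?K (s, z) (0, v))) (at z)"
    proof -
      have "((\<lambda>y. (s, y)) has_derivative (\<lambda>v. (0, v))) (at z)" by (auto intro!: derivative_eq_intros)
      from has_derivative_compose[OF this C2_onD(1)[OF C2k[OF c(2)] sz]] show ?thesis by simp
    qed
    have diff: "differential (H (\<tau> s)) d (\<phi> s p) = (\<lambda>v. D ?K (s, z) (0, v))"
      unfolding differential_def z(1)[symmetric]
      using at_within_open[OF z(2) chart(2)[OF c(2)]] frechet_derivative_at[OF dk] by simp
    have "linear (differential (H (\<tau> s)) d (\<phi> s p))"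
      unfolding diff using has_derivative_linear[OF dk] .
    from ham_vector_field_eq[OF c(2) x(4) this, of v]
    have 1: "om d z ?X v = D ?K (s, z) (0, v)" using om_apply[OF c(2) z(2)] z(3) diff by simp
    have 2: "D (hloc h d) (s, z) (0, v) = \<tau>' s * D ?K (s, z) (0, v)"
    proof -
      have "((\<lambda>y. (s, y)) has_derivative (\<lambda>v. (0, v))) (at z)" by (auto intro!: derivative_eq_intros)
      from has_derivative_compose[OF this C2_onD(1)[OF C2h[OF c(2)] sz]]
      have "((\<lambda>y. \<tau>' s * ?k y) has_derivative (\<lambda>v. D (hloc h d) (s, z) (0, v))) (at z)"
        unfolding hloc_def h_def by simp
      from has_derivative_unique[OF this has_derivative_mult_right[OF dk, of "\<tau>' s"]]
      show ?thesis by meson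
    qed
    show ?thesis using 1 2 dz unfolding z_def[symmetric] by (simp add: sx blinfun.bilinear_simps)
  qed
  have "ham_iso \<phi> h"
    unfolding ham_iso_def
    by (intro conjI allI ballI C2loc C2h ode cont)
       (simp_all add: \<phi>_def iso(3)[OF \<tau>01] start \<tau>_def[of 0])
  moreover have "\<zeta> p = \<phi> (pi / 2) p" if "p \<in> M" for p
    using H(3)[OF that] unfolding \<phi>_def \<tau>_def by simp
  ultimately show ?thesis by blast
qed

lemma tendsto_cmap:
  assumes "c \<in> A" "p \<in> cdom c" "(f \<longlongrightarrow> p) F"
  shows "((\<lambda>k. cmap c (f k)) \<longlongrightarrow> cmap c p) F"
  by (rule isCont_tendsto_compose[OF _ assms(3)])
     (use chart(1,3)[OF assms(1)] assms(2) continuous_on_eq_continuous_at in blast)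

lemma tendsto_cinv:
  assumes "c \<in> A" "x \<in> cimg c" "(f \<longlongrightarrow> x) F"
  shows "((\<lambda>k. cinv c (f k)) \<longlongrightarrow> cinv c x) F"
  by (rule isCont_tendsto_compose[OF _ assms(3)])
     (use chart(2,4)[OF assms(1)] assms(2) continuous_on_eq_continuous_at in blast)

lemma ham_isoD:
  assumes "ham_iso \<phi> h"
  shows "\<And>s. bij_betw (\<phi> s) M M" "\<And>p. p \<in> M \<Longrightarrow> \<phi> 0 p = p"
    "continuous_on (UNIV \<times> M) (\<lambda>(s, p). \<phi> s p)"
    "\<And>c d. c \<in> A \<Longrightarrow> d \<in> A \<Longrightarrow> C2_on (ldom \<phi> c d) (loc \<phi> c d)"
    "\<And>c. c \<in> A \<Longrightarrow> C2_on (UNIV \<times> cimg c) (hloc h c)"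
    "\<And>c d q v. c \<in> A \<Longrightarrow> d \<in> A \<Longrightarrow> q \<in> ldom \<phi> c d \<Longrightarrow>
       om d (loc \<phi> c d q) (D (loc \<phi> c d) q (1, 0)) v = D (hloc h d) (fst q, loc \<phi> c d q) (0, v)"
    "\<And>s p. p \<in> M \<Longrightarrow> \<phi> s p \<in> M"
    "\<And>c d. c \<in> A \<Longrightarrow> d \<in> A \<Longrightarrow> open (ldom \<phi> c d)"
proof -
  show b: "\<And>s. bij_betw (\<phi> s) M M" using assms unfolding ham_iso_def by simp
  show "\<And>p. p \<in> M \<Longrightarrow> \<phi> 0 p = p" using assms unfolding ham_iso_def by simp
  show co: "continuous_on (UNIV \<times> M) (\<lambda>(s, p). \<phi> s p)" using assms unfolding ham_iso_def by blast
  show "\<And>c d. c \<in> A \<Longrightarrow> d \<in> A \<Longrightarrow> C2_on (ldom \<phi> c d) (loc \<phi> c d)"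
    using assms unfolding ham_iso_def by blast
  show "\<And>c. c \<in> A \<Longrightarrow> C2_on (UNIV \<times> cimg c) (hloc h c)" using assms unfolding ham_iso_def by blast
  show "\<And>c d q v. c \<in> A \<Longrightarrow> d \<in> A \<Longrightarrow> q \<in> ldom \<phi> c d \<Longrightarrow>
       om d (loc \<phi> c d q) (D (loc \<phi> c d) q (1, 0)) v = D (hloc h d) (fst q, loc \<phi> c d q) (0, v)"
    using assms unfolding ham_iso_def by blast
  show "\<phi> s p \<in> M" if "p \<in> M" for s p using b[of s] that by (auto simp: bij_betw_def)
  show "open (ldom \<phi> c d)" if "c \<in> A" "d \<in> A" for c d by (rule open_ldom[OF co that])
qed

lemma loc_in: "d \<in> A \<Longrightarrow> q \<in> ldom \<phi> c d \<Longrightarrow> loc \<phi> c d q \<in> cimg d"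
  unfolding ldom_def loc_def by auto

lemma ldom_snd: "q \<in> ldom \<phi> c d \<Longrightarrow> snd q \<in> cimg c"
  unfolding ldom_def by auto

lemma cinv_loc: "d \<in> A \<Longrightarrow> q \<in> ldom \<phi> c d \<Longrightarrow> cinv d (loc \<phi> c d q) = \<phi> (fst q) (cinv c (snd q))"
  unfolding ldom_def loc_def using chart(5)[of d] by auto

section \<open>Hamiltonian flows preserve the symplectic form\<close>

text \<open>
  The second isotopy supplies the Hamiltonian: \<open>relative_hamiltonian\<close> evaluates two
  Hamiltonians along one flow.
\<close>

lemma along_C2:
  assumes \<phi>: "ham_iso \<phi> h'" and h: "C2_on (UNIV \<times> cimg d) (hloc h d)" and "c \<in> A" "d \<in> A"
  shows "C2_on (ldom \<phi> c d) (\<lambda>q. hloc h d (fst q, loc \<phi> c d q))"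
    "\<And>q u. q \<in> ldom \<phi> c d \<Longrightarrow>
      D (\<lambda>q. hloc h d (fst q, loc \<phi> c d q)) q u = D (hloc h d) (fst q, loc \<phi> c d q) (fst u, D (loc \<phi> c d) q u)"
proof -
  let ?g = "\<lambda>q. (fst q, loc \<phi> c d q)"
  have o: "open (ldom \<phi> c d)" using ham_isoD(8)[OF \<phi> assms(3,4)] .
  note L = ham_isoD(4)[OF \<phi> assms(3,4)]
  have g: "C2_on (ldom \<phi> c d) ?g"
    by (intro C2_on_Pair C2_on_linear bounded_linear_fst L o)
  have in_U: "?g q \<in> UNIV \<times> cimg d" if "q \<in> ldom \<phi> c d" for q using loc_in[OF assms(4) that] by simp
  show "C2_on (ldom \<phi> c d) (\<lambda>q. hloc h d (fst q, loc \<phi> c d q))"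
    by (rule C2_on_compose[OF h g in_U o])
  fix q u assume q: "q \<in> ldom \<phi> c d"
  have "(?g has_derivative (\<lambda>u. (fst u, D (loc \<phi> c d) q u))) (at q)"
    by (intro has_derivative_Pair has_derivative_fst has_derivative_ident C2_onD(1)[OF L q])
  from has_derivative_compose[OF this C2_onD(1)[OF h in_U[OF q]]]
  show "D (\<lambda>q. hloc h d (fst q, loc \<phi> c d q)) q u = D (hloc h d) (fst q, loc \<phi> c d q) (fst u, D (loc \<phi> c d) q u)"
    by (rule D_apply)
qed

text \<open>
  Since \<open>\<omega>\<close> is closed, the time derivative of \<open>\<omega>(D\<phi> v, D\<phi> w)\<close> is a difference of spatial
  derivatives of \<open>\<omega>(\<partial>\<^sub>t\<phi>, D\<phi> \<cdot>)\<close>. By Hamilton's equation these are mixed second derivatives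
  of one function, so they cancel.
\<close>

lemma pull_time_constant:
  assumes \<phi>: "ham_iso \<phi> h" and c: "c \<in> A" "d \<in> A" and q: "q \<in> ldom \<phi> c d"
  shows "D (pull (om d) (loc \<phi> c d) (0, v) (0, w)) q (1, 0) = 0"
proof -
  let ?S = "ldom \<phi> c d" and ?G = "pull (om d) (loc \<phi> c d)"
  let ?g = "\<lambda>q. hloc h d (fst q, loc \<phi> c d q)"
  have o: "open ?S" using ham_isoD(8)[OF \<phi> c] .
  note L = ham_isoD(4)[OF \<phi> c]
  note cl = pull_closed[OF om_closed[OF c(2)] L o loc_in[OF c(2)] q]
  note g = along_C2[OF \<phi> ham_isoD(5)[OF \<phi> c(2)] c]
  have 1: "?G (1, 0) (0, v) p = D ?g p (0, v)" if "p \<in> ?S" for p v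
    unfolding pull_def g(2)[OF that] using ham_isoD(6)[OF \<phi> c that] by simp
  have 2: "?G (0, v) (1, 0) p = - D ?g p (0, v)" if "p \<in> ?S" for p v
    using 1[OF that, of v] closed_form_skew[OF om_closed[OF c(2)] loc_in[OF c(2) that],
        of "D (loc \<phi> c d) p (0, v)" "D (loc \<phi> c d) p (1, 0)"]
    unfolding pull_def by simp
  have dd: "((\<lambda>p. D ?g p u) has_derivative (\<lambda>w. D (D ?g) q w u)) (at q)" for u
    by (rule bounded_linear.has_derivative[OF blinfun.bounded_linear_left C1_onD(1)[OF C2_onD(2)[OF g(1)] q]])
  have 3: "D (?G (1, 0) (0, v)) q w = D (D ?g) q w (0, v)" for v w
  proof -
    have "(?G (1, 0) (0, v) has_derivative (\<lambda>w. D (D ?g) q w (0, v))) (at q)"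
      by (rule has_derivative_transform_within_open[OF dd o q]) (simp add: 1)
    then show ?thesis by (rule D_apply)
  qed
  have 4: "D (?G (0, v) (1, 0)) q w = - D (D ?g) q w (0, v)" for v w
  proof -
    have "(?G (0, v) (1, 0) has_derivative (\<lambda>w. - D (D ?g) q w (0, v))) (at q)"
      by (rule has_derivative_transform_within_open[OF has_derivative_minus[OF dd] o q]) (simp add: 2)
    then show ?thesis by (rule D_apply)
  qed
  show ?thesis
    using cl[of "(0, v)" "(0, w)" "(1, 0)"] 3[of v "(0, w)"] 4[of w "(0, v)"]
      second_derivative_symmetric_real[OF g(1) o q, of "(0, v)" "(0, w)"] by simp
qed

lemma pull_target_chart:
  assumes \<phi>: "ham_iso \<phi> h" and c: "c \<in> A" "d \<in> A" "d' \<in> A" and q: "q \<in> ldom \<phi> c d" "q \<in> ldom \<phi> c d'"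
  shows "pull (om d) (loc \<phi> c d) u v q = pull (om d') (loc \<phi> c d') u v q"
proof -
  let ?S = "ldom \<phi> c d \<inter> ldom \<phi> c d'"
  have o: "open ?S" using ham_isoD(8)[OF \<phi> c(1)] c by blast
  have ov: "loc \<phi> c d p \<in> overlap d d'" if "p \<in> ?S" for p
    using that loc_in[OF c(2), of p] cinv_loc[OF c(2), of p] unfolding overlap_def ldom_def by auto
  have t: "transition d d' (loc \<phi> c d p) = loc \<phi> c d' p" if "p \<in> ?S" for p
  proof -
    have "cinv d (loc \<phi> c d p) = \<phi> (fst p) (cinv c (snd p))" using cinv_loc[OF c(2)] that by blast
    then have "transition d d' (loc \<phi> c d p) = cmap d' (\<phi> (fst p) (cinv c (snd p)))"
      unfolding transition_def by simp
    then show ?thesis by (simp add: loc_def split_def)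
  qed
  have qS: "q \<in> ?S" using q by simp
  have "((\<lambda>p. transition d d' (loc \<phi> c d p)) has_derivative
      (\<lambda>u. D (transition d d') (loc \<phi> c d q) (D (loc \<phi> c d) q u))) (at q)"
    by (rule has_derivative_compose[OF C2_onD(1)[OF ham_isoD(4)[OF \<phi> c(1,2)] q(1)]
        C2_onD(1)[OF transition_C2[OF c(2,3)] ov[OF qS]]])
  then have "(loc \<phi> c d' has_derivative (\<lambda>u. D (transition d d') (loc \<phi> c d q) (D (loc \<phi> c d) q u))) (at q)"
    by (rule has_derivative_transform_within_open[OF _ o qS]) (rule t)
  then have "D (loc \<phi> c d') q u = D (transition d d') (loc \<phi> c d q) (D (loc \<phi> c d) q u)" for u
    by (rule D_apply)
  then show ?thesis unfolding pull_def
    using om_transition[OF c(2,3) ov[OF qS]] t[OF qS] by simp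
qed

text \<open>
  The orbit of a point passes through several charts, so the previous lemma is applied to a function
  of time that is computed in any chart around the current point of the orbit.
\<close>

lemma flow_preserves_om:
  assumes \<phi>: "ham_iso \<phi> h" and c: "c \<in> A" "d \<in> A" and q: "(s, x) \<in> ldom \<phi> c d"
  shows "om d (loc \<phi> c d (s, x)) (D (loc \<phi> c d) (s, x) (0, v)) (D (loc \<phi> c d) (s, x) (0, w)) = om c x v w"
proof -
  define p where "p = cinv c x"
  have x: "x \<in> cimg c" "p \<in> cdom c" "p \<in> M"
    using q chart(7,8)[OF c(1)] unfolding ldom_def p_def by auto
  define ch where "ch s = (SOME d. d \<in> A \<and> \<phi> s p \<in> cdom d)" for s
  have ch: "ch s \<in> A" "\<phi> s p \<in> cdom (ch s)" for s
    using someI_ex[of "\<lambda>d. d \<in> A \<and> \<phi> s p \<in> cdom d"] ex_chart[OF ham_isoD(7)[OF \<phi> x(3)], of s]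
    unfolding ch_def by blast+
  define \<beta> where "\<beta> s = pull (om (ch s)) (loc \<phi> c (ch s)) (0, v) (0, w) (s, x)" for s
  have in_ldom: "(s, x) \<in> ldom \<phi> c d \<longleftrightarrow> \<phi> s p \<in> cdom d" for s d
    using x(1) unfolding ldom_def p_def by simp
  have \<beta>: "\<beta> s = pull (om d) (loc \<phi> c d) (0, v) (0, w) (s, x)" if "d \<in> A" "(s, x) \<in> ldom \<phi> c d" for s d
    unfolding \<beta>_def by (rule pull_target_chart[OF \<phi> c(1) ch(1) that(1) _ that(2)]) (use ch(2) in_ldom in blast)
  have "DERIV \<beta> s :> 0" for s
  proof -
    let ?d = "ch s"
    have q: "(s, x) \<in> ldom \<phi> c ?d" using in_ldom ch(2) by blast
    have C: "C1_on (ldom \<phi> c ?d) (pull (om ?d) (loc \<phi> c ?d) (0, v) (0, w))"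
      by (rule pull_C1(1)[OF C2_onD(5)[OF om_C2[OF ch(1)]] ham_isoD(4)[OF \<phi> c(1) ch(1)] loc_in[OF ch(1)]])
    have "((\<lambda>t. (t, x)) has_derivative (\<lambda>t. (t, 0))) (at s)" by (auto intro!: derivative_eq_intros)
    from has_derivative_compose[OF this C1_onD(1)[OF C q]]
    have "((\<lambda>t. pull (om ?d) (loc \<phi> c ?d) (0, v) (0, w) (t, x)) has_derivative
        (\<lambda>t. D (pull (om ?d) (loc \<phi> c ?d) (0, v) (0, w)) (s, x) (t, 0))) (at s)" .
    moreover have "D (pull (om ?d) (loc \<phi> c ?d) (0, v) (0, w)) (s, x) (t, 0) = 0 * t" for t
      using pull_time_constant[OF \<phi> c(1) ch(1) q, of v w]
        blinfun.scaleR_right[of "D (pull (om ?d) (loc \<phi> c ?d) (0, v) (0, w)) (s, x)" t "(1, 0)"] by simp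
    ultimately have "DERIV (\<lambda>t. pull (om ?d) (loc \<phi> c ?d) (0, v) (0, w) (t, x)) s :> 0"
      unfolding has_field_derivative_def by (simp add: lambda_zero)
    moreover have "open {t. (t, x) \<in> ldom \<phi> c ?d}"
    proof -
      have "open ((\<lambda>t. (t, x)) -` ldom \<phi> c ?d)"
        by (rule open_vimage[OF ham_isoD(8)[OF \<phi> c(1) ch(1)]]) (intro continuous_intros)
      then show ?thesis by (simp add: vimage_def)
    qed
    ultimately show ?thesis
      using q by (elim has_field_derivative_transform_within_open) (auto simp: \<beta>[OF ch(1)])
  qed
  then have "\<beta> s = \<beta> 0" using DERIV_isconst_all by blast
  moreover have "\<beta> 0 = om c x v w"
  proof -
    have l0: "(0, y) \<in> ldom \<phi> c c" "loc \<phi> c c (0, y) = y" if "y \<in> cimg c" for y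
    proof -
      have "cinv c y \<in> cdom c" "cinv c y \<in> M" using chart(7,8)[OF c(1)] that by blast+
      then show "(0, y) \<in> ldom \<phi> c c" "loc \<phi> c c (0, y) = y"
        using that ham_isoD(2)[OF \<phi>, of "cinv c y"] chart(6)[OF c(1) that] unfolding ldom_def loc_def by simp_all
    qed
    have "((\<lambda>y. (0 :: real, y)) has_derivative (\<lambda>v. (0, v))) (at x)" by (auto intro!: derivative_eq_intros)
    from has_derivative_compose[OF this C2_onD(1)[OF ham_isoD(4)[OF \<phi> c(1,1)] l0(1)[OF x(1)]]]
    have "((\<lambda>y. loc \<phi> c c (0, y)) has_derivative (\<lambda>v. D (loc \<phi> c c) (0, x) (0, v))) (at x)" .
    then have "((\<lambda>y. y) has_derivative (\<lambda>v. D (loc \<phi> c c) (0, x) (0, v))) (at x)"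
      by (rule has_derivative_transform_within_open[OF _ chart(2)[OF c(1)] x(1)]) (rule l0)
    then have "(\<lambda>v. D (loc \<phi> c c) (0, x) (0, v)) = (\<lambda>v. v)"
      using has_derivative_unique[OF _ has_derivative_ident] by blast
    then have "D (loc \<phi> c c) (0, x) (0, v) = v" for v by meson
    then show ?thesis using \<beta>[OF c(1) l0(1)[OF x(1)]] l0(2)[OF x(1)] unfolding pull_def by simp
  qed
  moreover have "\<beta> s = om d (loc \<phi> c d (s, x)) (D (loc \<phi> c d) (s, x) (0, v)) (D (loc \<phi> c d) (s, x) (0, w))"
    using \<beta>[OF c(2) q] unfolding pull_def .
  ultimately show ?thesis by simp
qed

text \<open>
  The flow as a map of space-time, a local diffeomorphism; its inverse controls the inverses of
  the flow at all times simultaneously.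
\<close>

definition graph_loc :: "(real \<Rightarrow> 'm \<Rightarrow> 'm) \<Rightarrow> ('m, 'e) chart \<Rightarrow> ('m, 'e) chart \<Rightarrow> real \<times> 'e \<Rightarrow> real \<times> 'e"
  where "graph_loc \<phi> c d q = (fst q, loc \<phi> c d q)"

lemma graph_loc_has_derivative:
  assumes "C2_on (ldom \<phi> c d) (loc \<phi> c d)" "q \<in> ldom \<phi> c d"
  shows "D (graph_loc \<phi> c d) q u = (fst u, D (loc \<phi> c d) q u)"
proof -
  have "(graph_loc \<phi> c d has_derivative (\<lambda>u. (fst u, D (loc \<phi> c d) q u))) (at q)"
    unfolding graph_loc_def[abs_def]
    by (intro has_derivative_Pair has_derivative_fst has_derivative_ident C2_onD(1)[OF assms])
  then show ?thesis by (rule D_apply)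
qed

lemma graph_loc_C2:
  assumes "C2_on (ldom \<phi> c d) (loc \<phi> c d)" "open (ldom \<phi> c d)"
  shows "C2_on (ldom \<phi> c d) (graph_loc \<phi> c d)"
  unfolding graph_loc_def[abs_def] by (intro C2_on_Pair C2_on_linear bounded_linear_fst assms)

text \<open>
  A vector in the kernel is spatial, and it pairs to zero with all vectors because the flow preserves
  the nondegenerate form \<open>\<omega>\<close>.
\<close>

lemma graph_loc_inj:
  assumes \<phi>: "ham_iso \<phi> h" and c: "c \<in> A" "d \<in> A" and q: "q \<in> ldom \<phi> c d"
  shows "inj (blinfun_apply (D (graph_loc \<phi> c d) q))"
proof (rule linear_injective_0[OF bounded_linear.linear[OF blinfun.bounded_linear_right], THEN iffD2], intro allI impI)
  obtain s x where sx: "q = (s, x)" by (metis surj_pair)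
  have x: "x \<in> cimg c" using q unfolding sx ldom_def by simp
  fix u assume 0: "D (graph_loc \<phi> c d) q u = 0"
  obtain a v where u: "u = (a, v)" by (metis surj_pair)
  have "a = 0" "D (loc \<phi> c d) q (0, v) = 0"
    using 0 unfolding graph_loc_has_derivative[OF ham_isoD(4)[OF \<phi> c] q] u by (auto simp: zero_prod_def)
  then have "om c x v w = 0" for w
    using flow_preserves_om[OF \<phi> c q[unfolded sx], of v w] sx by (simp add: blinfun.bilinear_simps)
  then have "v = 0" using om_nondeg[OF c(1) x] by blast
  then show "u = 0" using \<open>a = 0\<close> u by (simp add: zero_prod_def)
qed

section \<open>The isotopy between two Hamiltonian isotopies\<close>

text \<open>
  Joint continuity of \<open>(s, q) \<mapsto> \<phi>\<^sub>s\<^sup>-\<^sup>1(q)\<close>. For a general filter, so that it covers sequences of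
  different isotopies as well.
\<close>

lemma flow_inverse_continuous:
  assumes \<phi>: "ham_iso \<phi> h" and p: "p \<in> M" and S: "(S \<longlongrightarrow> s) F"
    and P: "\<forall>\<^sub>F k in F. P k \<in> M" and lim: "((\<lambda>k. \<phi> (S k) (P k)) \<longlongrightarrow> \<phi> s p) F"
  shows "(P \<longlongrightarrow> p) F"
proof -
  obtain c where c: "c \<in> A" "p \<in> cdom c" using ex_chart[OF p] by blast
  obtain d where d: "d \<in> A" "\<phi> s p \<in> cdom d" using ex_chart[OF ham_isoD(7)[OF \<phi> p]] by blast
  define x where "x = cmap c p"
  have x: "x \<in> cimg c" "cinv c x = p" using c chart(5)[OF c(1)] unfolding x_def by auto
  have q: "(s, x) \<in> ldom \<phi> c d" using x d unfolding ldom_def by simp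
  let ?G = "graph_loc \<phi> c d"
  have C: "C2_on (ldom \<phi> c d) ?G" by (rule graph_loc_C2[OF ham_isoD(4)[OF \<phi> c(1) d(1)] ham_isoD(8)[OF \<phi> c(1) d(1)]])
  obtain U V g where U: "open U" "U \<subseteq> ldom \<phi> c d" "(s, x) \<in> U" "open V" "?G (s, x) \<in> V"
    and hom: "homeomorphism U V ?G g"
    using inverse_function_theorem[OF ham_isoD(8)[OF \<phi> c(1) d(1)] C2_onD(1)[OF C] C2_onD(3)[OF C] q
        blinfun_inv(1)[OF graph_loc_inj[OF \<phi> c(1) d(1) q]]] by metis
  have Gx: "?G (s, x) = (s, cmap d (\<phi> s p))" by (simp add: graph_loc_def loc_def x(2))
  have cd: "((\<lambda>k. cmap d (\<phi> (S k) (P k))) \<longlongrightarrow> cmap d (\<phi> s p)) F"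
    by (rule tendsto_cmap[OF d lim])
  have ev1: "\<forall>\<^sub>F k in F. \<phi> (S k) (P k) \<in> cdom d" using topological_tendstoD[OF lim chart(1)[OF d(1)] d(2)] .
  have lim2: "((\<lambda>k. (S k, cmap d (\<phi> (S k) (P k)))) \<longlongrightarrow> ?G (s, x)) F"
    unfolding Gx by (intro tendsto_Pair S cd)
  have ev2: "\<forall>\<^sub>F k in F. (S k, cmap d (\<phi> (S k) (P k))) \<in> V" using topological_tendstoD[OF lim2 U(4,5)] .
  have "isCont g (?G (s, x))"
    using hom U(4,5) by (simp add: homeomorphism_def continuous_on_eq_continuous_at)
  then have lim3: "((\<lambda>k. g (S k, cmap d (\<phi> (S k) (P k)))) \<longlongrightarrow> g (?G (s, x))) F"
    using lim2 by (rule isCont_tendsto_compose)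
  have gG: "g (?G (s, x)) = (s, x)" using hom U(3) by (simp add: homeomorphism_def)
  have ev3: "\<forall>\<^sub>F k in F. cinv c (snd (g (S k, cmap d (\<phi> (S k) (P k))))) = P k"
    using ev1 ev2 P
  proof eventually_elim
    case (elim k)
    let ?y = "g (S k, cmap d (\<phi> (S k) (P k)))"
    have yU: "?y \<in> U" and Gy: "?G ?y = (S k, cmap d (\<phi> (S k) (P k)))"
      using hom elim(2) unfolding homeomorphism_def by auto
    then have y: "fst ?y = S k" "cmap d (\<phi> (S k) (cinv c (snd ?y))) = cmap d (\<phi> (S k) (P k))"
      unfolding graph_loc_def loc_def by (auto simp: split_def)
    have "?y \<in> ldom \<phi> c d" using yU U(2) by blast
    then have y2: "snd ?y \<in> cimg c" "\<phi> (S k) (cinv c (snd ?y)) \<in> cdom d"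
      using y(1) unfolding ldom_def by auto
    have "\<phi> (S k) (cinv c (snd ?y)) = \<phi> (S k) (P k)"
      using y(2) y2(2) elim(1) chart(5)[OF d(1)] by metis
    moreover have "cinv c (snd ?y) \<in> M" using y2(1) chart(7,8)[OF c(1)] by blast
    ultimately show ?case using ham_isoD(1)[OF \<phi>, of "S k"] elim(3) by (meson bij_betw_imp_inj_on inj_onD)
  qed
  have "((\<lambda>k. snd (g (S k, cmap d (\<phi> (S k) (P k))))) \<longlongrightarrow> x) F"
    using tendsto_snd[OF lim3] gG by simp
  then have "((\<lambda>k. cinv c (snd (g (S k, cmap d (\<phi> (S k) (P k)))))) \<longlongrightarrow> cinv c x) F"
    by (rule tendsto_cinv[OF c(1) x(1)])
  then show ?thesis using Lim_transform_eventually ev3 x(2) by fastforce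
qed

definition relative_isotopy :: "(real \<Rightarrow> 'm \<Rightarrow> 'm) \<Rightarrow> (real \<Rightarrow> 'm \<Rightarrow> 'm) \<Rightarrow> real \<Rightarrow> 'm \<Rightarrow> 'm"
  where "relative_isotopy \<phi> \<zeta> s p = inv_into M (\<phi> s) (\<zeta> s p)"

lemma relative_isotopy:
  assumes \<phi>: "ham_iso \<phi> h" and \<zeta>: "ham_iso \<zeta> k" and p: "p \<in> M"
  shows "relative_isotopy \<phi> \<zeta> s p \<in> M" "\<phi> s (relative_isotopy \<phi> \<zeta> s p) = \<zeta> s p" "relative_isotopy \<phi> \<zeta> 0 p = p"
proof -
  have "\<zeta> s p \<in> \<phi> s ` M" for s using ham_isoD(1)[OF \<phi>] ham_isoD(7)[OF \<zeta> p] by (simp add: bij_betw_def)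
  then show 1: "relative_isotopy \<phi> \<zeta> s p \<in> M" "\<phi> s (relative_isotopy \<phi> \<zeta> s p) = \<zeta> s p" for s
    unfolding relative_isotopy_def by (simp_all add: inv_into_into f_inv_into_f)
  have "\<phi> 0 (relative_isotopy \<phi> \<zeta> 0 p) = relative_isotopy \<phi> \<zeta> 0 p" by (rule ham_isoD(2)[OF \<phi> 1(1)])
  then show "relative_isotopy \<phi> \<zeta> 0 p = p" using 1(2)[of 0] ham_isoD(2)[OF \<zeta> p] by simp
qed

lemma relative_isotopy_continuous:
  assumes \<phi>: "ham_iso \<phi> h" and \<zeta>: "ham_iso \<zeta> k"
  shows "continuous_on (UNIV \<times> M) (\<lambda>(s, p). relative_isotopy \<phi> \<zeta> s p)"
  unfolding continuous_on_def
proof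
  fix q :: "real \<times> 'm" assume q: "q \<in> UNIV \<times> M"
  obtain s p where sp: "q = (s, p)" "p \<in> M" using q by auto
  let ?F = "at q within UNIV \<times> M"
  have id: "((\<lambda>q. q) \<longlongrightarrow> q) ?F" by (rule tendsto_ident_at)
  have ev: "\<forall>\<^sub>F q in ?F. snd q \<in> M" by (auto intro!: always_eventually simp: eventually_at_filter)
  have "((\<lambda>(s, p). \<zeta> s p) \<longlongrightarrow> \<zeta> s p) ?F"
    using ham_isoD(3)[OF \<zeta>] q unfolding continuous_on_def sp by auto
  then have z: "((\<lambda>q. \<zeta> (fst q) (snd q)) \<longlongrightarrow> \<zeta> s p) ?F" by (simp add: split_def)
  have "((\<lambda>q. relative_isotopy \<phi> \<zeta> (fst q) (snd q)) \<longlongrightarrow> relative_isotopy \<phi> \<zeta> s p) ?F"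
  proof (rule flow_inverse_continuous[OF \<phi> relative_isotopy(1)[OF \<phi> \<zeta> sp(2)]])
    show "(fst \<longlongrightarrow> s) ?F" using tendsto_fst[OF id] sp(1) by simp
    show "\<forall>\<^sub>F q in ?F. relative_isotopy \<phi> \<zeta> (fst q) (snd q) \<in> M"
      using ev by eventually_elim (rule relative_isotopy(1)[OF \<phi> \<zeta>])
    have "\<forall>\<^sub>F q in ?F. \<zeta> (fst q) (snd q) = \<phi> (fst q) (relative_isotopy \<phi> \<zeta> (fst q) (snd q))"
      using ev by eventually_elim (rule relative_isotopy(2)[OF \<phi> \<zeta>, symmetric])
    with Lim_transform_eventually[OF z] show "((\<lambda>q. \<phi> (fst q) (relative_isotopy \<phi> \<zeta> (fst q) (snd q))) \<longlongrightarrow> \<phi> s (relative_isotopy \<phi> \<zeta> s p)) ?F"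
      using relative_isotopy(2)[OF \<phi> \<zeta> sp(2)] by simp
  qed
  then show "((\<lambda>(s, p). relative_isotopy \<phi> \<zeta> s p) \<longlongrightarrow> (case q of (s, p) \<Rightarrow> relative_isotopy \<phi> \<zeta> s p)) ?F"
    using sp(1) by (simp add: split_def)
qed

text \<open>
  In coordinates \<open>\<psi> = \<phi>\<^sup>-\<^sup>1 \<zeta>\<close> is the solution of \<open>\<phi>(s, \<psi>(s, x)) = \<zeta>(s, x)\<close>, so it is as regular as
  the two flows, and the chain rule relates the derivatives.
\<close>

lemma relative_isotopy_local:
  assumes \<phi>: "ham_iso \<phi> h" and \<zeta>: "ham_iso \<zeta> k" and c: "c \<in> A" "c' \<in> A" "d \<in> A"
  defines "T \<equiv> ldom (relative_isotopy \<phi> \<zeta>) c c' \<inter> ldom \<zeta> c d"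
  shows "open T" "C2_on T (loc (relative_isotopy \<phi> \<zeta>) c c')"
    "\<And>q. q \<in> T \<Longrightarrow> graph_loc (relative_isotopy \<phi> \<zeta>) c c' q \<in> ldom \<phi> c' d"
    "\<And>q. q \<in> T \<Longrightarrow> loc \<phi> c' d (graph_loc (relative_isotopy \<phi> \<zeta>) c c' q) = loc \<zeta> c d q"
    "\<And>q u. q \<in> T \<Longrightarrow> D (loc \<phi> c' d) (graph_loc (relative_isotopy \<phi> \<zeta>) c c' q) (fst u, D (loc (relative_isotopy \<phi> \<zeta>) c c') q u)
        = D (loc \<zeta> c d) q u"
    "\<And>q u. q \<in> T \<Longrightarrow> D (graph_loc \<phi> c' d) (graph_loc (relative_isotopy \<phi> \<zeta>) c c' q) (fst u, D (loc (relative_isotopy \<phi> \<zeta>) c c') q u)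
        = (fst u, D (loc \<zeta> c d) q u)"
proof -
  let ?\<psi> = "relative_isotopy \<phi> \<zeta>" and ?w = "graph_loc (relative_isotopy \<phi> \<zeta>) c c'"
  have o1: "open (ldom ?\<psi> c c')" by (rule open_ldom[OF relative_isotopy_continuous[OF \<phi> \<zeta>] c(1,2)])
  then show o: "open T" unfolding T_def using ham_isoD(8)[OF \<zeta> c(1,3)] by blast
  have M: "cinv c (snd q) \<in> M" "snd q \<in> cimg c" if "q \<in> T" for q
    using that chart(7,8)[OF c(1)] unfolding T_def ldom_def by auto
  have wq: "?w q = (fst q, cmap c' (?\<psi> (fst q) (cinv c (snd q))))" for q
    unfolding graph_loc_def loc_def by (simp add: split_def)
  have inv: "cinv c' (snd (?w q)) = ?\<psi> (fst q) (cinv c (snd q))" "snd (?w q) \<in> cimg c'" if "q \<in> T" for q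
    using that chart(5)[OF c(2)] unfolding wq T_def ldom_def by auto
  show wS: "?w q \<in> ldom \<phi> c' d" if "q \<in> T" for q
    using inv[OF that] relative_isotopy(2)[OF \<phi> \<zeta> M(1)[OF that], of "fst q"] that
    unfolding ldom_def T_def by (auto simp: wq)
  show leq: "loc \<phi> c' d (?w q) = loc \<zeta> c d q" if "q \<in> T" for q
    using inv[OF that] relative_isotopy(2)[OF \<phi> \<zeta> M(1)[OF that], of "fst q"]
    unfolding loc_def by (simp add: split_def wq)
  have cw: "continuous_on T ?w"
  proof -
    have 1: "continuous_on T (\<lambda>q. (fst q, cinv c (snd q)))"
      by (intro continuous_intros continuous_on_compose2[OF chart(4)[OF c(1)] continuous_on_snd[OF continuous_on_id]])
         (use M in auto)
    have "continuous_on T (\<lambda>q. (\<lambda>(s, p). ?\<psi> s p) (fst q, cinv c (snd q)))"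
      by (rule continuous_on_compose2[OF relative_isotopy_continuous[OF \<phi> \<zeta>] 1]) (use M in auto)
    then have "continuous_on T (\<lambda>q. ?\<psi> (fst q) (cinv c (snd q)))" by simp
    then have "continuous_on T (\<lambda>q. cmap c' (?\<psi> (fst q) (cinv c (snd q))))"
      by (rule continuous_on_compose2[OF chart(3)[OF c(2)]]) (auto simp: T_def ldom_def)
    then show ?thesis unfolding wq[abs_def] by (intro continuous_intros)
  qed
  have G: "C2_on T (graph_loc \<zeta> c d)"
    by (rule C2_on_subset[OF graph_loc_C2[OF ham_isoD(4,8)[OF \<zeta> c(1,3)]]]) (simp add: T_def)
  have eq: "graph_loc \<phi> c' d (?w q) = graph_loc \<zeta> c d q" if "q \<in> T" for q
    using leq[OF that] unfolding graph_loc_def by simp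
  have imp1: "C2_on T ?w"
    by (rule implicit_C2(1)[OF graph_loc_C2[OF ham_isoD(4,8)[OF \<phi> c(2,3)]] ham_isoD(8)[OF \<phi> c(2,3)]
      graph_loc_inj[OF \<phi> c(2,3)] o cw wS G eq])
  have imp2: "D (graph_loc \<phi> c' d) (?w q) (D ?w q u) = D (graph_loc \<zeta> c d) q u" if "q \<in> T" for q u
    by (rule implicit_C2(2)[OF graph_loc_C2[OF ham_isoD(4,8)[OF \<phi> c(2,3)]] ham_isoD(8)[OF \<phi> c(2,3)]
      graph_loc_inj[OF \<phi> c(2,3)] o cw wS G eq that])
  have "C2_on T (\<lambda>q. snd (?w q))" by (rule C2_on_linear_compose[OF bounded_linear_snd imp1 o])
  then show C: "C2_on T (loc ?\<psi> c c')" unfolding graph_loc_def by simp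
  have Dw: "D ?w q u = (fst u, D (loc ?\<psi> c c') q u)" if "q \<in> T" for q u
  proof -
    have "(?w has_derivative (\<lambda>u. (fst u, D (loc ?\<psi> c c') q u))) (at q)"
      unfolding graph_loc_def[abs_def]
      by (intro has_derivative_Pair has_derivative_fst has_derivative_ident C2_onD(1)[OF C that])
    then show ?thesis by (rule D_apply)
  qed
  show 6: "D (graph_loc \<phi> c' d) (?w q) (fst u, D (loc ?\<psi> c c') q u) = (fst u, D (loc \<zeta> c d) q u)" if "q \<in> T" for q u
    using imp2[OF that, of u] Dw[OF that] graph_loc_has_derivative[OF ham_isoD(4)[OF \<zeta> c(1,3)], of q u] that
    unfolding T_def by simp
  show "D (loc \<phi> c' d) (?w q) (fst u, D (loc ?\<psi> c c') q u) = D (loc \<zeta> c d) q u" if "q \<in> T" for q u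
    using 6[OF that, of u] graph_loc_has_derivative[OF ham_isoD(4)[OF \<phi> c(2,3)] wS[OF that]] by simp
qed

text \<open>
  An abstraction of the relative isotopy of two flows. The last clause is Hamilton's
  equation paired with vectors tangent to the image of a family of points; there \<open>\<kappa>\<close> is the generating
  Hamiltonian at the end point of the orbit, as a function of the starting point.
\<close>

definition rel_iso :: "(real \<Rightarrow> 'm \<Rightarrow> 'm) \<Rightarrow> (real \<Rightarrow> 'm \<Rightarrow> real) \<Rightarrow> bool"
  where "rel_iso \<psi> \<kappa> \<longleftrightarrow>
    (\<forall>s. \<forall>p\<in>M. \<psi> s p \<in> M) \<and> (\<forall>p\<in>M. \<psi> 0 p = p) \<and>
    continuous_on (UNIV \<times> M) (\<lambda>(s, p). \<psi> s p) \<and>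
    (\<forall>c\<in>A. \<forall>d\<in>A. C2_on (ldom \<psi> c d) (loc \<psi> c d)) \<and>
    (\<forall>c\<in>A. C2_on (UNIV \<times> cimg c) (hloc \<kappa> c)) \<and>
    (\<forall>c\<in>A. \<forall>d\<in>A. \<forall>q\<in>ldom \<psi> c d. \<forall>v.
       om d (loc \<psi> c d q) (D (loc \<psi> c d) q (1, 0)) (D (loc \<psi> c d) q (0, v)) = D (hloc \<kappa> c) q (0, v))"

definition relative_hamiltonian :: "(real \<Rightarrow> 'm \<Rightarrow> 'm) \<Rightarrow> (real \<Rightarrow> 'm \<Rightarrow> real) \<Rightarrow> (real \<Rightarrow> 'm \<Rightarrow> real) \<Rightarrow> real \<Rightarrow> 'm \<Rightarrow> real"
  where "relative_hamiltonian \<zeta> k h s p = k s (\<zeta> s p) - h s (\<zeta> s p)"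

text \<open>
  Since \<open>\<phi>\<close> preserves \<open>\<omega>\<close>, the vectors may be mapped forward by \<open>D\<phi>\<close>. The velocity of \<open>\<psi>\<close> then
  becomes the difference of the velocities of \<open>\<zeta>\<close> and \<open>\<phi>\<close> at the same point, to which Hamilton's
  equations of the two flows apply.
\<close>

lemma rel_iso_relative_isotopy:
  assumes \<phi>: "ham_iso \<phi> h" and \<zeta>: "ham_iso \<zeta> k"
  shows "rel_iso (relative_isotopy \<phi> \<zeta>) (relative_hamiltonian \<zeta> k h)"
proof -
  let ?\<psi> = "relative_isotopy \<phi> \<zeta>" and ?\<kappa> = "relative_hamiltonian \<zeta> k h"
  have exd: "\<exists>d\<in>A. q \<in> ldom \<zeta> c d" if "c \<in> A" "snd q \<in> cimg c" for c q
    using ex_chart[OF ham_isoD(7)[OF \<zeta>, of "cinv c (snd q)" "fst q"]] that chart(7,8)[OF that(1)]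
    unfolding ldom_def by (auto simp: split_def)
  have C2: "C2_on (ldom ?\<psi> c c') (loc ?\<psi> c c')" if c: "c \<in> A" "c' \<in> A" for c c'
  proof (rule C2_on_local)
    show "open (ldom ?\<psi> c c')" by (rule open_ldom[OF relative_isotopy_continuous[OF \<phi> \<zeta>] c])
    fix q assume q: "q \<in> ldom ?\<psi> c c'"
    obtain d where d: "d \<in> A" "q \<in> ldom \<zeta> c d" using exd[OF c(1) ldom_snd[OF q]] by blast
    then show "\<exists>T. open T \<and> q \<in> T \<and> C2_on (T \<inter> ldom ?\<psi> c c') (loc ?\<psi> c c')"
      using relative_isotopy_local(1,2)[OF \<phi> \<zeta> c d(1)] q
      by (intro exI[of _ "ldom ?\<psi> c c' \<inter> ldom \<zeta> c d"]) (auto simp: Int_ac)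
  qed
  have hk: "hloc ?\<kappa> c q = hloc k d (fst q, loc \<zeta> c d q) - hloc h d (fst q, loc \<zeta> c d q)"
    if "c \<in> A" "d \<in> A" "q \<in> ldom \<zeta> c d" for c d q
    using cinv_loc[OF that(2,3)] unfolding hloc_def relative_hamiltonian_def by (simp add: split_def)
  have C2k: "C2_on (UNIV \<times> cimg c) (hloc ?\<kappa> c)" if c: "c \<in> A" for c
  proof (rule C2_on_local)
    show o: "open ((UNIV :: real set) \<times> cimg c)" using chart(2)[OF c] by (simp add: open_Times)
    fix q :: "real \<times> 'e" assume q: "q \<in> UNIV \<times> cimg c"
    obtain d where d: "d \<in> A" "q \<in> ldom \<zeta> c d" using exd[OF c, of q] q by auto
    have sub: "ldom \<zeta> c d \<inter> UNIV \<times> cimg c = ldom \<zeta> c d" unfolding ldom_def by auto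
    have "C2_on (ldom \<zeta> c d) (hloc ?\<kappa> c)"
      using C2_on_cong[OF ham_isoD(8)[OF \<zeta> c d(1)] hk[symmetric, OF c d(1)]
         C2_on_diff[OF along_C2(1)[OF \<zeta> ham_isoD(5)[OF \<zeta> d(1)] c d(1)] along_C2(1)[OF \<zeta> ham_isoD(5)[OF \<phi> d(1)] c d(1)]
           ham_isoD(8)[OF \<zeta> c d(1)]]] .
    then show "\<exists>T. open T \<and> q \<in> T \<and> C2_on (T \<inter> UNIV \<times> cimg c) (hloc ?\<kappa> c)"
      using d ham_isoD(8)[OF \<zeta> c d(1)] sub by auto
  qed
  have ode: "om c' (loc ?\<psi> c c' q) (D (loc ?\<psi> c c') q (1, 0)) (D (loc ?\<psi> c c') q (0, v)) = D (hloc ?\<kappa> c) q (0, v)"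
    if c: "c \<in> A" "c' \<in> A" and q: "q \<in> ldom ?\<psi> c c'" for c c' q v
  proof -
    obtain d where d: "d \<in> A" "q \<in> ldom \<zeta> c d" using exd[OF c(1) ldom_snd[OF q]] by blast
    let ?a = "D (loc ?\<psi> c c') q (1, 0)" and ?b = "D (loc ?\<psi> c c') q (0, v)"
    let ?w = "graph_loc ?\<psi> c c' q"
    let ?B = "D (loc \<phi> c' d) ?w"
    have qT: "q \<in> ldom ?\<psi> c c' \<inter> ldom \<zeta> c d" using q d by blast
    note r = relative_isotopy_local[OF \<phi> \<zeta> c d(1)]
    have w: "?w = (fst q, loc ?\<psi> c c' q)" unfolding graph_loc_def ..
    have z: "loc \<phi> c' d ?w = loc \<zeta> c d q" by (rule r(4)[OF qT])
    have Ba: "?B (1, ?a) = D (loc \<zeta> c d) q (1, 0)" using r(5)[OF qT, of "(1, 0)"] by simp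
    have Bb: "?B (0, ?b) = D (loc \<zeta> c d) q (0, v)" using r(5)[OF qT, of "(0, v)"] by simp
    have B0: "?B (0, ?a) = D (loc \<zeta> c d) q (1, 0) - ?B (1, 0)"
      using blinfun.add_right[of ?B "(0, ?a)" "(1, 0)"] Ba by (simp add: algebra_simps)
    have "om c' (loc ?\<psi> c c' q) ?a ?b = om d (loc \<phi> c' d ?w) (?B (0, ?a)) (?B (0, ?b))"
      using flow_preserves_om[OF \<phi> c(2) d(1) r(3)[OF qT, unfolded w], of ?a ?b] w by simp
    also have "\<dots> = om d (loc \<zeta> c d q) (D (loc \<zeta> c d) q (1, 0)) (?B (0, ?b)) - om d (loc \<phi> c' d ?w) (?B (1, 0)) (?B (0, ?b))"
      unfolding B0 z by (simp add: blinfun.bilinear_simps)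
    also have "\<dots> = D (hloc k d) (fst q, loc \<zeta> c d q) (0, ?B (0, ?b)) - D (hloc h d) (fst q, loc \<zeta> c d q) (0, ?B (0, ?b))"
      using ham_isoD(6)[OF \<zeta> c(1) d] ham_isoD(6)[OF \<phi> c(2) d(1) r(3)[OF qT]] z w by simp
    also have "\<dots> = D (hloc ?\<kappa> c) q (0, v)"
    proof -
      note g1 = along_C2[OF \<zeta> ham_isoD(5)[OF \<zeta> d(1)] c(1) d(1)]
      note g2 = along_C2[OF \<zeta> ham_isoD(5)[OF \<phi> d(1)] c(1) d(1)]
      have "(hloc ?\<kappa> c has_derivative (\<lambda>u. D (\<lambda>q. hloc k d (fst q, loc \<zeta> c d q)) q u - D (\<lambda>q. hloc h d (fst q, loc \<zeta> c d q)) q u)) (at q)"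
        by (rule has_derivative_transform_within_open[OF has_derivative_diff[OF C2_onD(1)[OF g1(1) d(2)] C2_onD(1)[OF g2(1) d(2)]]
            ham_isoD(8)[OF \<zeta> c(1) d(1)] d(2)]) (simp add: hk[OF c(1) d(1)])
      from fun_cong[OF D_unique[OF this], of "(0, v)"]
      show ?thesis unfolding g1(2)[OF d(2)] g2(2)[OF d(2)] Bb by simp
    qed
    finally show ?thesis .
  qed
  show ?thesis unfolding rel_iso_def
    by (intro conjI allI ballI C2 C2k ode relative_isotopy_continuous[OF \<phi> \<zeta>] relative_isotopy[OF \<phi> \<zeta>])
qed

text \<open>
  Convergence is stated by sequences of arguments, which amounts to locally uniform convergence.
  The quantification over reindexings \<open>r\<close> makes it stable under passing to subsequences.
\<close>

definition iso_conv :: "('m, 'e) chart set \<Rightarrow> (nat \<Rightarrow> real \<Rightarrow> 'm \<Rightarrow> 'm) \<Rightarrow> (real \<Rightarrow> 'm \<Rightarrow> 'm) \<Rightarrow> bool"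
  where "iso_conv B \<zeta> \<phi> \<longleftrightarrow>
    (\<forall>r S s P p. filterlim r at_top sequentially \<longrightarrow> (S \<longlonglongrightarrow> s) \<longrightarrow> (P \<longlonglongrightarrow> p) \<longrightarrow> p \<in> M \<longrightarrow>
       (\<forall>k. P k \<in> M) \<longrightarrow> (\<lambda>k. \<zeta> (r k) (S k) (P k)) \<longlonglongrightarrow> \<phi> s p) \<and>
    (\<forall>c\<in>B. \<forall>d\<in>B. \<forall>r Q q v. filterlim r at_top sequentially \<longrightarrow> q \<in> ldom \<phi> c d \<longrightarrow> (Q \<longlonglongrightarrow> q) \<longrightarrow>
       (\<lambda>k. D (loc (\<zeta> (r k)) c d) (Q k) v) \<longlonglongrightarrow> D (loc \<phi> c d) q v)"

lemma iso_conv_subseq: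
  assumes "iso_conv B \<zeta> \<phi>" "filterlim r at_top sequentially"
  shows "iso_conv B (\<lambda>k. \<zeta> (r k)) \<phi>"
proof -
  have "filterlim (\<lambda>k. r (r' k)) at_top sequentially" if "filterlim r' at_top sequentially" for r' :: "nat \<Rightarrow> nat"
    by (rule filterlim_compose[OF assms(2) that])
  then show ?thesis using assms(1) unfolding iso_conv_def by blast
qed

lemma iso_convD:
  assumes "iso_conv B \<zeta> \<phi>"
  shows "\<And>S s P p. S \<longlonglongrightarrow> s \<Longrightarrow> P \<longlonglongrightarrow> p \<Longrightarrow> p \<in> M \<Longrightarrow> (\<And>k. P k \<in> M) \<Longrightarrow> (\<lambda>k. \<zeta> k (S k) (P k)) \<longlonglongrightarrow> \<phi> s p"
    "\<And>c d Q q v. c \<in> B \<Longrightarrow> d \<in> B \<Longrightarrow> q \<in> ldom \<phi> c d \<Longrightarrow> Q \<longlonglongrightarrow> q \<Longrightarrow>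
       (\<lambda>k. D (loc (\<zeta> k) c d) (Q k) v) \<longlonglongrightarrow> D (loc \<phi> c d) q v"
proof -
  have id: "filterlim (\<lambda>k :: nat. k) at_top sequentially" by (rule filterlim_ident)
  show "(\<lambda>k. \<zeta> k (S k) (P k)) \<longlonglongrightarrow> \<phi> s p"
    if "S \<longlonglongrightarrow> s" "P \<longlonglongrightarrow> p" "p \<in> M" "\<And>k. P k \<in> M" for S s P p
    using assms that id unfolding iso_conv_def by blast
  show "(\<lambda>k. D (loc (\<zeta> k) c d) (Q k) v) \<longlonglongrightarrow> D (loc \<phi> c d) q v"
    if "c \<in> B" "d \<in> B" "q \<in> ldom \<phi> c d" "Q \<longlonglongrightarrow> q" for c d Q q v
    using assms that id unfolding iso_conv_def by blast
qed

lemma relative_isotopy_conv: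
  assumes \<phi>: "ham_iso \<phi> h" and \<zeta>: "\<And>k. ham_iso (\<zeta> k) (h' k)" and conv: "iso_conv B \<zeta> \<phi>"
    and S: "S \<longlonglongrightarrow> s" "P \<longlonglongrightarrow> p" "p \<in> M" "\<And>k. P k \<in> M"
  shows "(\<lambda>k. relative_isotopy \<phi> (\<zeta> k) (S k) (P k)) \<longlonglongrightarrow> p"
proof (rule flow_inverse_continuous[OF \<phi> S(3,1)])
  show "\<forall>\<^sub>F k in sequentially. relative_isotopy \<phi> (\<zeta> k) (S k) (P k) \<in> M" using relative_isotopy(1)[OF \<phi> \<zeta> S(4)] by simp
  show "(\<lambda>k. \<phi> (S k) (relative_isotopy \<phi> (\<zeta> k) (S k) (P k))) \<longlonglongrightarrow> \<phi> s p"
    using relative_isotopy(2)[OF \<phi> \<zeta> S(4)] iso_convD(1)[OF conv S] by simp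
qed

text \<open>
  The derivative of \<open>\<psi>\<^sub>k\<close> at a point is the inverse of \<open>D\<phi>\<close> applied to \<open>D\<zeta>\<^sub>k\<close>, and \<open>D\<zeta>\<^sub>k \<rightarrow> D\<phi>\<close>.
\<close>

lemma relative_isotopy_deriv_conv:
  assumes \<phi>: "ham_iso \<phi> h" and \<zeta>: "\<And>k. ham_iso (\<zeta> k) (h' k)" and conv: "iso_conv B \<zeta> \<phi>"
    and B: "B \<subseteq> A" "M \<subseteq> carrier B" and c: "c \<in> B"
    and S: "S \<longlonglongrightarrow> s" "X \<longlonglongrightarrow> x" "x \<in> cimg c" "\<And>k. X k \<in> cimg c"
  shows "(\<lambda>k. D (loc (relative_isotopy \<phi> (\<zeta> k)) c c) (S k, X k) (0, v)) \<longlonglongrightarrow> v"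
proof -
  define p where "p = cinv c x"
  define P where "P k = cinv c (X k)" for k
  have cA: "c \<in> A" using B(1) c by blast
  have p: "p \<in> M" "p \<in> cdom c" and P: "P k \<in> M" for k
    unfolding p_def P_def using chart(7,8)[OF cA] S by blast+
  have Pp: "P \<longlonglongrightarrow> p"
    unfolding P_def[abs_def] p_def by (rule tendsto_cinv[OF cA S(3,2)])
  obtain d where d: "d \<in> B" "\<phi> s p \<in> cdom d"
    using B(2) ham_isoD(7)[OF \<phi> p(1), of s] unfolding carrier_def by blast
  have dA: "d \<in> A" using B(1) d(1) by blast
  let ?\<psi> = "\<lambda>k. relative_isotopy \<phi> (\<zeta> k)"
  have r: "(\<lambda>k. ?\<psi> k (S k) (P k)) \<longlonglongrightarrow> p" by (rule relative_isotopy_conv[OF \<phi> \<zeta> conv S(1) Pp p(1) P])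
  have z: "(\<lambda>k. \<zeta> k (S k) (P k)) \<longlonglongrightarrow> \<phi> s p" by (rule iso_convD(1)[OF conv S(1) Pp p(1) P])
  have ev: "\<forall>\<^sub>F k in sequentially. (S k, X k) \<in> ldom (?\<psi> k) c c \<inter> ldom (\<zeta> k) c d"
    using topological_tendstoD[OF r chart(1)[OF cA] p(2)] topological_tendstoD[OF z chart(1)[OF dA] d(2)]
    by eventually_elim (use S(4) in \<open>auto simp: ldom_def P_def\<close>)
  define w where "w k = graph_loc (?\<psi> k) c c (S k, X k)" for k
  have sx: "(s, x) \<in> ldom \<phi> c d" using S(3) d(2) unfolding ldom_def p_def by simp
  have w: "w \<longlonglongrightarrow> (s, x)"
  proof -
    have "(\<lambda>k. cmap c (?\<psi> k (S k) (P k))) \<longlonglongrightarrow> cmap c p"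
      by (rule tendsto_cmap[OF cA p(2) r])
    then show ?thesis using S(1) chart(6)[OF cA S(3)]
      unfolding w_def[abs_def] graph_loc_def loc_def P_def p_def by (auto intro!: tendsto_Pair)
  qed
  let ?G = "graph_loc \<phi> c d"
  have GC: "C2_on (ldom \<phi> c d) ?G" by (rule graph_loc_C2[OF ham_isoD(4,8)[OF \<phi> cA dA]])
  have Gw: "(\<lambda>k. D ?G (w k)) \<longlonglongrightarrow> D ?G (s, x)"
    by (rule isCont_tendsto_compose[OF _ w])
       (use C2_onD(3)[OF GC] ham_isoD(8)[OF \<phi> cA dA] sx in \<open>simp add: continuous_on_eq_continuous_at\<close>)
  have wS: "\<forall>\<^sub>F k in sequentially. w k \<in> ldom \<phi> c d"
    by (rule topological_tendstoD[OF w ham_isoD(8)[OF \<phi> cA dA] sx])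
  have invlim: "(\<lambda>k. blinfun_inv (D ?G (w k))) \<longlonglongrightarrow> blinfun_inv (D ?G (s, x))"
    by (rule tendsto_blinfun_inv[OF Gw graph_loc_inj[OF \<phi> cA dA sx]])
       (use wS in eventually_elim, rule graph_loc_inj[OF \<phi> cA dA])
  have Q: "(\<lambda>k. (S k, X k)) \<longlonglongrightarrow> (s, x)" by (intro tendsto_Pair S)
  have Dz: "(\<lambda>k. D (loc (\<zeta> k) c d) (S k, X k) (0, v)) \<longlonglongrightarrow> D (loc \<phi> c d) (s, x) (0, v)"
    by (rule iso_convD(2)[OF conv c d(1) sx Q])
  have "(\<lambda>k. blinfun_inv (D ?G (w k)) (0, D (loc (\<zeta> k) c d) (S k, X k) (0, v)))
      \<longlonglongrightarrow> blinfun_inv (D ?G (s, x)) (0, D (loc \<phi> c d) (s, x) (0, v))"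
    by (intro bounded_bilinear.tendsto[OF bounded_bilinear_blinfun_apply] invlim tendsto_Pair tendsto_const Dz)
  also have "(0, D (loc \<phi> c d) (s, x) (0, v)) = D ?G (s, x) (0, v)"
    by (simp add: graph_loc_has_derivative[OF ham_isoD(4)[OF \<phi> cA dA] sx])
  also have "blinfun_inv (D ?G (s, x)) (D ?G (s, x) (0, v)) = (0, v)"
    by (rule blinfun_inv_apply(1)[OF graph_loc_inj[OF \<phi> cA dA sx]])
  finally have "(\<lambda>k. snd (blinfun_inv (D ?G (w k)) (0, D (loc (\<zeta> k) c d) (S k, X k) (0, v)))) \<longlonglongrightarrow> snd (0 :: real, v)"
    by (rule tendsto_snd)
  moreover have "\<forall>\<^sub>F k in sequentially. snd (blinfun_inv (D ?G (w k)) (0, D (loc (\<zeta> k) c d) (S k, X k) (0, v)))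
      = D (loc (?\<psi> k) c c) (S k, X k) (0, v)"
    using ev wS
  proof eventually_elim
    case (elim k)
    have "D ?G (w k) (0, D (loc (?\<psi> k) c c) (S k, X k) (0, v)) = (0, D (loc (\<zeta> k) c d) (S k, X k) (0, v))"
      using relative_isotopy_local(6)[OF \<phi> \<zeta> cA cA dA elim(1), of "(0, v)"] unfolding w_def by simp
    then show ?case using blinfun_inv_apply(1)[OF graph_loc_inj[OF \<phi> cA dA elim(2)]] by (metis snd_conv)
  qed
  ultimately show ?thesis using Lim_transform_eventually by fastforce
qed

end

section \<open>Uncountably many isotopies accumulate\<close>

text \<open>
  Read \<open>R j b\<close> as \<open>j\<close> lying in the basic open set \<open>b\<close>. There are only countably many finite
  intersections of basic sets, so those that contain countably many elements of \<open>I\<close>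
  together contain only countably many; any \<open>i\<close> outside them is an accumulation point.
\<close>

lemma condensation:
  fixes R :: "'i \<Rightarrow> 'b \<Rightarrow> bool"
  assumes "uncountable I" "countable B"
  obtains i J where "i \<in> I" "\<And>k :: nat. J k \<in> I \<and> J k \<noteq> i"
    "\<And>b. b \<in> B \<Longrightarrow> R i b \<Longrightarrow> \<forall>\<^sub>F k in sequentially. R (J k) b"
proof -
  define K where "K F = {i \<in> I. \<forall>b\<in>F. R i b}" for F
  define \<F> where "\<F> = {F. finite F \<and> F \<subseteq> B \<and> countable (K F)}"
  have "countable \<F>"
    unfolding \<F>_def
    by (rule countable_subset[OF _ countable_Collect_finite_subset[OF assms(2)]]) auto
  then have "countable (\<Union>F\<in>\<F>. K F)" by (intro countable_UN) (auto simp: \<F>_def)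
  then obtain i where i: "i \<in> I" "i \<notin> (\<Union>F\<in>\<F>. K F)"
    using assms(1) by (metis countable_subset subsetI)
  define F where "F k = {b \<in> B. R i b \<and> to_nat_on B b \<le> k}" for k
  have finF: "finite (F k)" for k
  proof (rule inj_on_finite)
    show "inj_on (to_nat_on B) (F k)"
      by (rule inj_on_subset[OF inj_on_to_nat_on[OF assms(2)]]) (auto simp: F_def)
    show "to_nat_on B ` F k \<subseteq> {..k}" by (auto simp: F_def)
  qed simp
  have "\<exists>j. j \<in> K (F k) \<and> j \<noteq> i" for k
  proof -
    have "i \<in> K (F k)" using i(1) by (auto simp: K_def F_def)
    then have "F k \<notin> \<F>" using i(2) by blast
    then have "uncountable (K (F k))" using finF unfolding \<F>_def by (auto simp: F_def)
    then have "\<not> K (F k) \<subseteq> {i}" using countable_subset[of "K (F k)" "{i}"] by auto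
    then show ?thesis by blast
  qed
  then obtain J where J: "\<And>k. J k \<in> K (F k) \<and> J k \<noteq> i" by metis
  show ?thesis
  proof (rule that[OF i(1)])
    show "J k \<in> I \<and> J k \<noteq> i" for k using J unfolding K_def by blast
    fix b assume b: "b \<in> B" "R i b"
    show "\<forall>\<^sub>F k in sequentially. R (J k) b"
      using eventually_ge_at_top[of "to_nat_on B b"]
    proof eventually_elim
      case (elim k)
      then have "b \<in> F k" using b unfolding F_def by simp
      then show ?case using J unfolding K_def by blast
    qed
  qed
qed

context symplectic
begin

text \<open>
  The basic sets are those of the compact-open topology, with countable bases of open
  sets in place of compact sets: for the isotopy, and for its derivatives in pairs of charts of the
  countable family \<open>B\<close>.
\<close>

lemma isotopies_accumulate:
  fixes \<phi> :: "'i \<Rightarrow> real \<Rightarrow> 'm \<Rightarrow> 'm"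
  assumes unc: "uncountable I" and iso: "\<And>i. i \<in> I \<Longrightarrow> ham_iso (\<phi> i) (h i)"
    and B: "countable B" "B \<subseteq> A"
  obtains i J where "i \<in> I" "\<And>k :: nat. J k \<in> I \<and> J k \<noteq> i" "iso_conv B (\<lambda>k. \<phi> (J k)) (\<phi> i)"
proof -
  obtain BR :: "real set set" where BR: "countable BR" "topological_basis BR"
    using ex_countable_basis by blast
  obtain BM :: "'m set set" where BM: "countable BM" "topological_basis BM"
    using ex_countable_basis by blast
  obtain BE :: "'e set set" where BE: "countable BE" "topological_basis BE"
    using ex_countable_basis by blast
  obtain BP :: "(real \<times> 'e) set set" where BP: "countable BP" "topological_basis BP"
    using ex_countable_basis by blast
  define R where "R i = case_sum (\<lambda>(T, U, V). \<forall>s\<in>T. \<forall>p\<in>U \<inter> M. \<phi> i s p \<in> V)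
      (\<lambda>(c, d, b, U, V). \<forall>q\<in>U. D (loc (\<phi> i) c d) q b \<in> V)" for i
  define C where "C = (BR \<times> BM \<times> BM) <+> (B \<times> B \<times> (Basis :: (real \<times> 'e) set) \<times> BP \<times> BE)"
  have "countable C"
    unfolding C_def using BR BM BE BP B by (intro countable_Plus countable_SIGMA) (auto intro: countable_finite)
  from condensation[OF unc this, of R]
  obtain i J where i: "i \<in> I" "\<And>k :: nat. J k \<in> I \<and> J k \<noteq> i"
    and ev: "\<And>b. b \<in> C \<Longrightarrow> R i b \<Longrightarrow> \<forall>\<^sub>F k in sequentially. R (J k) b" by blast
  note ii = iso[OF i(1)]
  have "iso_conv B (\<lambda>k. \<phi> (J k)) (\<phi> i)"
    unfolding iso_conv_def
  proof (intro conjI allI impI ballI)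
    fix r :: "nat \<Rightarrow> nat" and S :: "nat \<Rightarrow> real" and s P p
    assume r: "filterlim r at_top sequentially"
    assume S: "S \<longlonglongrightarrow> s" "P \<longlonglongrightarrow> p" "p \<in> M" "\<forall>k. P k \<in> M"
    show "(\<lambda>k. \<phi> (J (r k)) (S k) (P k)) \<longlonglongrightarrow> \<phi> i s p"
    proof (rule topological_tendstoI)
      fix V0 assume V0: "open V0" "\<phi> i s p \<in> V0"
      obtain V where V: "V \<in> BM" "\<phi> i s p \<in> V" "V \<subseteq> V0"
        using topological_basisE[OF BM(2) V0] by blast
      have oV: "open V" using topological_basis_open[OF BM(2) V(1)] .
      have "open ((UNIV \<times> M) \<inter> (\<lambda>(s, p). \<phi> i s p) -` V)"
        by (rule continuous_open_preimage[OF ham_isoD(3)[OF ii] open_Times[OF open_UNIV open_M] oV])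
      moreover have "(s, p) \<in> (UNIV \<times> M) \<inter> (\<lambda>(s, p). \<phi> i s p) -` V" using V(2) S(3) by simp
      ultimately obtain T' U' where T': "open T'" "open U'" "(s, p) \<in> T' \<times> U'"
        "T' \<times> U' \<subseteq> (UNIV \<times> M) \<inter> (\<lambda>(s, p). \<phi> i s p) -` V" by (rule open_prod_elim) blast
      obtain T where T: "T \<in> BR" "s \<in> T" "T \<subseteq> T'" using topological_basisE[OF BR(2) T'(1)] T'(3) by blast
      obtain U where U: "U \<in> BM" "p \<in> U" "U \<subseteq> U'" using topological_basisE[OF BM(2) T'(2)] T'(3) by blast
      have "\<phi> i s' p' \<in> V" if "s' \<in> T" "p' \<in> U" for s' p'
      proof -
        have "(s', p') \<in> T' \<times> U'" using that T(3) U(3) by blast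
        then have "(s', p') \<in> (UNIV \<times> M) \<inter> (\<lambda>(s, p). \<phi> i s p) -` V" by (rule subsetD[OF T'(4)])
        then show ?thesis by simp
      qed
      then have "R i (Inl (T, U, V))" unfolding R_def by simp
      then have "\<forall>\<^sub>F k in sequentially. R (J k) (Inl (T, U, V))"
        using ev[of "Inl (T, U, V)"] T(1) U(1) V(1) unfolding C_def by blast
      then have "\<forall>\<^sub>F k in sequentially. R (J (r k)) (Inl (T, U, V))"
        using r by (rule eventually_compose_filterlim)
      moreover have "\<forall>\<^sub>F k in sequentially. S k \<in> T"
        by (rule topological_tendstoD[OF S(1) topological_basis_open[OF BR(2) T(1)] T(2)])
      moreover have "\<forall>\<^sub>F k in sequentially. P k \<in> U"
        by (rule topological_tendstoD[OF S(2) topological_basis_open[OF BM(2) U(1)] U(2)])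
      ultimately show "\<forall>\<^sub>F k in sequentially. \<phi> (J (r k)) (S k) (P k) \<in> V0"
        by eventually_elim (use S(4) V(3) in \<open>auto simp: R_def\<close>)
    qed
  next
    fix c d q v and r :: "nat \<Rightarrow> nat" and Q
    assume r: "filterlim r at_top sequentially"
    assume c: "c \<in> B" "d \<in> B" and q: "q \<in> ldom (\<phi> i) c d" and Q: "Q \<longlonglongrightarrow> q"
    have cA: "c \<in> A" "d \<in> A" using c B(2) by blast+
    have basis: "(\<lambda>k. D (loc (\<phi> (J (r k))) c d) (Q k) b) \<longlonglongrightarrow> D (loc (\<phi> i) c d) q b" if b: "b \<in> Basis" for b
    proof (rule topological_tendstoI)
      fix V0 assume V0: "open V0" "D (loc (\<phi> i) c d) q b \<in> V0"
      obtain V where V: "V \<in> BE" "D (loc (\<phi> i) c d) q b \<in> V" "V \<subseteq> V0"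
        using topological_basisE[OF BE(2) V0] by blast
      have co: "continuous_on (ldom (\<phi> i) c d) (\<lambda>q. D (loc (\<phi> i) c d) q b)"
        using C2_onD(3)[OF ham_isoD(4)[OF ii cA]] by (intro continuous_intros)
      have "open (ldom (\<phi> i) c d \<inter> (\<lambda>q. D (loc (\<phi> i) c d) q b) -` V)"
        by (rule continuous_open_preimage[OF co ham_isoD(8)[OF ii cA] topological_basis_open[OF BE(2) V(1)]])
      moreover have "q \<in> ldom (\<phi> i) c d \<inter> (\<lambda>q. D (loc (\<phi> i) c d) q b) -` V" using V(2) q by simp
      ultimately obtain U where U: "U \<in> BP" "q \<in> U" "U \<subseteq> ldom (\<phi> i) c d \<inter> (\<lambda>q. D (loc (\<phi> i) c d) q b) -` V"
        using topological_basisE[OF BP(2)] by blast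
      have "R i (Inr (c, d, b, U, V))" unfolding R_def using U(3) by auto
      then have "\<forall>\<^sub>F k in sequentially. R (J k) (Inr (c, d, b, U, V))"
        using ev[of "Inr (c, d, b, U, V)"] c b U(1) V(1) unfolding C_def by blast
      then have "\<forall>\<^sub>F k in sequentially. R (J (r k)) (Inr (c, d, b, U, V))"
        using r by (rule eventually_compose_filterlim)
      moreover have "\<forall>\<^sub>F k in sequentially. Q k \<in> U"
        by (rule topological_tendstoD[OF Q topological_basis_open[OF BP(2) U(1)] U(2)])
      ultimately show "\<forall>\<^sub>F k in sequentially. D (loc (\<phi> (J (r k))) c d) (Q k) b \<in> V0"
        by eventually_elim (use V(3) in \<open>auto simp: R_def\<close>)
    qed
    have v: "F v = (\<Sum>b\<in>Basis. (v \<bullet> b) *\<^sub>R F b)" for F :: "(real \<times> 'e) \<Rightarrow>\<^sub>L 'e"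
    proof -
      have "F v = F (\<Sum>b\<in>Basis. (v \<bullet> b) *\<^sub>R b)" by (simp only: euclidean_representation)
      then show ?thesis by (simp only: blinfun.sum_right blinfun.scaleR_right)
    qed
    show "(\<lambda>k. D (loc (\<phi> (J (r k))) c d) (Q k) v) \<longlonglongrightarrow> D (loc (\<phi> i) c d) q v"
      unfolding v by (intro tendsto_intros basis)
  qed
  then show ?thesis using that i by blast
qed

end

section \<open>Orthogonal retraction onto a subspace\<close>

definition proj :: "'e::euclidean_space set \<Rightarrow> 'e \<Rightarrow>\<^sub>L 'e"
  where "proj W = (SOME \<pi>. \<forall>z. blinfun_apply \<pi> z \<in> W \<and> (\<forall>w\<in>W. (z - \<pi> z) \<bullet> w = 0))"

definition normal_part :: "'e::euclidean_space set \<Rightarrow> 'e \<Rightarrow> 'e"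
  where "normal_part W z = z - proj W z"

text \<open>
  The linear retraction, from the identity at \<open>r = 1\<close> to the orthogonal projection at \<open>r = 0\<close>.
\<close>

definition squeeze :: "'e::euclidean_space set \<Rightarrow> real \<Rightarrow> 'e \<Rightarrow> 'e"
  where "squeeze W r z = proj W z + r *\<^sub>R normal_part W z"

lemma proj:
  fixes W :: "'e::euclidean_space set"
  assumes "subspace W"
  shows "proj W z \<in> W" "w \<in> W \<Longrightarrow> normal_part W z \<bullet> w = 0"
proof -
  obtain B where B: "B \<subseteq> W" "pairwise orthogonal B" "\<And>x. x \<in> B \<Longrightarrow> norm x = 1" "independent B" "span B = W"
    using orthonormal_basis_subspace[OF assms] by metis
  have fin: "finite B" using B(4) by (rule independent_imp_finite)
  define f where "f z = (\<Sum>b\<in>B. (z \<bullet> b) *\<^sub>R b)" for z :: 'e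
  have "bounded_linear f"
    unfolding f_def
    by (intro bounded_linear_sum bounded_linear_scaleR_const bounded_linear_inner_left)
  then have bf: "blinfun_apply (Blinfun f) = f" by (rule bounded_linear_Blinfun_apply)
  have fW: "f z \<in> W" for z unfolding f_def using B(1) assms by (intro subspace_sum subspace_mul) auto
  have ob: "(z - f z) \<bullet> b = 0" if b: "b \<in> B" for z b
  proof -
    have "f z \<bullet> b = (\<Sum>a\<in>B. (z \<bullet> a) * (a \<bullet> b))" unfolding f_def by (simp add: inner_sum_left)
    also have "\<dots> = (\<Sum>a\<in>B. if a = b then z \<bullet> b else 0)"
    proof (rule sum.cong[OF refl])
      fix a assume a: "a \<in> B"
      show "(z \<bullet> a) * (a \<bullet> b) = (if a = b then z \<bullet> b else 0)"
        using B(2,3) a b by (auto simp: pairwise_def orthogonal_def dot_square_norm)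
    qed
    also have "\<dots> = z \<bullet> b" using fin b by simp
    finally show ?thesis by (simp add: inner_diff_left)
  qed
  have "(z - f z) \<bullet> w = 0" if "w \<in> W" for z w
  proof -
    have "w \<in> span B" using B(5) that by simp
    then show ?thesis
    proof (induction rule: span_induct_alt)
      case (step c x y)
      then show ?case using ob by (simp add: inner_add_right)
    qed simp
  qed
  then have "\<forall>z. blinfun_apply (Blinfun f) z \<in> W \<and> (\<forall>w\<in>W. (z - Blinfun f z) \<bullet> w = 0)"
    unfolding bf using fW by blast
  then have *: "\<forall>z. blinfun_apply (proj W) z \<in> W \<and> (\<forall>w\<in>W. (z - proj W z) \<bullet> w = 0)"
    unfolding proj_def by (rule someI)
  then show "proj W z \<in> W" by blast
  show "w \<in> W \<Longrightarrow> normal_part W z \<bullet> w = 0" using * unfolding normal_part_def by blast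
qed

lemma proj_id:
  assumes "subspace W" "z \<in> W" shows "proj W z = z" "normal_part W z = 0"
proof -
  have "normal_part W z \<in> W" unfolding normal_part_def by (intro subspace_diff assms proj)
  then show "normal_part W z = 0" using proj(2)[OF assms(1)] inner_eq_zero_iff by blast
  then show "proj W z = z" unfolding normal_part_def by simp
qed

lemma normal_part_eq_0:
  assumes "subspace W" "normal_part W z = 0" shows "z \<in> W"
  using proj(1)[OF assms(1), of z] assms(2) unfolding normal_part_def by simp

lemma norm_split:
  assumes "subspace W" "w \<in> W" shows "norm (z - w) ^ 2 = norm (proj W z - w) ^ 2 + norm (normal_part W z) ^ 2"
proof -
  have "z - w = (proj W z - w) + normal_part W z" unfolding normal_part_def by simp
  moreover have "orthogonal (proj W z - w) (normal_part W z)"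
    using proj(2)[OF assms(1), of "proj W z - w" z] subspace_diff[OF assms(1) proj(1)[OF assms(1)] assms(2)]
    by (simp add: orthogonal_def inner_commute)
  ultimately show ?thesis using norm_add_Pythagorean by metis
qed

lemma norm_normal_part_le:
  assumes "subspace W" "w \<in> W" shows "norm (normal_part W z) \<le> norm (z - w)"
  by (rule power2_le_imp_le) (use norm_split[OF assms, of z] in simp_all)

lemma norm_proj_le:
  assumes "subspace W" "w \<in> W" shows "norm (proj W z - w) \<le> norm (z - w)"
  by (rule power2_le_imp_le) (use norm_split[OF assms, of z] in simp_all)

lemma squeeze_simps: "squeeze W 1 z = z" "squeeze W 0 z = proj W z"
  unfolding squeeze_def normal_part_def by simp_all

lemma squeeze_ball:
  assumes "subspace W" "w \<in> W" "z \<in> ball w \<rho>" "r \<in> {0..1}" shows "squeeze W r z \<in> ball w \<rho>"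
proof -
  have "proj W z \<in> ball w \<rho>" using norm_proj_le[OF assms(1,2), of z] assms(3) by (simp add: dist_norm norm_minus_commute)
  moreover have "squeeze W r z = (1 - r) *\<^sub>R proj W z + r *\<^sub>R z" unfolding squeeze_def normal_part_def by (simp add: algebra_simps)
  ultimately show ?thesis using convex_ball[of w \<rho>] assms(3,4) by (simp add: convex_alt)
qed

lemma squeeze_diff: "squeeze W r z - squeeze W r' z = (r - r') *\<^sub>R normal_part W z"
  unfolding squeeze_def by (simp add: algebra_simps)

lemma bounded_linear_normal_part: "bounded_linear (normal_part W)"
  unfolding normal_part_def[abs_def] by (intro bounded_linear_sub bounded_linear_ident blinfun.bounded_linear_right)

lemma squeeze_C2:
  assumes "C2_on S \<rho>" "C2_on S f" "open S"
  shows "C2_on S (\<lambda>q. squeeze W (\<rho> q) (f q))"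
    "q \<in> S \<Longrightarrow> D (\<lambda>q. squeeze W (\<rho> q) (f q)) q u = D \<rho> q u *\<^sub>R normal_part W (f q) + squeeze W (\<rho> q) (D f q u)"
proof -
  have n: "C2_on S (\<lambda>q. normal_part W (f q))" by (rule C2_on_linear_compose[OF bounded_linear_normal_part assms(2,3)])
  show "C2_on S (\<lambda>q. squeeze W (\<rho> q) (f q))"
    unfolding squeeze_def
    by (intro C2_on_add C2_on_linear_compose[OF blinfun.bounded_linear_right assms(2,3)] C2_on_scaleR[OF assms(1) n assms(3)] assms(3))
  assume q: "q \<in> S"
  have "((\<lambda>q. squeeze W (\<rho> q) (f q)) has_derivative (\<lambda>u. proj W (D f q u) + (\<rho> q *\<^sub>R normal_part W (D f q u) + D \<rho> q u *\<^sub>R normal_part W (f q)))) (at q)"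
    unfolding squeeze_def
    by (intro has_derivative_add has_derivative_scaleR bounded_linear.has_derivative[OF blinfun.bounded_linear_right]
        bounded_linear.has_derivative[OF bounded_linear_normal_part] C2_onD(1)[OF assms(1) q] C2_onD(1)[OF assms(2) q])
  from D_apply[OF this, of u]
  show "D (\<lambda>q. squeeze W (\<rho> q) (f q)) q u = D \<rho> q u *\<^sub>R normal_part W (f q) + squeeze W (\<rho> q) (D f q u)"
    unfolding squeeze_def by (simp add: add.commute add.left_commute)
qed

lemma D_linear: "bounded_linear f \<Longrightarrow> D f q u = f u"
  by (rule D_apply) (rule bounded_linear_imp_has_derivative)

section \<open>Slice charts and the action of an orbit\<close>

locale lagrangian_setting = symplectic A \<omega>
  for A :: "('m::{t2_space, second_countable_topology}, 'e::euclidean_space) chart set" and \<omega> +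
  fixes L :: "'m set" and T :: real
  assumes lagr: "lagrangian UNIV A \<omega> L" and T: "0 \<le> T"
begin

definition slice :: "('m, 'e) chart \<Rightarrow> 'e set \<Rightarrow> bool"
  where "slice c W \<longleftrightarrow> slice_chart UNIV A L c W \<and> 2 * dim W = DIM('e)"

lemma L_M: "L \<subseteq> M" using lagr unfolding lagrangian_def submanifold_of_dim_def by blast

lemma ex_slice:
  assumes "p \<in> L" shows "\<exists>c W. slice c W \<and> p \<in> cdom c"
proof -
  obtain k where k: "submanifold_of_dim UNIV A k L" "2 * k = dim (UNIV :: 'e set)"
    using lagr unfolding lagrangian_def by blast
  then obtain c W where "slice_chart UNIV A L c W" "p \<in> cdom c" "dim W = k"
    using assms unfolding submanifold_of_dim_def by blast
  then have "slice c W" using k(2) unfolding slice_def by simp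
  then show ?thesis using \<open>p \<in> cdom c\<close> by blast
qed

lemma slice:
  assumes "slice c W"
  shows "c \<in> A" "subspace W" "\<And>p. p \<in> cdom c \<Longrightarrow> p \<in> L \<longleftrightarrow> cmap c p \<in> W"
    "\<And>x. x \<in> cimg c \<Longrightarrow> cinv c x \<in> L \<longleftrightarrow> x \<in> W"
    "\<And>x u v. x \<in> cimg c \<Longrightarrow> x \<in> W \<Longrightarrow> u \<in> W \<Longrightarrow> v \<in> W \<Longrightarrow> om c x u v = 0"
proof -
  have sl: "slice_chart UNIV A L c W" using assms unfolding slice_def by simp
  then have h: "c \<in> A" "subspace W" "cmap c ` (L \<inter> cdom c) = W \<inter> cimg c" unfolding slice_chart_def by auto
  show c: "c \<in> A" and "subspace W" by (fact h)+
  show 3: "p \<in> L \<longleftrightarrow> cmap c p \<in> W" if p: "p \<in> cdom c" for p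
  proof
    assume "cmap c p \<in> W"
    then have "cmap c p \<in> cmap c ` (L \<inter> cdom c)" using h(3) p by blast
    then obtain p' where "p' \<in> L" "p' \<in> cdom c" "cmap c p' = cmap c p" by force
    then show "p \<in> L" using chart(5)[OF c] p by metis
  qed (use h(3) p in blast)
  show 4: "cinv c x \<in> L \<longleftrightarrow> x \<in> W" if "x \<in> cimg c" for x
    using 3[OF chart(7)[OF c that]] chart(6)[OF c that] by simp
  fix x u v assume x: "x \<in> cimg c" "x \<in> W" and uv: "u \<in> W" "v \<in> W"
  let ?p = "cinv c x"
  have p: "?p \<in> L" "?p \<in> cdom c" "cmap c ?p = x" using 4 x chart(6,7)[OF c] by auto
  have t: "w \<in> tangent_space UNIV A L c ?p" if "w \<in> W" for w
  proof -
    have "((\<lambda>y. y) has_derivative (\<lambda>v. v)) (at x)" by (rule has_derivative_ident)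
    then have "(transition c c has_derivative (\<lambda>v. v)) (at x)"
      by (rule has_derivative_transform_within_open[OF _ chart(2)[OF c] x(1)])
         (simp add: transition_def chart(6)[OF c])
    then have "coord_change c c ?p w = w"
      using coord_change_D[OF c c p(2,2)] p(3) by (metis D_apply)
    then show ?thesis unfolding tangent_space_def using sl p(2) that
      by (intro CollectI exI[of _ c] exI[of _ W] exI[of _ w]) simp
  qed
  have "\<omega> c ?p u v = 0" using lagr p c t uv unfolding lagrangian_def by blast
  then show "om c x u v = 0" using om_apply[OF c x(1)] by simp
qed

text \<open>
  The symplectic area of the surface \<open>(r, t) \<mapsto> squeeze W r (\<psi>\<^sub>t)\<close>, which joins the orbit of the
  point with coordinates \<open>x\<close> to its projection onto \<open>W\<close>; the second and third arguments of the form are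
  the partial derivatives of the surface.
\<close>

definition area :: "('m, 'e) chart \<Rightarrow> 'e set \<Rightarrow> (real \<Rightarrow> 'm \<Rightarrow> 'm) \<Rightarrow> 'e \<Rightarrow> real"
  where "area c W \<psi> x = integral {0..1} (\<lambda>r. integral {0..T} (\<lambda>t.
    om c (squeeze W r (loc \<psi> c c (t, x))) (normal_part W (loc \<psi> c c (t, x))) (squeeze W r (D (loc \<psi> c c) (t, x) (1, 0)))))"

definition action :: "('m, 'e) chart \<Rightarrow> 'e set \<Rightarrow> (real \<Rightarrow> 'm \<Rightarrow> 'm) \<Rightarrow> (real \<Rightarrow> 'm \<Rightarrow> real) \<Rightarrow> 'e \<Rightarrow> real"
  where "action c W \<psi> \<kappa> x = area c W \<psi> x + integral {0..T} (\<lambda>t. \<kappa> t (cinv c x))"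

lemma rel_isoD:
  assumes "rel_iso \<psi> \<kappa>"
  shows "\<And>p s. p \<in> M \<Longrightarrow> \<psi> s p \<in> M" "\<And>p. p \<in> M \<Longrightarrow> \<psi> 0 p = p"
    "continuous_on (UNIV \<times> M) (\<lambda>(s, p). \<psi> s p)"
    "\<And>c d. c \<in> A \<Longrightarrow> d \<in> A \<Longrightarrow> C2_on (ldom \<psi> c d) (loc \<psi> c d)"
    "\<And>c. c \<in> A \<Longrightarrow> C2_on (UNIV \<times> cimg c) (hloc \<kappa> c)"
    "\<And>c d q v. c \<in> A \<Longrightarrow> d \<in> A \<Longrightarrow> q \<in> ldom \<psi> c d \<Longrightarrow>
       om d (loc \<psi> c d q) (D (loc \<psi> c d) q (1, 0)) (D (loc \<psi> c d) q (0, v)) = D (hloc \<kappa> c) q (0, v)"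
    "\<And>c d. c \<in> A \<Longrightarrow> d \<in> A \<Longrightarrow> open (ldom \<psi> c d)"
  using assms open_ldom[of \<psi>] unfolding rel_iso_def by blast+

lemma loc_0:
  assumes "rel_iso \<psi> \<kappa>" "c \<in> A" "x \<in> cimg c"
  shows "(0, x) \<in> ldom \<psi> c c" "loc \<psi> c c (0, x) = x"
proof -
  have "cinv c x \<in> cdom c" "cinv c x \<in> M" using chart(7,8)[OF assms(2)] assms(3) by blast+
  then show "(0, x) \<in> ldom \<psi> c c" "loc \<psi> c c (0, x) = x"
    using assms(3) rel_isoD(2)[OF assms(1), of "cinv c x"] chart(6)[OF assms(2,3)] unfolding ldom_def loc_def by simp_all
qed

text \<open>
  Stokes' theorem for the family of surfaces over the segment from \<open>x\<close> to \<open>x + Z v\<close> in \<open>W\<close>. The face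
  \<open>r = 0\<close> lies in \<open>W\<close>, where \<open>\<omega>\<close> vanishes; the face \<open>t = 0\<close> is degenerate, because points of
  \<open>W\<close> are not moved by the retraction; by \<open>rel_iso\<close> the face \<open>r = 1\<close> is the change of the integral
  of \<open>\<kappa>\<close>. Only the face \<open>t = T\<close> remains.
\<close>

lemma action_variation:
  assumes \<psi>: "rel_iso \<psi> \<kappa>" and sl: "slice c W" and b: "w \<in> W" "ball w \<rho> \<subseteq> cimg c"
    and x: "x \<in> W" "v \<in> W" and Z: "0 \<le> Z"
    and dom: "\<And>t s. t \<in> {0..T} \<Longrightarrow> s \<in> {0..Z} \<Longrightarrow> (t, x + s *\<^sub>R v) \<in> ldom \<psi> c c \<and> loc \<psi> c c (t, x + s *\<^sub>R v) \<in> ball w \<rho>"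
  shows "action c W \<psi> \<kappa> (x + Z *\<^sub>R v) - action c W \<psi> \<kappa> x =
    integral {0..1} (\<lambda>r. integral {0..Z} (\<lambda>s. om c (squeeze W r (loc \<psi> c c (T, x + s *\<^sub>R v)))
      (normal_part W (loc \<psi> c c (T, x + s *\<^sub>R v))) (squeeze W r (D (loc \<psi> c c) (T, x + s *\<^sub>R v) (0, v)))))"
proof -
  have c: "c \<in> A" and W: "subspace W" using slice[OF sl] by auto
  let ?l = "loc \<psi> c c"
  let ?g = "\<lambda>p :: real \<times> real \<times> real. (fst (snd p), x + snd (snd p) *\<^sub>R v)"
  let ?z = "\<lambda>p. ?l (?g p)"
  let ?\<sigma> = "\<lambda>p. squeeze W (fst p) (?z p)"
  define S0 where "S0 = ?g -` ldom \<psi> c c"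
  define S where "S = S0 \<inter> ?\<sigma> -` ball w \<rho>"
  have lf: "bounded_linear (\<lambda>p :: real \<times> real \<times> real. fst p)"
    "bounded_linear (\<lambda>p :: real \<times> real \<times> real. fst (snd p))"
    "bounded_linear (\<lambda>p :: real \<times> real \<times> real. snd (snd p))"
    by (intro bounded_linear_fst bounded_linear_snd bounded_linear_compose[OF bounded_linear_fst]
       bounded_linear_compose[OF bounded_linear_snd])+
  have oS0: "open S0" unfolding S0_def
    by (intro open_vimage rel_isoD(7)[OF \<psi> c c] continuous_intros)
  have Cg: "C2_on S0 ?g"
    by (intro C2_on_Pair C2_on_linear lf C2_on_add C2_on_const C2_on_scaleR oS0)
  have Dg: "(?g has_derivative (\<lambda>u. (fst (snd u), snd (snd u) *\<^sub>R v))) (at p)" for p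
    by (auto intro!: derivative_eq_intros)
  have Cz: "C2_on S0 ?z"
    by (rule C2_on_compose[OF rel_isoD(4)[OF \<psi> c c] Cg _ oS0]) (simp add: S0_def)
  have Dz: "D ?z p u = D ?l (?g p) (fst (snd u), snd (snd u) *\<^sub>R v)" if "p \<in> S0" for p u
    by (rule D_apply, rule has_derivative_compose[OF Dg C2_onD(1)[OF rel_isoD(4)[OF \<psi> c c]]])
       (use that in \<open>simp add: S0_def\<close>)
  note Cs0 = squeeze_C2(1)[OF C2_on_linear[OF lf(1) oS0] Cz oS0, of W]
  have oS: "open S" unfolding S_def
    by (rule continuous_open_preimage[OF C2_onD(4)[OF Cs0] oS0 open_ball])
  have Cs: "C2_on S ?\<sigma>" by (rule C2_on_subset[OF Cs0]) (simp add: S_def)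
  have SS0: "p \<in> S0" if "p \<in> S" for p using that unfolding S_def by blast
  have Ds: "D ?\<sigma> p u = fst u *\<^sub>R normal_part W (?z p) + squeeze W (fst p) (D ?l (?g p) (fst (snd u), snd (snd u) *\<^sub>R v))" if "p \<in> S0" for p u
    using squeeze_C2(2)[OF C2_on_linear[OF lf(1) oS0] Cz oS0 that, of W u] D_linear[OF lf(1)] Dz[OF that] by simp
  have inU: "?\<sigma> p \<in> cimg c" if "p \<in> S" for p using that b(2) unfolding S_def by blast
  have box: "{0..1} \<times> {0..T} \<times> {0..Z} \<subseteq> S"
    unfolding S_def S0_def using dom squeeze_ball[OF W b(1)] by auto
  let ?G = "pull (om c) ?\<sigma>"
  have G: "?G u u' p = om c (?\<sigma> p) (D ?\<sigma> p u) (D ?\<sigma> p u')" for u u' p unfolding pull_def ..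
  have box0: "(r, t, s) \<in> S" "(r, t, s) \<in> S0" "(t, x + s *\<^sub>R v) \<in> ldom \<psi> c c"
    if "r \<in> {0..1}" "t \<in> {0..T}" "s \<in> {0..Z}" for r t s
    using that box SS0 dom by blast+
  have sq0: "squeeze W r 0 = 0" for r unfolding squeeze_def normal_part_def by (simp add: blinfun.zero_right)
  have n0: "normal_part W 0 = 0" unfolding normal_part_def by (simp add: blinfun.zero_right)
  have 01: "(0 :: real) \<in> {0..1}" "(1 :: real) \<in> {0..1}" "T \<in> {0..T}" "0 \<in> {0..T}" "0 \<in> {0..Z}" "Z \<in> {0..Z}" using Z T by auto
  have Grt: "?G (1,0,0) (0,1,0) (r,t,s) = om c (squeeze W r (?l (t, x + s *\<^sub>R v))) (normal_part W (?l (t, x + s *\<^sub>R v))) (squeeze W r (D ?l (t, x + s *\<^sub>R v) (1, 0)))"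
    if "r \<in> {0..1}" "t \<in> {0..T}" "s \<in> {0..Z}" for r t s
    unfolding G Ds[OF box0(2)[OF that]] by (simp add: sq0 zero_prod_def[symmetric] blinfun.zero_right)
  have Gts1: "?G (0,1,0) (0,0,1) (1,t,s) = D (hloc \<kappa> c) (t, x + s *\<^sub>R v) (0, v)"
    if "t \<in> {0..T}" "s \<in> {0..Z}" for t s
    unfolding G Ds[OF box0(2)[OF 01(2) that]]
    using rel_isoD(6)[OF \<psi> c c box0(3)[OF 01(2) that], of v] by (simp add: squeeze_simps)
  have Gts0: "?G (0,1,0) (0,0,1) (0,t,s) = 0" if "t \<in> {0..T}" "s \<in> {0..Z}" for t s
    unfolding G Ds[OF box0(2)[OF 01(1) that]]
    using inU[OF box0(1)[OF 01(1) that]] slice(5)[OF sl, OF _ proj(1)[OF W] proj(1)[OF W] proj(1)[OF W]]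
    by (simp add: squeeze_simps)
  have GsrT: "?G (0,0,1) (1,0,0) (r,T,s) = - om c (squeeze W r (?l (T, x + s *\<^sub>R v))) (normal_part W (?l (T, x + s *\<^sub>R v))) (squeeze W r (D ?l (T, x + s *\<^sub>R v) (0, v)))"
    if "r \<in> {0..1}" "s \<in> {0..Z}" for r s
  proof -
    let ?p = "(r, T, s)"
    have e: "D ?\<sigma> ?p (0,0,1) = squeeze W r (D ?l (T, x + s *\<^sub>R v) (0, v))"
      "D ?\<sigma> ?p (1,0,0) = normal_part W (?l (T, x + s *\<^sub>R v))"
      unfolding Ds[OF box0(2)[OF that(1) 01(3) that(2)]]
      by (simp_all add: sq0 zero_prod_def[symmetric] blinfun.zero_right)
    show ?thesis unfolding G e
      using closed_form_skew[OF om_closed[OF c] inU[OF box0(1)[OF that(1) 01(3) that(2)]],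
        of "squeeze W r (D ?l (T, x + s *\<^sub>R v) (0, v))" "normal_part W (?l (T, x + s *\<^sub>R v))"] by simp
  qed
  have xs: "x + s *\<^sub>R v \<in> W" for s using x W by (intro subspace_add subspace_mul)
  have Gsr0: "?G (0,0,1) (1,0,0) (r,0,s) = 0" if "r \<in> {0..1}" "s \<in> {0..Z}" for r s
  proof -
    have "x + s *\<^sub>R v \<in> cimg c" using ldom_snd[OF box0(3)[OF that(1) 01(4) that(2)]] by simp
    then have "?l (0, x + s *\<^sub>R v) = x + s *\<^sub>R v" by (rule loc_0(2)[OF \<psi> c])
    then have "normal_part W (?l (0, x + s *\<^sub>R v)) = 0" using proj_id(2)[OF W xs] by simp
    then show ?thesis
      unfolding G Ds[OF box0(2)[OF that(1) 01(4) that(2)]]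
      by (simp add: sq0 zero_prod_def[symmetric] blinfun.zero_right)
  qed
  have st: "integral {0..1} (\<lambda>r. integral {0..T} (\<lambda>t. ?G (1,0,0) (0,1,0) (r,t,Z)))
       - integral {0..1} (\<lambda>r. integral {0..T} (\<lambda>t. ?G (1,0,0) (0,1,0) (r,t,0)))
    + integral {0..T} (\<lambda>t. integral {0..Z} (\<lambda>s. ?G (0,1,0) (0,0,1) (1,t,s) - ?G (0,1,0) (0,0,1) (0,t,s)))
    + integral {0..1} (\<lambda>r. integral {0..Z} (\<lambda>s. ?G (0,0,1) (1,0,0) (r,T,s) - ?G (0,0,1) (1,0,0) (r,0,s))) = 0"
    by (rule stokes_box[OF om_closed[OF c] Cs oS inU box _ T Z]) simp_all
  have A1: "integral {0..1} (\<lambda>r. integral {0..T} (\<lambda>t. ?G (1,0,0) (0,1,0) (r,t,s))) = area c W \<psi> (x + s *\<^sub>R v)"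
    if "s \<in> {0..Z}" for s
    unfolding area_def using that by (intro integral_cong Grt)
  have A2: "integral {0..T} (\<lambda>t. integral {0..Z} (\<lambda>s. ?G (0,1,0) (0,0,1) (1,t,s) - ?G (0,1,0) (0,0,1) (0,t,s)))
     = integral {0..T} (\<lambda>t. \<kappa> t (cinv c (x + Z *\<^sub>R v))) - integral {0..T} (\<lambda>t. \<kappa> t (cinv c x))"
  proof -
    have in_dom: "(t, x + s *\<^sub>R v) \<in> UNIV \<times> cimg c" if "t \<in> {0..T}" "s \<in> {0..Z}" for t s
      using ldom_snd[OF box0(3)[OF 01(1) that]] by simp
    have inner: "integral {0..Z} (\<lambda>s. ?G (0,1,0) (0,0,1) (1,t,s) - ?G (0,1,0) (0,0,1) (0,t,s))
       = \<kappa> t (cinv c (x + Z *\<^sub>R v)) - \<kappa> t (cinv c x)" if t: "t \<in> {0..T}" for t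
    proof -
      have "((\<lambda>s. D (hloc \<kappa> c) ((t, x) + s *\<^sub>R (0, v)) (0, v)) has_integral
          hloc \<kappa> c ((t, x) + Z *\<^sub>R (0, v)) - hloc \<kappa> c (t, x)) {0..Z}"
        by (rule FTC_line[OF _ Z], rule C2_onD(1)[OF rel_isoD(5)[OF \<psi> c]]) (use in_dom[OF t] in simp)
      from integral_unique[OF this]
      have "integral {0..Z} (\<lambda>s. D (hloc \<kappa> c) (t, x + s *\<^sub>R v) (0, v)) = \<kappa> t (cinv c (x + Z *\<^sub>R v)) - \<kappa> t (cinv c x)"
        by (simp add: hloc_def)
      moreover have "integral {0..Z} (\<lambda>s. ?G (0,1,0) (0,0,1) (1,t,s) - ?G (0,1,0) (0,0,1) (0,t,s))
          = integral {0..Z} (\<lambda>s. D (hloc \<kappa> c) (t, x + s *\<^sub>R v) (0, v))"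
        using Gts1[OF t] Gts0[OF t] by (intro integral_cong) simp
      ultimately show ?thesis by simp
    qed
    have "integral {0..T} (\<lambda>t. integral {0..Z} (\<lambda>s. ?G (0,1,0) (0,0,1) (1,t,s) - ?G (0,1,0) (0,0,1) (0,t,s)))
      = integral {0..T} (\<lambda>t. \<kappa> t (cinv c (x + Z *\<^sub>R v)) - \<kappa> t (cinv c x))" by (rule integral_cong[OF inner])
    also have "\<dots> = integral {0..T} (\<lambda>t. \<kappa> t (cinv c (x + Z *\<^sub>R v))) - integral {0..T} (\<lambda>t. \<kappa> t (cinv c x))"
    proof (rule integral_diff)
      have k: "(\<lambda>t. \<kappa> t (cinv c y)) integrable_on {0..T}" if "y \<in> cimg c" for y
      proof (rule integrable_continuous_real)
        have "continuous_on {0..T} (\<lambda>t. hloc \<kappa> c (t, y))"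
          by (rule continuous_on_compose2[OF C2_onD(4)[OF rel_isoD(5)[OF \<psi> c]]])
             (use that in \<open>auto intro!: continuous_intros\<close>)
        then show "continuous_on {0..T} (\<lambda>t. \<kappa> t (cinv c y))" by (simp add: hloc_def)
      qed
      show "(\<lambda>t. \<kappa> t (cinv c (x + Z *\<^sub>R v))) integrable_on {0..T}" using k in_dom[OF 01(4,6)] by simp
      show "(\<lambda>t. \<kappa> t (cinv c x)) integrable_on {0..T}" using k[of x] in_dom[OF 01(4,5)] by simp
    qed
    finally show ?thesis .
  qed
  have A3: "integral {0..1} (\<lambda>r. integral {0..Z} (\<lambda>s. ?G (0,0,1) (1,0,0) (r,T,s) - ?G (0,0,1) (1,0,0) (r,0,s)))
    = - integral {0..1} (\<lambda>r. integral {0..Z} (\<lambda>s. om c (squeeze W r (loc \<psi> c c (T, x + s *\<^sub>R v)))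
      (normal_part W (loc \<psi> c c (T, x + s *\<^sub>R v))) (squeeze W r (D (loc \<psi> c c) (T, x + s *\<^sub>R v) (0, v)))))"
  proof -
    have "integral {0..1} (\<lambda>r. integral {0..Z} (\<lambda>s. ?G (0,0,1) (1,0,0) (r,T,s) - ?G (0,0,1) (1,0,0) (r,0,s)))
      = integral {0..1} (\<lambda>r. integral {0..Z} (\<lambda>s. - om c (squeeze W r (loc \<psi> c c (T, x + s *\<^sub>R v)))
      (normal_part W (loc \<psi> c c (T, x + s *\<^sub>R v))) (squeeze W r (D (loc \<psi> c c) (T, x + s *\<^sub>R v) (0, v)))))"
      by (intro integral_cong) (simp add: GsrT Gsr0)
    then show ?thesis by simp
  qed
  show ?thesis
    using st A1[OF 01(6)] A1[OF 01(5)] A2 A3 unfolding action_def by simp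
qed

end

section \<open>Changing the slice chart\<close>

lemma abs_integral_le_const:
  fixes f :: "real \<Rightarrow> real"
  assumes "\<And>x. x \<in> {0..1} \<Longrightarrow> \<bar>f x\<bar> \<le> B" "0 \<le> B"
  shows "\<bar>integral {0..1} f\<bar> \<le> B"
proof (cases "f integrable_on {0..1}")
  case True
  have "norm (integral {0..1} f) \<le> integral {0..1} (\<lambda>x :: real. B)"
    by (rule integral_norm_bound_integral[OF True]) (use assms in auto)
  then show ?thesis by simp
next
  case False
  then show ?thesis using assms(2) by (simp add: not_integrable_integral)
qed

context lagrangian_setting
begin

lemma action_variation_lower:
  assumes \<psi>: "rel_iso \<psi> \<kappa>" and sl: "slice c W" and b: "w \<in> W" "ball w \<rho> \<subseteq> cimg c"
    and x: "x \<in> W" "v \<in> W" and Z: "0 \<le> Z"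
    and dom: "\<And>t s. t \<in> {0..T} \<Longrightarrow> s \<in> {0..Z} \<Longrightarrow> (t, x + s *\<^sub>R v) \<in> ldom \<psi> c c \<and> loc \<psi> c c (t, x + s *\<^sub>R v) \<in> ball w \<rho>"
    and low: "\<And>r s. r \<in> {0..1} \<Longrightarrow> s \<in> {0..Z} \<Longrightarrow> B \<le> om c (squeeze W r (loc \<psi> c c (T, x + s *\<^sub>R v)))
      (normal_part W (loc \<psi> c c (T, x + s *\<^sub>R v))) (squeeze W r (D (loc \<psi> c c) (T, x + s *\<^sub>R v) (0, v)))"
  shows "B * Z \<le> action c W \<psi> \<kappa> (x + Z *\<^sub>R v) - action c W \<psi> \<kappa> x"
proof -
  have c: "c \<in> A" and W: "subspace W" using slice[OF sl] by auto
  let ?l = "loc \<psi> c c" and ?K = "{0..1} \<times> {0..Z}"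
  define f where "f r s = om c (squeeze W r (?l (T, x + s *\<^sub>R v))) (normal_part W (?l (T, x + s *\<^sub>R v))) (squeeze W r (D ?l (T, x + s *\<^sub>R v) (0, v)))" for r s
  have TT: "T \<in> {0..T}" using T by simp
  have line: "continuous_on ?K (\<lambda>q. (T, x + snd q *\<^sub>R v))" by (intro continuous_intros)
  have into: "(\<lambda>q. (T, x + snd q *\<^sub>R v)) ` ?K \<subseteq> ldom \<psi> c c" using dom[OF TT] by auto
  have cl: "continuous_on ?K (\<lambda>q. ?l (T, x + snd q *\<^sub>R v))"
    by (rule continuous_on_compose2[OF C2_onD(4)[OF rel_isoD(4)[OF \<psi> c c]] line into])
  have cD: "continuous_on ?K (\<lambda>q. D ?l (T, x + snd q *\<^sub>R v))"
    by (rule continuous_on_compose2[OF C2_onD(3)[OF rel_isoD(4)[OF \<psi> c c]] line into])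
  have cn: "continuous_on ?K (\<lambda>q. normal_part W (g q))" if "continuous_on ?K g" for g
    unfolding normal_part_def using that by (intro continuous_intros)
  have cs: "continuous_on ?K (\<lambda>q. squeeze W (fst q) (g q))" if "continuous_on ?K g" for g
    unfolding squeeze_def by (intro continuous_intros cn that)
  have co: "continuous_on ?K (\<lambda>q. om c (squeeze W (fst q) (?l (T, x + snd q *\<^sub>R v))))"
    by (rule continuous_on_compose2[OF C2_onD(4)[OF om_C2[OF c]] cs[OF cl]])
       (use dom[OF TT] squeeze_ball[OF W b(1)] b(2) in fastforce)
  have cf: "continuous_on ?K (\<lambda>(r, s). f r s)"
    unfolding f_def split_def
    by (intro bounded_bilinear.continuous_on[OF bounded_bilinear_blinfun_apply] co cn cl cs continuous_on_const cD)
  have inner_int: "f r integrable_on {0..Z}" if "r \<in> {0..1}" for r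
  proof (rule integrable_continuous_real)
    have "continuous_on {0..Z} (\<lambda>s. (\<lambda>(r, s). f r s) (r, s))"
      by (rule continuous_on_compose2[OF cf]) (use that in \<open>auto intro!: continuous_intros\<close>)
    then show "continuous_on {0..Z} (f r)" by simp
  qed
  have inner: "B * Z \<le> integral {0..Z} (f r)" if "r \<in> {0..1}" for r
  proof -
    have "integral {0..Z} (\<lambda>s. B) \<le> integral {0..Z} (f r)"
      by (rule integral_le[OF _ inner_int[OF that]]) (use low[OF that] in \<open>auto simp: f_def\<close>)
    then show ?thesis using Z by (simp add: mult.commute)
  qed
  have outer_int: "(\<lambda>r. integral {0..Z} (f r)) integrable_on {0..1}"
    using integral_continuous_on_param[of "{0..1}" 0 Z f] cf by (intro integrable_continuous_real) simp
  have "integral {0..1} (\<lambda>r :: real. B * Z) \<le> integral {0..1} (\<lambda>r. integral {0..Z} (f r))"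
    by (rule integral_le[OF _ outer_int]) (use inner in auto)
  moreover have "action c W \<psi> \<kappa> (x + Z *\<^sub>R v) - action c W \<psi> \<kappa> x = integral {0..1} (\<lambda>r. integral {0..Z} (f r))"
    unfolding f_def by (rule action_variation[OF \<psi> sl b x Z dom])
  ultimately show ?thesis by simp
qed

text \<open>
  Both slices describe \<open>L\<close>, so coordinate changes map one to the other and respect tangent vectors.
\<close>

lemma transition_slice:
  assumes sl: "slice c W" "slice c' W'" and y: "y \<in> overlap c' c" "y \<in> W'"
  shows "transition c' c y \<in> W" "w \<in> W' \<Longrightarrow> D (transition c' c) y w \<in> W"
proof -
  have c: "c \<in> A" "c' \<in> A" and W: "subspace W" "subspace W'" using slice[OF sl(1)] slice[OF sl(2)] by auto
  have t: "transition c' c y \<in> W" if "y \<in> overlap c' c" "y \<in> W'" for y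
    using that slice(4)[OF sl(2), of y] slice(3)[OF sl(1), of "cinv c' y"] unfolding overlap_def transition_def by auto
  show "transition c' c y \<in> W" by (rule t[OF y])
  assume w: "w \<in> W'"
  let ?O = "(\<lambda>s. y + s *\<^sub>R w) -` overlap c' c"
  have o: "open ?O" by (intro open_vimage open_overlap c continuous_intros)
  have "((\<lambda>s. y + s *\<^sub>R w) has_derivative (\<lambda>s. s *\<^sub>R w)) (at 0)" by (auto intro!: derivative_eq_intros)
  from has_derivative_compose[OF this, of "transition c' c"] C2_onD(1)[OF transition_C2[OF c(2,1)] y(1)]
  have "((\<lambda>s. transition c' c (y + s *\<^sub>R w)) has_derivative (\<lambda>s. D (transition c' c) y (s *\<^sub>R w))) (at 0)" by simp
  from bounded_linear.has_derivative[OF bounded_linear_normal_part this, of W]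
  have d: "((\<lambda>s. normal_part W (transition c' c (y + s *\<^sub>R w))) has_derivative (\<lambda>s. normal_part W (D (transition c' c) y (s *\<^sub>R w)))) (at 0)" .
  have "((\<lambda>s. 0) has_derivative (\<lambda>s. normal_part W (D (transition c' c) y (s *\<^sub>R w)))) (at 0)"
  proof (rule has_derivative_transform_within_open[OF d o])
    show "0 \<in> ?O" using y(1) by simp
    fix s assume "s \<in> ?O"
    then have "transition c' c (y + s *\<^sub>R w) \<in> W"
      using t y(2) w subspace_add[OF W(2) _ subspace_mul[OF W(2)]] by simp
    then show "normal_part W (transition c' c (y + s *\<^sub>R w)) = 0" by (rule proj_id(2)[OF W(1)])
  qed
  from has_derivative_unique[OF this has_derivative_const]
  have "normal_part W (D (transition c' c) y (1 *\<^sub>R w)) = 0" by meson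
  then show "D (transition c' c) y w \<in> W" using normal_part_eq_0[OF W(1)] by simp
qed

text \<open>
  Stokes' theorem for the linear homotopy, in the chart \<open>c\<close>, from the surface retracted in \<open>c\<close> to the
  one retracted in \<open>c'\<close>. The face \<open>r = 1\<close> is degenerate since both surfaces contain the orbit, the face
  \<open>r = 0\<close> lies in \<open>W\<close>, and the face \<open>t = 0\<close> is degenerate since the orbit starts in \<open>L\<close>.
  Again only the face at the end time \<open>T\<close> remains.
\<close>

lemma area_comparison:
  assumes \<psi>: "rel_iso \<psi> \<kappa>" and sl: "slice c W" "slice c' W'"
    and U: "convex U" "open U" "U \<subseteq> cimg c" and V: "open V" "V \<subseteq> overlap c' c" "\<And>y. y \<in> V \<Longrightarrow> transition c' c y \<in> U"
    and m: "m \<in> L" "m \<in> cdom c" "m \<in> cdom c'"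
    and dom: "\<And>t. t \<in> {0..T} \<Longrightarrow> \<psi> t m \<in> cdom c \<and> \<psi> t m \<in> cdom c'"
    and inU: "\<And>t r. t \<in> {0..T} \<Longrightarrow> r \<in> {0..1} \<Longrightarrow> squeeze W r (cmap c (\<psi> t m)) \<in> U \<and> squeeze W' r (cmap c' (\<psi> t m)) \<in> V"
  defines "zT \<equiv> cmap c (\<psi> T m)" and "zT' \<equiv> cmap c' (\<psi> T m)" and "\<tau> \<equiv> transition c' c"
  shows "area c' W' \<psi> (cmap c' m) - area c W \<psi> (cmap c m) +
    integral {0..1} (\<lambda>r. integral {0..1} (\<lambda>u.
      om c (squeeze W r zT + u *\<^sub>R (\<tau> (squeeze W' r zT') - squeeze W r zT)) (\<tau> (squeeze W' r zT') - squeeze W r zT)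
       (normal_part W zT + u *\<^sub>R (D \<tau> (squeeze W' r zT') (normal_part W' zT') - normal_part W zT)))) = 0"
proof -
  have c: "c \<in> A" "c' \<in> A" and W: "subspace W" "subspace W'" using slice[OF sl(1)] slice[OF sl(2)] by auto
  define X where "X = cmap c m"
  define X' where "X' = cmap c' m"
  let ?l = "loc \<psi> c c" and ?l' = "loc \<psi> c' c'"
  have X: "X \<in> cimg c" "cinv c X = m" "X' \<in> cimg c'" "cinv c' X' = m"
    unfolding X_def X'_def using m chart(5) c by auto
  have XW: "X \<in> W" "X' \<in> W'"
    unfolding X_def X'_def using slice(3)[OF sl(1) m(2)] slice(3)[OF sl(2) m(3)] m(1) by auto
  have l: "?l (t, X) = cmap c (\<psi> t m)" "?l' (t, X') = cmap c' (\<psi> t m)" for t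
    unfolding loc_def by (simp_all add: X)
  have ld: "(t, X) \<in> ldom \<psi> c c" "(t, X') \<in> ldom \<psi> c' c'" if "t \<in> {0..T}" for t
    using dom[OF that] X unfolding ldom_def by simp_all
  have tau: "\<tau> (?l' (t, X')) = ?l (t, X)" if "t \<in> {0..T}" for t
    unfolding l \<tau>_def transition_def using dom[OF that] chart(5)[OF c(2)] by simp
  let ?g = "\<lambda>p :: real \<times> real \<times> real. (fst (snd p), X)" and ?g' = "\<lambda>p :: real \<times> real \<times> real. (fst (snd p), X')"
  let ?z = "\<lambda>p. ?l (?g p)" and ?z' = "\<lambda>p. ?l' (?g' p)"
  have lf: "bounded_linear (\<lambda>p :: real \<times> real \<times> real. fst p)"
    "bounded_linear (\<lambda>p :: real \<times> real \<times> real. fst (snd p))"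
    "bounded_linear (\<lambda>p :: real \<times> real \<times> real. snd (snd p))"
    by (intro bounded_linear_fst bounded_linear_snd bounded_linear_compose[OF bounded_linear_fst]
       bounded_linear_compose[OF bounded_linear_snd])+
  define S0 where "S0 = ?g -` ldom \<psi> c c \<inter> ?g' -` ldom \<psi> c' c'"
  have oS0: "open S0" unfolding S0_def
    by (intro open_Int open_vimage rel_isoD(7)[OF \<psi>] c continuous_intros)
  have Cg: "C2_on S0 ?g" "C2_on S0 ?g'"
    by (intro C2_on_Pair C2_on_linear lf C2_on_const oS0)+
  have Dg: "(?g has_derivative (\<lambda>u. (fst (snd u), 0))) (at p)" "(?g' has_derivative (\<lambda>u. (fst (snd u), 0))) (at p)" for p
    by (auto intro!: derivative_eq_intros)
  have Cz: "C2_on S0 ?z" "C2_on S0 ?z'"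
    by (rule C2_on_compose[OF rel_isoD(4)[OF \<psi> c(1,1)] Cg(1) _ oS0], simp add: S0_def,
        rule C2_on_compose[OF rel_isoD(4)[OF \<psi> c(2,2)] Cg(2) _ oS0], simp add: S0_def)
  have Dz: "D ?z p u = D ?l (?g p) (fst (snd u), 0)" "D ?z' p u = D ?l' (?g' p) (fst (snd u), 0)" if "p \<in> S0" for p u
    by (rule D_apply, rule has_derivative_compose[OF Dg(1) C2_onD(1)[OF rel_isoD(4)[OF \<psi> c(1,1)]]],
         use that in \<open>simp add: S0_def\<close>,
        rule D_apply, rule has_derivative_compose[OF Dg(2) C2_onD(1)[OF rel_isoD(4)[OF \<psi> c(2,2)]]],
         use that in \<open>simp add: S0_def\<close>)
  let ?a = "\<lambda>p. squeeze W (fst p) (?z p)" and ?b' = "\<lambda>p. squeeze W' (fst p) (?z' p)"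
  note Ca0 = squeeze_C2(1)[OF C2_on_linear[OF lf(1) oS0] Cz(1) oS0, of W]
  note Cb0 = squeeze_C2(1)[OF C2_on_linear[OF lf(1) oS0] Cz(2) oS0, of W']
  define S1 where "S1 = S0 \<inter> ?b' -` V"
  have oS1: "open S1" unfolding S1_def by (rule continuous_open_preimage[OF C2_onD(4)[OF Cb0] oS0 V(1)])
  have S10: "p \<in> S0" if "p \<in> S1" for p using that unfolding S1_def by blast
  let ?b = "\<lambda>p. \<tau> (?b' p)"
  have Ct: "C2_on V \<tau>" unfolding \<tau>_def by (rule C2_on_subset[OF transition_C2[OF c(2,1)] V(2)])
  have Ca: "C2_on S1 ?a" by (rule C2_on_subset[OF Ca0]) (simp add: S1_def)
  have Cb': "C2_on S1 ?b'" by (rule C2_on_subset[OF Cb0]) (simp add: S1_def)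
  have Cb: "C2_on S1 ?b" by (rule C2_on_compose[OF Ct Cb' _ oS1]) (simp add: S1_def)
  have Da: "D ?a p u = fst u *\<^sub>R normal_part W (?z p) + squeeze W (fst p) (D ?l (?g p) (fst (snd u), 0))" if "p \<in> S1" for p u
    using squeeze_C2(2)[OF C2_on_linear[OF lf(1) oS0] Cz(1) oS0 S10[OF that], of W u] D_linear[OF lf(1)] Dz(1)[OF S10[OF that]] by simp
  have Db': "D ?b' p u = fst u *\<^sub>R normal_part W' (?z' p) + squeeze W' (fst p) (D ?l' (?g' p) (fst (snd u), 0))" if "p \<in> S1" for p u
    using squeeze_C2(2)[OF C2_on_linear[OF lf(1) oS0] Cz(2) oS0 S10[OF that], of W' u] D_linear[OF lf(1)] Dz(2)[OF S10[OF that]] by simp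
  have Db: "D ?b p u = D \<tau> (?b' p) (D ?b' p u)" if "p \<in> S1" for p u
    by (rule D_apply, rule has_derivative_compose[OF C2_onD(1)[OF Cb' that] C2_onD(1)[OF Ct]])
       (use that in \<open>simp add: S1_def\<close>)
  let ?\<sigma> = "\<lambda>p. ?a p + snd (snd p) *\<^sub>R (?b p - ?a p)"
  have Cs1: "C2_on S1 ?\<sigma>"
    by (intro C2_on_add C2_on_scaleR C2_on_diff Ca Cb oS1 C2_on_linear lf)
  have Ds: "D ?\<sigma> p u = D ?a p u + (snd (snd u) *\<^sub>R (?b p - ?a p) + snd (snd p) *\<^sub>R (D ?b p u - D ?a p u))" if "p \<in> S1" for p u
  proof -
    have "(?\<sigma> has_derivative (\<lambda>u. D ?a p u + (snd (snd p) *\<^sub>R (D ?b p u - D ?a p u) + snd (snd u) *\<^sub>R (?b p - ?a p)))) (at p)"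
      by (intro has_derivative_add has_derivative_scaleR has_derivative_diff has_derivative_snd has_derivative_ident
          C2_onD(1)[OF Ca that] C2_onD(1)[OF Cb that])
    from D_apply[OF this, of u] show ?thesis by (simp add: add.commute)
  qed
  define S where "S = S1 \<inter> ?\<sigma> -` U"
  have oS: "open S" unfolding S_def by (rule continuous_open_preimage[OF C2_onD(4)[OF Cs1] oS1 U(2)])
  have Cs: "C2_on S ?\<sigma>" by (rule C2_on_subset[OF Cs1]) (simp add: S_def)
  have sU: "?\<sigma> p \<in> cimg c" if "p \<in> S" for p using that U(3) unfolding S_def by blast
  have S1: "(r, t, u) \<in> S1" if "r \<in> {0..1}" "t \<in> {0..T}" for r t u
    unfolding S1_def S0_def using ld[OF that(2)] inU[OF that(2,1)] l by simp
  have box1: "(r, t, u) \<in> S" if "r \<in> {0..1}" "t \<in> {0..T}" "u \<in> {0..1}" for r t u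
  proof -
    have 1: "squeeze W r (?l (t, X)) \<in> U" "\<tau> (squeeze W' r (?l' (t, X'))) \<in> U"
      using inU[OF that(2,1)] V(3) unfolding l \<tau>_def by auto
    have "?\<sigma> (r, t, u) = (1 - u) *\<^sub>R squeeze W r (?l (t, X)) + u *\<^sub>R \<tau> (squeeze W' r (?l' (t, X')))"
      by (simp add: algebra_simps)
    moreover have "(1 - u) *\<^sub>R squeeze W r (?l (t, X)) + u *\<^sub>R \<tau> (squeeze W' r (?l' (t, X'))) \<in> U"
      using U(1) 1 that(3) by (simp add: convex_alt)
    ultimately show ?thesis using S1[OF that(1,2)] unfolding S_def by simp
  qed
  then have box: "{0..1} \<times> {0..T} \<times> {0..1} \<subseteq> S" by auto
  let ?G = "pull (om c) ?\<sigma>"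
  have G: "?G u u' p = om c (?\<sigma> p) (D ?\<sigma> p u) (D ?\<sigma> p u')" for u u' p unfolding pull_def ..
  have 01: "(0 :: real) \<in> {0..1}" "(1 :: real) \<in> {0..1}" "T \<in> {0..T}" "0 \<in> {0..T}" using T by auto
  have sq0: "squeeze V r 0 = 0" for V :: "'e set" and r unfolding squeeze_def normal_part_def by (simp add: blinfun.zero_right)
  have z0: "blinfun_apply F (0 :: real, 0 :: 'e) = 0" for F :: "(real \<times> 'e) \<Rightarrow>\<^sub>L 'e"
    using blinfun.zero_right[of F] by (simp add: zero_prod_def)
  have st: "integral {0..1} (\<lambda>r. integral {0..T} (\<lambda>t. ?G (1,0,0) (0,1,0) (r,t,1)))
       - integral {0..1} (\<lambda>r. integral {0..T} (\<lambda>t. ?G (1,0,0) (0,1,0) (r,t,0)))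
    + integral {0..T} (\<lambda>t. integral {0..1} (\<lambda>s. ?G (0,1,0) (0,0,1) (1,t,s) - ?G (0,1,0) (0,0,1) (0,t,s)))
    + integral {0..1} (\<lambda>r. integral {0..1} (\<lambda>s. ?G (0,0,1) (1,0,0) (r,T,s) - ?G (0,0,1) (1,0,0) (r,0,s))) = 0"
    by (rule stokes_box[OF om_closed[OF c(1)] Cs oS sU box _ T]) simp_all
  have F0: "?G (1,0,0) (0,1,0) (r,t,0) = om c (squeeze W r (?l (t, X))) (normal_part W (?l (t, X))) (squeeze W r (D ?l (t, X) (1, 0)))"
    if "r \<in> {0..1}" "t \<in> {0..T}" for r t
    unfolding G Ds[OF S1[OF that]] Da[OF S1[OF that]] by (simp add: sq0 z0)
  have F1: "?G (1,0,0) (0,1,0) (r,t,1) = om c' (squeeze W' r (?l' (t, X'))) (normal_part W' (?l' (t, X'))) (squeeze W' r (D ?l' (t, X') (1, 0)))"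
    if "r \<in> {0..1}" "t \<in> {0..T}" for r t
  proof -
    have ov: "squeeze W' r (?l' (t, X')) \<in> overlap c' c" using inU[OF that(2,1)] V(2) unfolding l by blast
    show ?thesis
      unfolding om_transition[OF c(2,1) ov, folded \<tau>_def] G Ds[OF S1[OF that]] Db[OF S1[OF that]] Db'[OF S1[OF that]]
      by (simp add: sq0 z0)
  qed
  have R1: "?G (0,1,0) (0,0,1) (1,t,u) = 0" if "t \<in> {0..T}" for t u
  proof -
    have "D ?\<sigma> (1,t,u) (0,0,1) = 0"
      unfolding Ds[OF S1[OF 01(2) that]] Da[OF S1[OF 01(2) that]] Db[OF S1[OF 01(2) that]] Db'[OF S1[OF 01(2) that]]
      by (simp add: sq0 z0 squeeze_simps tau[OF that] blinfun.zero_right)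
    then show ?thesis unfolding G by (simp add: blinfun.zero_right)
  qed
  have R0: "?G (0,1,0) (0,0,1) (0,t,u) = 0" if t: "t \<in> {0..T}" and u: "u \<in> {0..1}" for t u
  proof -
    note s1 = S1[OF 01(1) t, of u]
    have ov: "proj W' (?l' (t, X')) \<in> overlap c' c" using inU[OF t 01(1)] V(2) unfolding l by (auto simp: squeeze_simps)
    note tr = transition_slice[OF sl ov proj(1)[OF W(2)], folded \<tau>_def]
    have "?\<sigma> (0,t,u) \<in> W"
      using tr(1) W proj(1)[OF W(1)] by (simp add: squeeze_simps subspace_add subspace_mul subspace_diff)
    moreover have "D ?\<sigma> (0,t,u) (0,1,0) \<in> W"
      unfolding Ds[OF s1] Da[OF s1] Db[OF s1] Db'[OF s1]
      using tr(2)[OF proj(1)[OF W(2)]] W(1) proj(1)[OF W(1)] by (simp add: squeeze_simps subspace_add subspace_mul subspace_diff)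
    moreover have "D ?\<sigma> (0,t,u) (0,0,1) \<in> W"
      unfolding Ds[OF s1] Da[OF s1] Db[OF s1] Db'[OF s1]
      using tr(1) W(1) proj(1)[OF W(1)] by (simp add: squeeze_simps z0 sq0 blinfun.zero_right subspace_add subspace_mul subspace_diff)
    ultimately show ?thesis unfolding G using slice(5)[OF sl(1) sU[OF box1[OF 01(1) t u]]] by blast
  qed
  have T0: "?G (0,0,1) (1,0,0) (r,0,u) = 0" if r: "r \<in> {0..1}" for r u
  proof -
    note s1 = S1[OF r 01(4), of u]
    have "normal_part W (?l (0, X)) = 0" "normal_part W' (?l' (0, X')) = 0"
      using loc_0(2)[OF \<psi> c(1) X(1)] loc_0(2)[OF \<psi> c(2) X(3)] proj_id(2)[OF W(1) XW(1)] proj_id(2)[OF W(2) XW(2)] by simp_all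
    then have "D ?\<sigma> (r,0,u) (1,0,0) = 0"
      unfolding Ds[OF s1] Da[OF s1] Db[OF s1] Db'[OF s1] by (simp add: sq0 z0 blinfun.zero_right)
    then show ?thesis unfolding G by (simp add: blinfun.zero_right)
  qed
  have TT: "?G (0,0,1) (1,0,0) (r,T,u) = om c (squeeze W r zT + u *\<^sub>R (\<tau> (squeeze W' r zT') - squeeze W r zT)) (\<tau> (squeeze W' r zT') - squeeze W r zT)
       (normal_part W zT + u *\<^sub>R (D \<tau> (squeeze W' r zT') (normal_part W' zT') - normal_part W zT))" if r: "r \<in> {0..1}" for r u
  proof -
    note s1 = S1[OF r 01(3), of u]
    have e: "D ?\<sigma> (r,T,u) (0,0,1) = \<tau> (squeeze W' r zT') - squeeze W r zT"
      "D ?\<sigma> (r,T,u) (1,0,0) = normal_part W zT + u *\<^sub>R (D \<tau> (squeeze W' r zT') (normal_part W' zT') - normal_part W zT)"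
      unfolding Ds[OF s1] Da[OF s1] Db[OF s1] Db'[OF s1] by (simp_all add: sq0 z0 l zT_def zT'_def blinfun.zero_right)
    show ?thesis unfolding G e by (simp add: l zT_def zT'_def)
  qed
  have A0: "integral {0..1} (\<lambda>r. integral {0..T} (\<lambda>t. ?G (1,0,0) (0,1,0) (r,t,0))) = area c W \<psi> X"
    unfolding area_def by (intro integral_cong F0)
  have A1: "integral {0..1} (\<lambda>r. integral {0..T} (\<lambda>t. ?G (1,0,0) (0,1,0) (r,t,1))) = area c' W' \<psi> X'"
    unfolding area_def by (intro integral_cong F1)
  have A2: "integral {0..T} (\<lambda>t. integral {0..1} (\<lambda>s. ?G (0,1,0) (0,0,1) (1,t,s) - ?G (0,1,0) (0,0,1) (0,t,s))) = 0"
  proof -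
    have "integral {0..T} (\<lambda>t. integral {0..1} (\<lambda>s. ?G (0,1,0) (0,0,1) (1,t,s) - ?G (0,1,0) (0,0,1) (0,t,s)))
       = integral {0..T} (\<lambda>t. integral {0..1} (\<lambda>s :: real. 0))"
      by (intro integral_cong) (simp add: R1 R0)
    then show ?thesis by simp
  qed
  have A3: "integral {0..1} (\<lambda>r. integral {0..1} (\<lambda>s. ?G (0,0,1) (1,0,0) (r,T,s) - ?G (0,0,1) (1,0,0) (r,0,s)))
    = integral {0..1} (\<lambda>r. integral {0..1} (\<lambda>u.
      om c (squeeze W r zT + u *\<^sub>R (\<tau> (squeeze W' r zT') - squeeze W r zT)) (\<tau> (squeeze W' r zT') - squeeze W r zT)
       (normal_part W zT + u *\<^sub>R (D \<tau> (squeeze W' r zT') (normal_part W' zT') - normal_part W zT))))"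
    by (intro integral_cong) (simp add: TT T0)
  show ?thesis using st unfolding A0 A1 A2 A3 unfolding X_def X'_def by simp
qed

lemma lipschitz_ball:
  fixes f :: "'e \<Rightarrow> 'e"
  assumes "C2_on S f" "ball x d \<subseteq> S" "\<And>y. y \<in> ball x d \<Longrightarrow> norm (D f y) \<le> C" "y \<in> ball x d" "z \<in> ball x d"
  shows "norm (f y - f z) \<le> C * norm (y - z)"
proof (rule differentiable_bound[OF convex_ball _ _ assms(4,5)])
  show "(f has_derivative blinfun_apply (D f y)) (at y within ball x d)" if "y \<in> ball x d" for y
    using C2_onD(1)[OF assms(1)] assms(2) that by (blast intro: has_derivative_at_withinI)
  show "onorm (blinfun_apply (D f y)) \<le> C" if "y \<in> ball x d" for y
    using assms(3)[OF that] by (simp add: norm_blinfun.rep_eq)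
qed

lemma local_bound:
  fixes f :: "'e \<Rightarrow> 'z::real_normed_vector"
  assumes "continuous_on S f" "open S" "x \<in> S"
  shows "\<forall>\<^sub>F y in nhds x. y \<in> S \<and> norm (f y) \<le> norm (f x) + 1"
proof -
  have "isCont f x" using assms by (simp add: continuous_on_eq_continuous_at)
  then have "((\<lambda>y. norm (f y)) \<longlongrightarrow> norm (f x)) (nhds x)"
    by (intro tendsto_norm) (simp add: isCont_def tendsto_at_iff_tendsto_nhds)
  then have "\<forall>\<^sub>F y in nhds x. norm (f y) < norm (f x) + 1" by (rule order_tendstoD) simp
  then show ?thesis using eventually_nhds_in_open[OF assms(2,3)] by eventually_elim simp
qed

text \<open>
  In the remaining face of \<open>area_comparison\<close> both partial derivatives are bounded by the normal
  components of the end point of the orbit in the two charts, and the one in \<open>c'\<close> is bounded by a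
  multiple of the one in \<open>c\<close>. Since \<open>N\<close> and \<open>C\<close> are chosen before the isotopy, they serve a
  whole sequence of isotopies.
\<close>

lemma local_comparison:
  assumes sl: "slice c W" "slice c' W'" and m0: "m0 \<in> L" "m0 \<in> cdom c" "m0 \<in> cdom c'"
  shows "\<exists>N C. open N \<and> m0 \<in> N \<and> 0 \<le> C \<and> (\<forall>\<psi> \<kappa> m. rel_iso \<psi> \<kappa> \<longrightarrow> m \<in> L \<longrightarrow> (\<forall>t\<in>{0..T}. \<psi> t m \<in> N) \<longrightarrow>
    \<bar>action c' W' \<psi> \<kappa> (cmap c' m) - action c W \<psi> \<kappa> (cmap c m)\<bar> \<le> C * norm (normal_part W (cmap c (\<psi> T m))) ^ 2)"
proof -
  have c: "c \<in> A" "c' \<in> A" and W: "subspace W" "subspace W'" using slice[OF sl(1)] slice[OF sl(2)] by auto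
  define \<xi> where "\<xi> = cmap c m0"
  define \<xi>' where "\<xi>' = cmap c' m0"
  let ?t = "transition c' c" and ?t' = "transition c c'"
  have xi: "\<xi> \<in> cimg c" "\<xi>' \<in> cimg c'" "cinv c \<xi> = m0" "cinv c' \<xi>' = m0" "\<xi> \<in> overlap c c'" "\<xi>' \<in> overlap c' c"
    "?t \<xi>' = \<xi>" "\<xi> \<in> W" "\<xi>' \<in> W'"
    using m0 chart(5) c slice(3)[OF sl(1) m0(2)] slice(3)[OF sl(2) m0(3)]
    unfolding \<xi>_def \<xi>'_def overlap_def transition_def by auto
  define C1 where "C1 = norm (D ?t \<xi>') + 1"
  define C1' where "C1' = norm (D ?t' \<xi>) + 1"
  define C2 where "C2 = norm (om c \<xi>) + 1"
  have pos: "C1 \<ge> 0" "C1' \<ge> 0" "C2 \<ge> 0" unfolding C1_def C1'_def C2_def by simp_all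
  have "\<forall>\<^sub>F y in nhds \<xi>. y \<in> overlap c c' \<and> norm (D ?t' y) \<le> C1'"
    unfolding C1'_def by (rule local_bound[OF C2_onD(3)[OF transition_C2[OF c]] open_overlap[OF c] xi(5)])
  moreover have "\<forall>\<^sub>F y in nhds \<xi>. y \<in> cimg c \<and> norm (om c y) \<le> C2"
    unfolding C2_def by (rule local_bound[OF C2_onD(4)[OF om_C2[OF c(1)]] chart(2)[OF c(1)] xi(1)])
  ultimately have "\<forall>\<^sub>F y in nhds \<xi>. y \<in> overlap c c' \<and> norm (D ?t' y) \<le> C1' \<and> y \<in> cimg c \<and> norm (om c y) \<le> C2"
    by eventually_elim simp
  then obtain \<delta> where \<delta>: "\<delta> > 0" "\<And>y. y \<in> ball \<xi> \<delta> \<Longrightarrow> y \<in> overlap c c' \<and> norm (D ?t' y) \<le> C1' \<and> y \<in> cimg c \<and> norm (om c y) \<le> C2"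
    unfolding eventually_nhds_metric by (auto simp: dist_commute)
  have tc: "isCont ?t \<xi>'"
    using C2_onD(4)[OF transition_C2[OF c(2,1)]] open_overlap[OF c(2,1)] xi(6) by (simp add: continuous_on_eq_continuous_at)
  have "(?t \<longlongrightarrow> ?t \<xi>') (nhds \<xi>')" using tc by (simp add: isCont_def tendsto_at_iff_tendsto_nhds)
  then have "\<forall>\<^sub>F y in nhds \<xi>'. ?t y \<in> ball \<xi> \<delta>"
    by (rule topological_tendstoD) (use \<delta>(1) xi(7) in auto)
  moreover have "\<forall>\<^sub>F y in nhds \<xi>'. y \<in> overlap c' c \<and> norm (D ?t y) \<le> C1"
    unfolding C1_def by (rule local_bound[OF C2_onD(3)[OF transition_C2[OF c(2,1)]] open_overlap[OF c(2,1)] xi(6)])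
  ultimately have "\<forall>\<^sub>F y in nhds \<xi>'. ?t y \<in> ball \<xi> \<delta> \<and> y \<in> overlap c' c \<and> norm (D ?t y) \<le> C1"
    by eventually_elim simp
  then obtain \<delta>' where \<delta>': "\<delta>' > 0" "\<And>y. y \<in> ball \<xi>' \<delta>' \<Longrightarrow> ?t y \<in> ball \<xi> \<delta> \<and> y \<in> overlap c' c \<and> norm (D ?t y) \<le> C1"
    unfolding eventually_nhds_metric by (auto simp: dist_commute)
  define N where "N = (cdom c \<inter> cmap c -` ball \<xi> \<delta>) \<inter> (cdom c' \<inter> cmap c' -` ball \<xi>' \<delta>')"
  have oN: "open N" unfolding N_def
    by (intro open_Int continuous_open_preimage chart c open_ball)
  have mN: "m0 \<in> N" unfolding N_def using m0 \<delta>(1) \<delta>'(1) by (simp add: \<xi>_def \<xi>'_def)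
  define C where "C = C2 * ((1 + C1 * C1') * (1 + C1 * C1'))"
  have C0: "0 \<le> C" unfolding C_def using pos by simp
  have "\<bar>action c' W' \<psi> \<kappa> (cmap c' m) - action c W \<psi> \<kappa> (cmap c m)\<bar> \<le> C * norm (normal_part W (cmap c (\<psi> T m))) ^ 2"
    if \<psi>: "rel_iso \<psi> \<kappa>" and m: "m \<in> L" and orb: "\<forall>t\<in>{0..T}. \<psi> t m \<in> N" for \<psi> \<kappa> m
  proof -
    have mM: "m \<in> M" using m L_M by blast
    have "\<psi> 0 m \<in> N" using orb T by simp
    then have mN: "m \<in> N" using rel_isoD(2)[OF \<psi> mM] by simp
    then have mc: "m \<in> cdom c" "m \<in> cdom c'" unfolding N_def by auto
    define z where "z = cmap c (\<psi> T m)"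
    define z' where "z' = cmap c' (\<psi> T m)"
    define y where "y = normal_part W z"
    define y' where "y' = normal_part W' z'"
    have \<psi>T: "\<psi> T m \<in> N" using orb T by simp
    have z: "z \<in> ball \<xi> \<delta>" "z' \<in> ball \<xi>' \<delta>'" "?t' z = z'" "?t z' = z"
      using \<psi>T chart(5) c unfolding N_def z_def z'_def transition_def by auto
    have pz: "proj W z \<in> ball \<xi> \<delta>" using squeeze_ball[OF W(1) xi(8) z(1), of 0] by (simp add: squeeze_simps)
    have lip': "norm (?t' a - ?t' b) \<le> C1' * norm (a - b)" if "a \<in> ball \<xi> \<delta>" "b \<in> ball \<xi> \<delta>" for a b
      by (rule lipschitz_ball[OF transition_C2[OF c] _ _ that]) (use \<delta>(2) in auto)
    have lip: "norm (?t a - ?t b) \<le> C1 * norm (a - b)" if "a \<in> ball \<xi>' \<delta>'" "b \<in> ball \<xi>' \<delta>'" for a b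
      by (rule lipschitz_ball[OF transition_C2[OF c(2,1)] _ _ that]) (use \<delta>'(2) in auto)
    \<comment> \<open>the projection of \<open>z\<close> is a point of \<open>L\<close>, whose distance in \<open>c'\<close> bounds the distance from \<open>W'\<close>\<close>
    have yy: "norm y' \<le> C1' * norm y"
    proof -
      have "?t' (proj W z) \<in> W'"
        by (rule transition_slice(1)[OF sl(2,1) _ proj(1)[OF W(1)]]) (use \<delta>(2)[OF pz] in blast)
      then have "norm y' \<le> norm (z' - ?t' (proj W z))" unfolding y'_def by (rule norm_normal_part_le[OF W(2)])
      also have "\<dots> \<le> C1' * norm (z - proj W z)" using lip'[OF z(1) pz] z(3) by simp
      finally show ?thesis unfolding y_def normal_part_def .
    qed
    have Cyy: "norm y + C1 * norm y' \<le> (1 + C1 * C1') * norm y"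
      using mult_left_mono[OF yy pos(1)] by (simp add: algebra_simps)
    have bnd: "\<bar>om c (squeeze W r z + u *\<^sub>R (?t (squeeze W' r z') - squeeze W r z)) (?t (squeeze W' r z') - squeeze W r z)
       (normal_part W z + u *\<^sub>R (D ?t (squeeze W' r z') (normal_part W' z') - normal_part W z))\<bar> \<le> C * norm y ^ 2"
      if r: "r \<in> {0..1}" and u: "u \<in> {0..1}" for r u
    proof -
      have s: "squeeze W r z \<in> ball \<xi> \<delta>" "squeeze W' r z' \<in> ball \<xi>' \<delta>'"
        using squeeze_ball[OF W(1) xi(8) z(1) r] squeeze_ball[OF W(2) xi(9) z(2) r] by auto
      let ?b = "?t (squeeze W' r z')" and ?a = "squeeze W r z"
      have "?a + u *\<^sub>R (?b - ?a) = (1 - u) *\<^sub>R ?a + u *\<^sub>R ?b" by (simp add: algebra_simps)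
      then have "?a + u *\<^sub>R (?b - ?a) \<in> ball \<xi> \<delta>"
        using convex_ball[of \<xi> \<delta>] s \<delta>'(2)[OF s(2)] u by (simp only: convex_alt) (auto simp: convex_alt)
      then have o: "norm (om c (?a + u *\<^sub>R (?b - ?a))) \<le> C2" using \<delta>(2) by blast
      have "?b - ?a = (?b - ?t z') + (z - ?a)" using z(4) by simp
      then have "norm (?b - ?a) \<le> norm (?b - ?t z') + norm (z - ?a)" using norm_triangle_ineq by metis
      also have "norm (?b - ?t z') \<le> C1 * norm (squeeze W' r z' - z')" using lip[OF s(2) z(2)] .
      also have "norm (squeeze W' r z' - z') \<le> norm y'"
        using squeeze_diff[of W' r z' 1] r by (simp add: squeeze_simps y'_def mult_left_le_one_le)
      also have "norm (z - ?a) \<le> norm y"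
        using squeeze_diff[of W 1 z r] r by (simp add: squeeze_simps y_def mult_left_le_one_le)
      finally have d: "norm (?b - ?a) \<le> (1 + C1 * C1') * norm y"
        using Cyy pos by (simp add: mult_left_mono)
      have "normal_part W z + u *\<^sub>R (D ?t (squeeze W' r z') (normal_part W' z') - normal_part W z) = (1 - u) *\<^sub>R y + u *\<^sub>R D ?t (squeeze W' r z') y'"
        unfolding y_def y'_def by (simp add: algebra_simps)
      also have "norm \<dots> \<le> (1 - u) * norm y + u * norm (D ?t (squeeze W' r z') y')"
        using norm_triangle_ineq[of "(1 - u) *\<^sub>R y" "u *\<^sub>R D ?t (squeeze W' r z') y'"] u by simp
      also have "\<dots> \<le> norm y + norm (D ?t (squeeze W' r z') y')"
        using u by (intro add_mono mult_left_le_one_le) auto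
      also have "norm (D ?t (squeeze W' r z') y') \<le> C1 * norm y'"
        using norm_blinfun[of "D ?t (squeeze W' r z')" y'] \<delta>'(2)[OF s(2)] by (meson mult_right_mono norm_ge_zero order_trans)
      finally have e: "norm (normal_part W z + u *\<^sub>R (D ?t (squeeze W' r z') (normal_part W' z') - normal_part W z)) \<le> (1 + C1 * C1') * norm y"
        using Cyy by simp
      have "norm (om c (?a + u *\<^sub>R (?b - ?a)) (?b - ?a) (normal_part W z + u *\<^sub>R (D ?t (squeeze W' r z') (normal_part W' z') - normal_part W z)))
        \<le> norm (om c (?a + u *\<^sub>R (?b - ?a)) (?b - ?a)) * norm (normal_part W z + u *\<^sub>R (D ?t (squeeze W' r z') (normal_part W' z') - normal_part W z))"
        by (rule norm_blinfun)
      also have "\<dots> \<le> (C2 * ((1 + C1 * C1') * norm y)) * ((1 + C1 * C1') * norm y)"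
        using norm_blinfun[of "om c (?a + u *\<^sub>R (?b - ?a))" "?b - ?a"] o d e pos
        by (intro mult_mono) (auto intro: order_trans[OF _ mult_mono])
      also have "\<dots> = C * norm y ^ 2" unfolding C_def by (simp add: power2_eq_square)
      finally show ?thesis by simp
    qed
    have dom: "\<psi> t m \<in> cdom c \<and> \<psi> t m \<in> cdom c'" if "t \<in> {0..T}" for t using orb that unfolding N_def by blast
    have inU: "squeeze W r (cmap c (\<psi> t m)) \<in> ball \<xi> \<delta> \<and> squeeze W' r (cmap c' (\<psi> t m)) \<in> ball \<xi>' \<delta>'"
      if "t \<in> {0..T}" "r \<in> {0..1}" for t r
      using orb that squeeze_ball[OF W(1) xi(8) _ that(2)] squeeze_ball[OF W(2) xi(9) _ that(2)] unfolding N_def by blast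
    have UV: "ball \<xi> \<delta> \<subseteq> cimg c" "ball \<xi>' \<delta>' \<subseteq> overlap c' c" "\<And>y. y \<in> ball \<xi>' \<delta>' \<Longrightarrow> ?t y \<in> ball \<xi> \<delta>"
      using \<delta>(2) \<delta>'(2) by blast+
    let ?I = "integral {0..1} (\<lambda>r. integral {0..1} (\<lambda>u.
      om c (squeeze W r z + u *\<^sub>R (?t (squeeze W' r z') - squeeze W r z)) (?t (squeeze W' r z') - squeeze W r z)
       (normal_part W z + u *\<^sub>R (D ?t (squeeze W' r z') (normal_part W' z') - normal_part W z))))"
    have "area c' W' \<psi> (cmap c' m) - area c W \<psi> (cmap c m) + ?I = 0"
      using area_comparison[OF \<psi> sl convex_ball open_ball UV(1) open_ball UV(2,3) m mc dom inU] unfolding z_def z'_def .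
    moreover have "\<bar>?I\<bar> \<le> C * norm y ^ 2"
      by (intro abs_integral_le_const bnd) (use C0 in auto)
    moreover have "cinv c (cmap c m) = cinv c' (cmap c' m)" using chart(5)[OF c(1) mc(1)] chart(5)[OF c(2) mc(2)] by simp
    ultimately show ?thesis unfolding action_def y_def z_def by simp
  qed
  then show ?thesis using oN mN C0 by blast
qed

section \<open>The gain of action at a displaced point\<close>

text \<open>
  Otherwise \<open>\<omega>\<close> would embed the span of \<open>W\<close> and \<open>\<eta>\<close> into the annihilator of \<open>W\<close>, which has the same dimension
  as \<open>W\<close>.
\<close>

lemma isotropic_maximal:
  assumes c: "c \<in> A" "x \<in> cimg c" and W: "subspace W" "2 * dim W = DIM('e)"
    and iso: "\<And>u v. u \<in> W \<Longrightarrow> v \<in> W \<Longrightarrow> om c x u v = 0" and \<eta>: "\<And>v. v \<in> W \<Longrightarrow> om c x \<eta> v = 0"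
  shows "\<eta> \<in> W"
proof (rule ccontr)
  assume n: "\<eta> \<notin> W"
  obtain F where linF: "linear F" and injF: "inj F" and Fv: "\<And>u v. F u \<bullet> v = om c x u v"
    using om_dual[OF c] by blast
  let ?P = "{y \<in> UNIV. \<forall>w\<in>W. orthogonal w y}"
  have sub: "F ` insert \<eta> W \<subseteq> ?P"
    using iso \<eta> Fv by (auto simp: orthogonal_def inner_commute)
  have "dim ?P + dim W = dim (UNIV :: 'e set)"
    by (rule dim_subspace_orthogonal_to_vectors[OF W(1) subspace_UNIV]) simp
  then have "dim ?P = dim W" using W(2) by simp
  moreover have "dim (F ` insert \<eta> W) = dim (insert \<eta> W)"
    by (rule dim_image_eq[OF linF]) (use injF in \<open>auto intro: inj_on_subset\<close>)
  moreover have "dim (insert \<eta> W) = dim W + 1"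
    using n W(1) by (simp add: dim_insert span_eq_iff[THEN iffD2])
  moreover have "dim (F ` insert \<eta> W) \<le> dim ?P" by (rule dim_subset[OF sub])
  ultimately show False by simp
qed

end

text \<open>
  It suffices to follow sequences of possible counterexamples.
\<close>

lemma eventually_ball_by_sequences:
  assumes ne: "\<And>n. a n \<in> K n"
    and seq: "\<And>s. (\<And>n. s n \<in> K n) \<Longrightarrow> \<forall>\<^sub>F n in sequentially. P n (s n)"
  shows "\<forall>\<^sub>F n in sequentially. \<forall>x\<in>K n. P n x"
proof -
  define s where "s n = (if \<exists>x\<in>K n. \<not> P n x then SOME x. x \<in> K n \<and> \<not> P n x else a n)" for n
  have bad: "s n \<in> K n \<and> \<not> P n (s n)" if "\<exists>x\<in>K n. \<not> P n x" for n
    using someI_ex[of "\<lambda>x. x \<in> K n \<and> \<not> P n x"] that unfolding s_def by auto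
  have sK: "s n \<in> K n" for n
    using bad[of n] ne[of n] by (cases "\<exists>x\<in>K n. \<not> P n x") (auto simp: s_def)
  have "\<forall>\<^sub>F n in sequentially. P n (s n)" by (rule seq) (rule sK)
  then show ?thesis by eventually_elim (use bad in blast)
qed

context lagrangian_setting
begin

definition near_id :: "(nat \<Rightarrow> real \<Rightarrow> 'm \<Rightarrow> 'm) \<Rightarrow> bool"
  where "near_id \<psi> \<longleftrightarrow> (\<forall>r S s P p. filterlim r at_top sequentially \<longrightarrow> (S \<longlonglongrightarrow> s) \<longrightarrow> (P \<longlonglongrightarrow> p) \<longrightarrow> p \<in> M \<longrightarrow>
       (\<forall>k. P k \<in> M) \<longrightarrow> (\<lambda>k. \<psi> (r k) (S k) (P k)) \<longlonglongrightarrow> p)"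

definition deriv_near_id :: "(nat \<Rightarrow> real \<Rightarrow> 'm \<Rightarrow> 'm) \<Rightarrow> ('m, 'e) chart \<Rightarrow> bool"
  where "deriv_near_id \<psi> c \<longleftrightarrow> (\<forall>r S s X x v. filterlim r at_top sequentially \<longrightarrow> (S \<longlonglongrightarrow> s) \<longrightarrow> (X \<longlonglongrightarrow> x) \<longrightarrow> x \<in> cimg c \<longrightarrow>
       (\<forall>k. X k \<in> cimg c) \<longrightarrow> (\<lambda>k. D (loc (\<psi> (r k)) c c) (S k, X k) (0, v)) \<longlonglongrightarrow> v)"

lemma near_id_subseq:
  assumes "filterlim r at_top sequentially"
  shows "near_id \<psi> \<Longrightarrow> near_id (\<lambda>k. \<psi> (r k))" "deriv_near_id \<psi> c \<Longrightarrow> deriv_near_id (\<lambda>k. \<psi> (r k)) c"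
proof -
  have "filterlim (\<lambda>k. r (r' k)) at_top sequentially" if "filterlim r' at_top sequentially" for r' :: "nat \<Rightarrow> nat"
    by (rule filterlim_compose[OF assms that])
  then show "near_id \<psi> \<Longrightarrow> near_id (\<lambda>k. \<psi> (r k))" "deriv_near_id \<psi> c \<Longrightarrow> deriv_near_id (\<lambda>k. \<psi> (r k)) c"
    unfolding near_id_def deriv_near_id_def by blast+
qed

lemma near_idD:
  assumes "near_id \<psi>" "S \<longlonglongrightarrow> s" "P \<longlonglongrightarrow> p" "p \<in> M" "\<And>k. P k \<in> M"
  shows "(\<lambda>k. \<psi> k (S k) (P k)) \<longlonglongrightarrow> p"
proof -
  have id: "filterlim (\<lambda>k :: nat. k) at_top sequentially" by (rule filterlim_ident)
  show ?thesis using assms id unfolding near_id_def by blast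
qed

lemma deriv_near_idD:
  assumes "deriv_near_id \<psi> c" "S \<longlonglongrightarrow> s" "X \<longlonglongrightarrow> x" "x \<in> cimg c" "\<And>k. X k \<in> cimg c"
  shows "(\<lambda>k. D (loc (\<psi> k) c c) (S k, X k) (0, v)) \<longlonglongrightarrow> v"
proof -
  have id: "filterlim (\<lambda>k :: nat. k) at_top sequentially" by (rule filterlim_ident)
  show ?thesis using assms id unfolding deriv_near_id_def by blast
qed

lemma near_id_compact:
  assumes n: "near_id \<psi>" and K: "compact K" "K \<subseteq> M" and V: "open V" "K \<subseteq> V"
  shows "\<forall>\<^sub>F k in sequentially. \<forall>t\<in>{0..T}. \<forall>m\<in>K. \<psi> k t m \<in> V"
proof (rule ccontr)
  assume "\<not> ?thesis"
  then obtain r :: "nat \<Rightarrow> nat" where r: "strict_mono r" "\<And>k. \<not> (\<forall>t\<in>{0..T}. \<forall>m\<in>K. \<psi> (r k) t m \<in> V)"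
    using not_eventually_sequentiallyD by blast
  then have "\<forall>k. \<exists>q. q \<in> {0..T} \<times> K \<and> \<psi> (r k) (fst q) (snd q) \<notin> V" by force
  then obtain q where q: "\<And>k. q k \<in> {0..T} \<times> K" "\<And>k. \<psi> (r k) (fst (q k)) (snd (q k)) \<notin> V" by metis
  have "compact ({0..T} \<times> K)" using K(1) by (intro compact_Times compact_Icc)
  then have "seq_compact ({0..T} \<times> K)" by (rule compact_imp_seq_compact)
  then obtain l r' where l: "l \<in> {0..T} \<times> K" "strict_mono (r' :: nat \<Rightarrow> nat)" "(q \<circ> r') \<longlonglongrightarrow> l"
    using q(1) unfolding seq_compact_def by metis
  have fl: "filterlim (\<lambda>k. r (r' k)) at_top sequentially"
    using filterlim_subseq[OF strict_mono_o[OF r(1) l(2)]] by (simp add: o_def)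
  have "(\<lambda>k. \<psi> (r (r' k)) (fst (q (r' k))) (snd (q (r' k)))) \<longlonglongrightarrow> snd l"
  proof (rule near_idD[OF near_id_subseq(1)[OF fl n]])
    show "(\<lambda>k. fst (q (r' k))) \<longlonglongrightarrow> fst l" "(\<lambda>k. snd (q (r' k))) \<longlonglongrightarrow> snd l"
      using tendsto_fst[OF l(3)] tendsto_snd[OF l(3)] by (simp_all add: o_def)
    show "snd l \<in> M" "snd (q (r' k)) \<in> M" for k using l(1) q(1)[of "r' k"] K(2) by auto
  qed
  then have "\<forall>\<^sub>F k in sequentially. \<psi> (r (r' k)) (fst (q (r' k))) (snd (q (r' k))) \<in> V"
    by (rule topological_tendstoD) (use V l(1) in auto)
  then show False using q(2) by (auto simp: eventually_sequentially)
qed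

lemma action_continuous:
  assumes \<psi>: "rel_iso \<psi> \<kappa>" and sl: "slice c W" and b: "w \<in> W" "ball w \<rho> \<subseteq> cimg c" and K: "K \<subseteq> cimg c"
    and dom: "\<And>t x. t \<in> {0..T} \<Longrightarrow> x \<in> K \<Longrightarrow> (t, x) \<in> ldom \<psi> c c \<and> loc \<psi> c c (t, x) \<in> ball w \<rho>"
  shows "continuous_on K (action c W \<psi> \<kappa>)"
proof -
  have c: "c \<in> A" and W: "subspace W" using slice[OF sl] by auto
  let ?l = "loc \<psi> c c"
  let ?K = "(K \<times> {0..1 :: real}) \<times> {0..T}"
  let ?g = "\<lambda>q :: ('e \<times> real) \<times> real. (snd q, fst (fst q))"
  define f where "f y t = om c (squeeze W (snd y) (?l (t, fst y))) (normal_part W (?l (t, fst y))) (squeeze W (snd y) (D ?l (t, fst y) (1, 0)))" for y :: "'e \<times> real" and t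
  have line: "continuous_on ?K ?g" by (intro continuous_intros)
  have into: "?g ` ?K \<subseteq> ldom \<psi> c c" using dom by auto
  have cl: "continuous_on ?K (\<lambda>q. ?l (snd q, fst (fst q)))"
    by (rule continuous_on_compose2[OF C2_onD(4)[OF rel_isoD(4)[OF \<psi> c c]] line into])
  have cD: "continuous_on ?K (\<lambda>q. D ?l (snd q, fst (fst q)))"
    by (rule continuous_on_compose2[OF C2_onD(3)[OF rel_isoD(4)[OF \<psi> c c]] line into])
  have cn: "continuous_on ?K (\<lambda>q. normal_part W (g q))" if "continuous_on ?K g" for g
    unfolding normal_part_def using that by (intro continuous_intros)
  have cs: "continuous_on ?K (\<lambda>q. squeeze W (snd (fst q)) (g q))" if "continuous_on ?K g" for g
    unfolding squeeze_def by (intro continuous_intros cn that)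
  have img: "(\<lambda>q. squeeze W (snd (fst q)) (?l (snd q, fst (fst q)))) ` ?K \<subseteq> cimg c"
  proof
    fix y assume "y \<in> (\<lambda>q. squeeze W (snd (fst q)) (?l (snd q, fst (fst q)))) ` ?K"
    then obtain x r t where q: "x \<in> K" "r \<in> {0..1}" "t \<in> {0..T}" "y = squeeze W r (?l (t, x))" by auto
    then show "y \<in> cimg c" using squeeze_ball[OF W b(1) _ q(2)] dom b(2) by blast
  qed
  have co: "continuous_on ?K (\<lambda>q. om c (squeeze W (snd (fst q)) (?l (snd q, fst (fst q)))))"
    by (rule continuous_on_compose2[OF C2_onD(4)[OF om_C2[OF c]] cs[OF cl] img])
  have cf: "continuous_on ?K (\<lambda>(y, t). f y t)"
    unfolding f_def split_def
    by (intro bounded_bilinear.continuous_on[OF bounded_bilinear_blinfun_apply] co cn cl cs continuous_on_const cD)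
  have "continuous_on (K \<times> {0..1}) (\<lambda>y. integral {0..T} (f y))"
    using integral_continuous_on_param[of "K \<times> {0..1}" 0 T f] cf by simp
  then have "continuous_on K (\<lambda>x. integral {0..1} (\<lambda>r. integral {0..T} (f (x, r))))"
    using integral_continuous_on_param[of K 0 1 "\<lambda>x r. integral {0..T} (f (x, r))"] by (simp add: split_def)
  moreover have "continuous_on K (\<lambda>x. integral {0..T} (\<lambda>t. \<kappa> t (cinv c x)))"
  proof -
    have "continuous_on (K \<times> {0..T}) (\<lambda>q. hloc \<kappa> c (snd q, fst q))"
      by (rule continuous_on_compose2[OF C2_onD(4)[OF rel_isoD(5)[OF \<psi> c]]])
         (use K in \<open>auto intro!: continuous_intros\<close>)
    then have "continuous_on (K \<times> cbox 0 T) (\<lambda>(x, t). \<kappa> t (cinv c x))" by (simp add: hloc_def split_def)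
    from integral_continuous_on_param[OF this] show ?thesis by simp
  qed
  ultimately show ?thesis unfolding action_def area_def f_def fst_conv snd_conv by (rule continuous_on_add)
qed

text \<open>
  Here \<open>d n\<close> is the size of the normal displacement of the point \<open>x n\<close> at time \<open>T\<close>, and \<open>\<eta>\<close> is its
  limit direction. As \<open>\<eta>\<close> is orthogonal to \<open>W\<close>, some \<open>v \<in> W\<close> satisfies \<open>\<omega>(\<eta>, v) > 0\<close>. Along
  segments of length proportional to \<open>d n\<close> in the direction \<open>v\<close> the integrand of \<open>action_variation\<close>
  divided by \<open>d n\<close> converges to this number, since \<open>D\<psi>\<^sub>n\<close> tends to the identity and the normal
  displacement changes only by \<open>o(d n)\<close>. The constant \<open>a\<close> is independent of \<open>R\<close>.
\<close>

lemma action_gain: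
  assumes rel: "\<And>n. rel_iso (\<psi> n) (\<kappa> n)" and near: "near_id \<psi>" "deriv_near_id \<psi> c"
    and sl: "slice c W" and b: "w \<in> W" "ball w (3 * \<rho>) \<subseteq> cimg c" "\<rho> > 0"
    and dom: "\<And>n t x. t \<in> {0..T} \<Longrightarrow> x \<in> ball w (2 * \<rho>) \<Longrightarrow>
      (t, x) \<in> ldom (\<psi> n) c c \<and> loc (\<psi> n) c c (t, x) \<in> ball w (3 * \<rho>)"
    and x: "\<And>n. x n \<in> W" "\<And>n. x n \<in> cball w \<rho>" "x \<longlonglongrightarrow> x0"
    and d: "\<And>n. d n = norm (normal_part W (loc (\<psi> n) c c (T, x n)))" "\<And>n. d n > 0"
    and \<eta>: "(\<lambda>n. normal_part W (loc (\<psi> n) c c (T, x n)) /\<^sub>R d n) \<longlonglongrightarrow> \<eta>"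
  shows "\<exists>v\<in>W. \<exists>a>0. \<forall>R>0. (\<forall>\<^sub>F n in sequentially.
     x n + (R * d n) *\<^sub>R v \<in> ball w (2 * \<rho>) \<and>
     a * R * (d n)\<^sup>2 \<le> action c W (\<psi> n) (\<kappa> n) (x n + (R * d n) *\<^sub>R v) - action c W (\<psi> n) (\<kappa> n) (x n) \<and>
     norm (normal_part W (loc (\<psi> n) c c (T, x n + (R * d n) *\<^sub>R v))) \<le> 2 * d n) \<and> (\<lambda>n. x n + (R * d n) *\<^sub>R v) \<longlonglongrightarrow> x0"
proof -
  have c: "c \<in> A" and W: "subspace W" using slice[OF sl] by auto
  have dimW: "2 * dim W = DIM('e)" using sl unfolding slice_def by simp
  have x0: "x0 \<in> W" "x0 \<in> cball w \<rho>"
    using closed_sequentially[OF closed_subspace[OF W] _ x(3)] closed_sequentially[OF closed_cball _ x(3)] x(1,2) by blast+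
  have sub2: "ball w (2 * \<rho>) \<subseteq> cimg c" using b(2,3) by (auto simp: subset_iff)
  have x0c: "x0 \<in> cimg c" "x0 \<in> ball w (2 * \<rho>)" using x0(2) b(3) sub2 by (auto simp: subset_iff)
  have tn: "(f \<longlonglongrightarrow> l) \<Longrightarrow> (\<lambda>n. normal_part W (f n)) \<longlonglongrightarrow> normal_part W l" for f :: "nat \<Rightarrow> 'e" and l
    by (rule bounded_linear.tendsto[OF bounded_linear_normal_part])
  have zlim: "(\<lambda>n. loc (\<psi> n) c c (T, X n)) \<longlonglongrightarrow> x0" if "X \<longlonglongrightarrow> x0" "\<And>n. X n \<in> cimg c" for X
  proof -
    have M: "cinv c y \<in> M" "cinv c y \<in> cdom c" if "y \<in> cimg c" for y using chart(7,8)[OF c] that by blast+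
    have "(\<lambda>n. \<psi> n T (cinv c (X n))) \<longlonglongrightarrow> cinv c x0"
      by (rule near_idD[OF near(1) tendsto_const tendsto_cinv[OF c x0c(1) that(1)]]) (use M that(2) x0c(1) in blast)+
    from tendsto_cmap[OF c M(2)[OF x0c(1)] this] show ?thesis
      unfolding loc_def by (simp add: chart(6)[OF c x0c(1)])
  qed
  have xc: "x n \<in> cimg c" for n using x(2)[of n] b(3) sub2 by (auto simp: subset_iff)
  have d0: "d \<longlonglongrightarrow> 0"
    using tendsto_norm[OF tn[OF zlim[OF x(3) xc]]] proj_id(2)[OF W x0(1)] by (simp add: d(1)[symmetric])
  have n\<eta>: "norm \<eta> = 1"
  proof -
    have "norm (normal_part W (loc (\<psi> n) c c (T, x n)) /\<^sub>R d n) = 1" for n using d(2)[of n] by (simp add: d(1))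
    then show ?thesis using tendsto_norm[OF \<eta>] by (simp add: LIMSEQ_const_iff)
  qed
  have \<eta>W: "\<eta> \<bullet> v = 0" if "v \<in> W" for v
  proof -
    have "(\<lambda>n. (normal_part W (loc (\<psi> n) c c (T, x n)) /\<^sub>R d n) \<bullet> v) \<longlonglongrightarrow> \<eta> \<bullet> v" by (intro tendsto_inner \<eta> tendsto_const)
    then show ?thesis using proj(2)[OF W that] by (simp add: LIMSEQ_const_iff)
  qed
  have "\<eta> \<notin> W"
  proof
    assume "\<eta> \<in> W"
    then have "\<eta> \<bullet> \<eta> = 0" by (rule \<eta>W)
    then show False using n\<eta> by simp
  qed
  then obtain v0 where v0: "v0 \<in> W" "om c x0 \<eta> v0 \<noteq> 0"
    using isotropic_maximal[OF c x0c(1) W dimW slice(5)[OF sl x0c(1) x0(1)]] by blast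
  define v where "v = (if om c x0 \<eta> v0 > 0 then v0 else - v0)"
  have v: "v \<in> W" "om c x0 \<eta> v > 0" unfolding v_def using v0 W by (auto simp: subspace_neg blinfun.bilinear_simps)
  define a where "a = om c x0 \<eta> v / 2"
  have a: "a > 0" "a < om c x0 \<eta> v" unfolding a_def using v by simp_all
  have "(\<forall>\<^sub>F n in sequentially.
     x n + (R * d n) *\<^sub>R v \<in> ball w (2 * \<rho>) \<and>
     a * R * (d n)\<^sup>2 \<le> action c W (\<psi> n) (\<kappa> n) (x n + (R * d n) *\<^sub>R v) - action c W (\<psi> n) (\<kappa> n) (x n) \<and>
     norm (normal_part W (loc (\<psi> n) c c (T, x n + (R * d n) *\<^sub>R v))) \<le> 2 * d n) \<and> (\<lambda>n. x n + (R * d n) *\<^sub>R v) \<longlonglongrightarrow> x0" if R: "R > 0" for R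
  proof -
    define Z where "Z n = R * d n" for n
    have Z0: "Z n > 0" for n unfolding Z_def using R d(2) by simp
    have Zlim: "Z \<longlonglongrightarrow> 0" unfolding Z_def using tendsto_mult_right_zero[OF d0] by simp
    let ?z = "\<lambda>n s. loc (\<psi> n) c c (T, x n + s *\<^sub>R v)"
    let ?zs = "\<lambda>n s. D (loc (\<psi> n) c c) (T, x n + s *\<^sub>R v) (0, v)"
    define K where "K n = {s \<in> {0..Z n}. x n + s *\<^sub>R v \<in> ball w (2 * \<rho>)}" for n
    have K0: "0 \<in> K n" for n using Z0[of n] x(2)[of n] b(3) unfolding K_def by auto
    have Klim: "s \<longlonglongrightarrow> 0" if "\<And>n. s n \<in> K n" for s
      by (rule tendsto_sandwich[OF _ _ tendsto_const Zlim]) (use that in \<open>auto simp: K_def\<close>)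
    have Xlim: "(\<lambda>n. x n + s n *\<^sub>R v) \<longlonglongrightarrow> x0" if "s \<longlonglongrightarrow> 0" for s
    proof -
      have "(\<lambda>n. x n + s n *\<^sub>R v) \<longlonglongrightarrow> x0 + 0 *\<^sub>R v" by (intro tendsto_intros x(3) that)
      then show ?thesis by simp
    qed
    have Kc: "x n + s n *\<^sub>R v \<in> cimg c" if "\<And>n. s n \<in> K n" for s n using that[of n] sub2 unfolding K_def by auto
    have zl: "(\<lambda>n. ?z n (s n)) \<longlonglongrightarrow> x0" if "\<And>n. s n \<in> K n" for s
      by (rule zlim[OF Xlim[OF Klim[OF that]] Kc[OF that]])
    have zsl: "(\<lambda>n. ?zs n (s n)) \<longlonglongrightarrow> v" if "\<And>n. s n \<in> K n" for s
      by (rule deriv_near_idD[OF near(2) tendsto_const Xlim[OF Klim[OF that]] x0c(1) Kc[OF that]])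
    have nv: "normal_part W v = 0" by (rule proj_id(2)[OF W v(1)])
    have ev_dom: "\<forall>\<^sub>F n in sequentially. {0..Z n} = K n"
    proof -
      have "(\<lambda>n. Z n * norm v) \<longlonglongrightarrow> 0" using tendsto_mult_left_zero[OF Zlim] by simp
      then have "\<forall>\<^sub>F n in sequentially. Z n * norm v < \<rho>" using b(3) by (rule order_tendstoD)
      then show ?thesis
      proof eventually_elim
        case (elim n)
        have "x n + s *\<^sub>R v \<in> ball w (2 * \<rho>)" if "s \<in> {0..Z n}" for s
        proof -
          have "norm (s *\<^sub>R v) \<le> Z n * norm v" using that by (simp add: mult_right_mono)
          moreover have "dist w (x n + s *\<^sub>R v) \<le> dist w (x n) + norm (s *\<^sub>R v)"
            using dist_triangle[of w "x n + s *\<^sub>R v" "x n"] by (simp add: dist_norm)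
          ultimately show ?thesis using elim x(2)[of n] by simp
        qed
        then show ?case unfolding K_def by auto
      qed
    qed
    have slope: "\<forall>\<^sub>F n in sequentially. \<forall>s\<in>K n. norm (normal_part W (?z n s) - normal_part W (?z n 0)) \<le> e * s" if e: "e > 0" for e
    proof -
      have "\<forall>\<^sub>F n in sequentially. \<forall>s\<in>K n. norm (normal_part W (?zs n s)) < e"
      proof (rule eventually_ball_by_sequences[where a="\<lambda>n. 0"])
        fix s :: "nat \<Rightarrow> real" assume s: "\<And>n. s n \<in> K n"
        have "(\<lambda>n. norm (normal_part W (?zs n (s n)))) \<longlonglongrightarrow> norm (normal_part W v)" by (intro tendsto_norm tn zsl s)
        then show "\<forall>\<^sub>F n in sequentially. norm (normal_part W (?zs n (s n))) < e" by (rule order_tendstoD) (use nv e in simp)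
      qed (rule K0)
      then show ?thesis using ev_dom
      proof eventually_elim
        case (elim n)
        show ?case
        proof
          fix s assume s: "s \<in> K n"
          then have sZ: "s \<in> {0..Z n}" unfolding K_def by simp
          have "norm (normal_part W (?z n s) - normal_part W (?z n 0)) \<le> e * norm (s - 0)"
          proof (rule differentiable_bound[where S="{0..s}"])
            fix u assume u: "u \<in> {0..s}"
            then have "u \<in> {0..Z n}" using sZ by simp
            then have uK: "u \<in> K n" using elim(2) by blast
            then have ld: "(T, x n + u *\<^sub>R v) \<in> ldom (\<psi> n) c c" using dom[of T] T unfolding K_def by auto
            have "((\<lambda>u. (T, x n + u *\<^sub>R v)) has_derivative (\<lambda>t. (0, t *\<^sub>R v))) (at u)" by (auto intro!: derivative_eq_intros)
            from bounded_linear.has_derivative[OF bounded_linear_normal_part has_derivative_compose[OF this C2_onD(1)[OF rel_isoD(4)[OF rel c c] ld]], of W]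
            show "((\<lambda>u. normal_part W (?z n u)) has_derivative (\<lambda>t. normal_part W (D (loc (\<psi> n) c c) (T, x n + u *\<^sub>R v) (0, t *\<^sub>R v)))) (at u within {0..s})"
              by (rule has_derivative_at_withinI)
            have "normal_part W (D (loc (\<psi> n) c c) (T, x n + u *\<^sub>R v) (0, t *\<^sub>R v)) = t *\<^sub>R normal_part W (?zs n u)" for t
              using blinfun.scaleR_right[of "D (loc (\<psi> n) c c) (T, x n + u *\<^sub>R v)" t "(0, v)"]
                linear_cmul[OF bounded_linear.linear[OF bounded_linear_normal_part], of W t] by simp
            moreover have N: "norm (normal_part W (?zs n u)) \<le> e" using elim(1) uK less_imp_le by blast
            ultimately show "onorm (\<lambda>t. normal_part W (D (loc (\<psi> n) c c) (T, x n + u *\<^sub>R v) (0, t *\<^sub>R v))) \<le> e"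
              using mult_left_mono[OF N abs_ge_zero] by (intro onorm_le) (simp add: mult.commute)
          qed (use sZ in auto)
          then show "norm (normal_part W (?z n s) - normal_part W (?z n 0)) \<le> e * s" using sZ by simp
        qed
      qed
    qed
    have ratio: "(\<lambda>n. normal_part W (?z n (s n)) /\<^sub>R d n) \<longlonglongrightarrow> \<eta>" if s: "\<And>n. s n \<in> K n" for s
    proof -
      have "(\<lambda>n. (normal_part W (?z n (s n)) - normal_part W (?z n 0)) /\<^sub>R d n) \<longlonglongrightarrow> 0"
      proof (rule tendstoI)
        fix e :: real assume e: "e > 0"
        then have e': "e / (2 * R) > 0" using R by simp
        show "\<forall>\<^sub>F n in sequentially. dist ((normal_part W (?z n (s n)) - normal_part W (?z n 0)) /\<^sub>R d n) 0 < e"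
          using slope[OF e']
        proof eventually_elim
          case (elim n)
          have "norm (normal_part W (?z n (s n)) - normal_part W (?z n 0)) \<le> e / (2 * R) * s n" using elim s by blast
          also have "\<dots> \<le> e / (2 * R) * Z n" using s[of n] e' unfolding K_def by (intro mult_left_mono) auto
          also have "\<dots> = e / 2 * d n" unfolding Z_def using R by simp
          finally have le: "norm (normal_part W (?z n (s n)) - normal_part W (?z n 0)) / d n \<le> e / 2" using d(2)[of n] by (simp add: divide_le_eq)
          have scale: "dist (y /\<^sub>R d n) 0 = norm y / d n" for y :: 'e
            using d(2)[of n] by (simp add: divide_inverse mult.commute)
          show ?case unfolding scale using le e by linarith
        qed
      qed
      from tendsto_add[OF this \<eta>] show ?thesis by (simp add: scaleR_diff_right)
    qed
    have sqlim: "(\<lambda>n. squeeze W (r n) (f n)) \<longlonglongrightarrow> l" if f: "f \<longlonglongrightarrow> l" and l: "normal_part W l = 0" and r: "\<And>n. r n \<in> {0..1}" for r f l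
    proof -
      have "(\<lambda>n. (1 - r n) *\<^sub>R normal_part W (f n)) \<longlonglongrightarrow> 0"
      proof (rule tendsto_norm_zero_cancel, rule tendsto_sandwich[OF _ _ tendsto_const])
        show "(\<lambda>n. norm (normal_part W (f n))) \<longlonglongrightarrow> 0" using tendsto_norm[OF tn[OF f]] l by simp
        show "\<forall>\<^sub>F n in sequentially. norm ((1 - r n) *\<^sub>R normal_part W (f n)) \<le> norm (normal_part W (f n))"
          by (rule always_eventually) (use r in \<open>auto simp: mult_left_le_one_le\<close>)
      qed simp
      from tendsto_diff[OF f this] show ?thesis
        unfolding squeeze_def normal_part_def by (simp add: algebra_simps)
    qed
    have "\<forall>\<^sub>F n in sequentially. \<forall>q\<in>{0..1} \<times> K n.
       a < om c (squeeze W (fst q) (?z n (snd q))) (normal_part W (?z n (snd q)) /\<^sub>R d n) (squeeze W (fst q) (?zs n (snd q)))"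
    proof (rule eventually_ball_by_sequences[where a="\<lambda>n. (0, 0)"])
      fix q :: "nat \<Rightarrow> real \<times> real" assume q: "\<And>n. q n \<in> {0..1} \<times> K n"
      have s: "snd (q n) \<in> K n" "fst (q n) \<in> {0..1}" for n using q[of n] by auto
      have cont: "isCont (om c) x0"
        using C2_onD(4)[OF om_C2[OF c]] chart(2)[OF c] x0c(1) by (simp only: continuous_on_eq_continuous_at)
      have "(\<lambda>n. om c (squeeze W (fst (q n)) (?z n (snd (q n))))) \<longlonglongrightarrow> om c x0"
        by (rule isCont_tendsto_compose[OF cont sqlim[OF zl[OF s(1)] proj_id(2)[OF W x0(1)] s(2)]])
      then have "(\<lambda>n. om c (squeeze W (fst (q n)) (?z n (snd (q n)))) (normal_part W (?z n (snd (q n))) /\<^sub>R d n) (squeeze W (fst (q n)) (?zs n (snd (q n)))))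
         \<longlonglongrightarrow> om c x0 \<eta> v"
        by (intro bounded_bilinear.tendsto[OF bounded_bilinear_blinfun_apply] ratio[OF s(1)] sqlim[OF zsl[OF s(1)] nv s(2)])
      then show "\<forall>\<^sub>F n in sequentially. a < om c (squeeze W (fst (q n)) (?z n (snd (q n)))) (normal_part W (?z n (snd (q n))) /\<^sub>R d n) (squeeze W (fst (q n)) (?zs n (snd (q n))))"
        using a(2) by (rule order_tendstoD)
    qed (use K0 in simp)
    then have gain: "\<forall>\<^sub>F n in sequentially. a * R * (d n)\<^sup>2 \<le> action c W (\<psi> n) (\<kappa> n) (x n + Z n *\<^sub>R v) - action c W (\<psi> n) (\<kappa> n) (x n)"
      using ev_dom
    proof eventually_elim
      case (elim n)
      have "a * d n * Z n \<le> action c W (\<psi> n) (\<kappa> n) (x n + Z n *\<^sub>R v) - action c W (\<psi> n) (\<kappa> n) (x n)"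
      proof (rule action_variation_lower[OF rel sl b(1,2) x(1) v(1) less_imp_le[OF Z0]])
        fix t s assume ts: "t \<in> {0..T}" "s \<in> {0..Z n}"
        then have "x n + s *\<^sub>R v \<in> ball w (2 * \<rho>)" using elim(2) unfolding K_def by blast
        then show "(t, x n + s *\<^sub>R v) \<in> ldom (\<psi> n) c c \<and> loc (\<psi> n) c c (t, x n + s *\<^sub>R v) \<in> ball w (3 * \<rho>)"
          using dom ts(1) by blast
      next
        fix r s :: real assume rs: "r \<in> {0..1}" "s \<in> {0..Z n}"
        then have "(r, s) \<in> {0..1} \<times> K n" using elim(2) by simp
        then have "a < om c (squeeze W r (?z n s)) (normal_part W (?z n s) /\<^sub>R d n) (squeeze W r (?zs n s))" using elim(1) by force
        then show "a * d n \<le> om c (squeeze W r (?z n s)) (normal_part W (?z n s)) (squeeze W r (?zs n s))"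
          using d(2)[of n] by (simp add: blinfun.bilinear_simps field_simps)
      qed
      then show ?case unfolding Z_def by (simp add: power2_eq_square mult_ac)
    qed
    have close: "\<forall>\<^sub>F n in sequentially. norm (normal_part W (?z n (Z n))) \<le> 2 * d n"
    proof -
      have "1 / R > 0" using R by simp
      from slope[OF this] ev_dom show ?thesis
      proof eventually_elim
        case (elim n)
        have "Z n \<in> {0..Z n}" using Z0[of n] by simp
        then have "Z n \<in> K n" using elim(2) by blast
        then have "norm (normal_part W (?z n (Z n)) - normal_part W (?z n 0)) \<le> 1 / R * Z n" using elim(1) by blast
        then have "norm (normal_part W (?z n (Z n)) - normal_part W (?z n 0)) \<le> d n" unfolding Z_def using R by simp
        moreover have "norm (normal_part W (?z n 0)) = d n" by (simp add: d(1))
        ultimately show ?case using norm_triangle_sub[of "normal_part W (?z n (Z n))" "normal_part W (?z n 0)"] by simp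
      qed
    qed
    have inb: "\<forall>\<^sub>F n in sequentially. x n + Z n *\<^sub>R v \<in> ball w (2 * \<rho>)"
      using ev_dom
    proof eventually_elim
      case (elim n)
      have "Z n \<in> {0..Z n}" using Z0[of n] by simp
      then have "Z n \<in> K n" using elim by blast
      then show ?case unfolding K_def by simp
    qed
    show ?thesis
      using eventually_conj[OF inb eventually_conj[OF gain close]] Xlim[OF Zlim] unfolding Z_def by simp
  qed
  then show ?thesis using v(1) a(1) by blast
qed

end

context lagrangian_setting
begin

section \<open>Intersections and the countability of packings\<close>

text \<open>
  The slice charts \<open>ch p\<close> with the balls of radius \<open>\<rho> p\<close> cover \<open>L\<close>; on the balls of twice this
  radius the actions are defined for almost all indices. The action is maximized over the
  charts and over the part \<open>Kx p\<close> of \<open>L\<close> in each closed ball, and a subsequence is chosen along which the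
  maximizing chart is fixed and the maximizers and the directions of their displacements
  converge.
\<close>

lemma no_displacement_near_id:
  assumes rel: "\<And>n. rel_iso (\<psi> n) (\<kappa> n)" and near: "near_id \<psi>" "\<And>p. p \<in> F \<Longrightarrow> deriv_near_id \<psi> (ch p)"
    and F: "finite F" "F \<noteq> {}" "F \<subseteq> L"
    and sl: "\<And>p. p \<in> F \<Longrightarrow> slice (ch p) (Wd p)" "\<And>p. p \<in> F \<Longrightarrow> p \<in> cdom (ch p)"
    and \<rho>: "\<And>p. p \<in> F \<Longrightarrow> \<rho> p > 0" "\<And>p. p \<in> F \<Longrightarrow> ball (cmap (ch p) p) (3 * \<rho> p) \<subseteq> cimg (ch p)"
    and cover: "\<And>m. m \<in> L \<Longrightarrow> \<exists>p\<in>F. m \<in> cdom (ch p) \<and> cmap (ch p) m \<in> ball (cmap (ch p) p) (\<rho> p)"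
  shows "\<exists>n. \<exists>m\<in>L. \<psi> n T m \<in> L"
proof (rule ccontr)
  assume "\<not> ?thesis"
  then have disp: "\<And>n m. m \<in> L \<Longrightarrow> \<psi> n T m \<notin> L" by blast
  define w where "w p = cmap (ch p) p" for p
  have A: "ch p \<in> A" "subspace (Wd p)" if "p \<in> F" for p using slice[OF sl(1)[OF that]] by auto
  have wW: "w p \<in> Wd p" if "p \<in> F" for p
    using slice(3)[OF sl(1)[OF that] sl(2)[OF that]] F(3) that unfolding w_def by blast
  have cb: "cball (w p) (2 * \<rho> p) \<subseteq> cimg (ch p)" "cball (w p) (\<rho> p) \<subseteq> ball (w p) (2 * \<rho> p)" if "p \<in> F" for p
    using \<rho>(1)[OF that] \<rho>(2)[OF that] unfolding w_def by (auto simp: subset_iff)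
  have cb1: "cball (w p) (\<rho> p) \<subseteq> cimg (ch p)" if "p \<in> F" for p
    using cb[OF that] ball_subset_cball by blast
  have b3: "ball (w p) (3 * \<rho> p) \<subseteq> cimg (ch p)" if "p \<in> F" for p using \<rho>(2)[OF that] unfolding w_def .
  define good where "good n p \<longleftrightarrow> (\<forall>t\<in>{0..T}. \<forall>x\<in>ball (w p) (2 * \<rho> p).
      (t, x) \<in> ldom (\<psi> n) (ch p) (ch p) \<and> loc (\<psi> n) (ch p) (ch p) (t, x) \<in> ball (w p) (3 * \<rho> p))" for n p
  have "\<forall>\<^sub>F n in sequentially. good n p" if p: "p \<in> F" for p
  proof -
    let ?c = "ch p"
    let ?K = "cinv ?c ` cball (w p) (2 * \<rho> p)" and ?V = "cdom ?c \<inter> cmap ?c -` ball (w p) (3 * \<rho> p)"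
    have K: "compact ?K"
      by (rule compact_continuous_image[OF continuous_on_subset[OF chart(4)[OF A(1)[OF p]] cb(1)[OF p]] compact_cball])
    have KM: "?K \<subseteq> M" using chart(7,8)[OF A(1)[OF p]] cb(1)[OF p] by blast
    have oV: "open ?V" by (rule continuous_open_preimage[OF chart(3,1)[OF A(1)[OF p]] open_ball])
    have KV: "?K \<subseteq> ?V"
    proof
      fix m assume "m \<in> ?K"
      then obtain x where x: "x \<in> cball (w p) (2 * \<rho> p)" "m = cinv ?c x" by blast
      then have "x \<in> cimg ?c" using cb(1)[OF p] by blast
      then show "m \<in> ?V" using x \<rho>(1)[OF p] chart(6,7)[OF A(1)[OF p]] by auto
    qed
    show ?thesis using near_id_compact[OF near(1) K KM oV KV]
    proof eventually_elim
      case (elim n)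
      show ?case unfolding good_def
      proof (intro ballI)
        fix t x assume t: "t \<in> {0..T}" and x: "x \<in> ball (w p) (2 * \<rho> p)"
        then have x': "x \<in> cball (w p) (2 * \<rho> p)" "x \<in> cimg ?c" using cb(1)[OF p] by auto
        then have "\<psi> n t (cinv ?c x) \<in> ?V" using elim t by blast
        then show "(t, x) \<in> ldom (\<psi> n) ?c ?c \<and> loc (\<psi> n) ?c ?c (t, x) \<in> ball (w p) (3 * \<rho> p)"
          using x'(2) unfolding ldom_def loc_def by simp
      qed
    qed
  qed
  then have "\<forall>\<^sub>F n in sequentially. \<forall>p\<in>F. good n p" by (intro eventually_ball_finite F(1)) blast
  then obtain n0 where n0: "\<And>n p. n \<ge> n0 \<Longrightarrow> p \<in> F \<Longrightarrow> good n p" unfolding eventually_sequentially by blast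
  define Kx where "Kx p = Wd p \<inter> cball (w p) (\<rho> p)" for p
  have compK: "compact (Kx p)" if "p \<in> F" for p
    unfolding Kx_def by (rule closed_Int_compact[OF closed_subspace[OF A(2)[OF that]] compact_cball])
  have wK: "w p \<in> Kx p" if "p \<in> F" for p unfolding Kx_def using wW[OF that] \<rho>(1)[OF that] by simp
  let ?act = "\<lambda>n p. action (ch p) (Wd p) (\<psi> n) (\<kappa> n)"
  have contact: "continuous_on (Kx p) (?act n p)" if n: "n \<ge> n0" and p: "p \<in> F" for n p
  proof (rule action_continuous[OF rel sl(1)[OF p] wW[OF p] b3[OF p]])
    show "Kx p \<subseteq> cimg (ch p)" using cb1[OF p] unfolding Kx_def by blast
    fix t x assume "t \<in> {0..T}" "x \<in> Kx p"
    then show "(t, x) \<in> ldom (\<psi> n) (ch p) (ch p) \<and> loc (\<psi> n) (ch p) (ch p) (t, x) \<in> ball (w p) (3 * \<rho> p)"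
      using n0[OF n p] cb(2)[OF p] unfolding good_def Kx_def by blast
  qed
  have "\<exists>p x. p \<in> F \<and> x \<in> Kx p \<and> (\<forall>q\<in>F. \<forall>y\<in>Kx q. ?act n q y \<le> ?act n p x)" if n: "n \<ge> n0" for n
  proof -
    have "\<exists>x\<in>Kx p. \<forall>y\<in>Kx p. ?act n p y \<le> ?act n p x" if p: "p \<in> F" for p
      using continuous_attains_sup[OF compK[OF p] _ contact[OF n p]] wK[OF p] by blast
    then obtain X where X: "\<And>p. p \<in> F \<Longrightarrow> X p \<in> Kx p \<and> (\<forall>y\<in>Kx p. ?act n p y \<le> ?act n p (X p))" by metis
    let ?S = "(\<lambda>p. ?act n p (X p)) ` F"
    have S: "finite ?S" "?S \<noteq> {}" using F by auto
    obtain p where p: "p \<in> F" "Max ?S = ?act n p (X p)" using Max_in[OF S] by auto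
    have "?act n q y \<le> ?act n p (X p)" if "q \<in> F" "y \<in> Kx q" for q y
    proof -
      have "?act n q y \<le> ?act n q (X q)" using X that by blast
      also have "\<dots> \<le> Max ?S" using S(1) that(1) by (intro Max_ge) auto
      finally show ?thesis using p(2) by simp
    qed
    then show ?thesis using p(1) X by blast
  qed
  then have "\<forall>n. \<exists>p x. p \<in> F \<and> x \<in> Kx p \<and> (\<forall>q\<in>F. \<forall>y\<in>Kx q. ?act (n + n0) q y \<le> ?act (n + n0) p x)" by simp
  then obtain P X where PX: "\<And>n. P n \<in> F" "\<And>n. X n \<in> Kx (P n)"
    "\<And>n q y. q \<in> F \<Longrightarrow> y \<in> Kx q \<Longrightarrow> ?act (n + n0) q y \<le> ?act (n + n0) (P n) (X n)" by metis
  have "P ` UNIV \<subseteq> F" using PX(1) by blast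
  then have "finite (P ` UNIV)" using F(1) finite_subset by blast
  then obtain k0 where inf: "infinite {n. P n = P k0}"
    using pigeonhole_infinite[of "UNIV :: nat set" P] by auto
  define p where "p = P k0"
  have p: "p \<in> F" unfolding p_def by (rule PX(1))
  obtain r1 :: "nat \<Rightarrow> nat" where r1: "strict_mono r1" "\<And>n. P (r1 n) = p"
    using infinite_enumerate[OF inf] unfolding p_def by blast
  let ?c = "ch p" and ?W = "Wd p"
  note cA = A(1)[OF p] and W = A(2)[OF p]
  define Y where "Y n = normal_part ?W (loc (\<psi> (r1 n + n0)) ?c ?c (T, X (r1 n)))" for n
  have Xp: "X (r1 n) \<in> Kx p" for n using PX(2)[of "r1 n"] r1(2) by simp
  have Y0: "Y n \<noteq> 0" for n
  proof
    assume "Y n = 0"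
    let ?k = "r1 n + n0" and ?x = "X (r1 n)"
    have x: "?x \<in> ?W" "?x \<in> ball (w p) (2 * \<rho> p)" "?x \<in> cimg ?c" using Xp[of n] cb[OF p] cb1[OF p] unfolding Kx_def by blast+
    have g: "(T, ?x) \<in> ldom (\<psi> ?k) ?c ?c" using n0[of ?k p] p x(2) T unfolding good_def by auto
    have "loc (\<psi> ?k) ?c ?c (T, ?x) \<in> ?W" using normal_part_eq_0[OF W] \<open>Y n = 0\<close> unfolding Y_def by blast
    then have "\<psi> ?k T (cinv ?c ?x) \<in> L"
      using slice(3)[OF sl(1)[OF p], of "\<psi> ?k T (cinv ?c ?x)"] g unfolding ldom_def loc_def by simp
    moreover have "cinv ?c ?x \<in> L" using slice(4)[OF sl(1)[OF p] x(3)] x(1) by blast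
    ultimately show False using disp by blast
  qed
  have sc: "seq_compact (Kx p \<times> (sphere 0 1 :: 'e set))" by (intro compact_imp_seq_compact compact_Times compK p compact_sphere)
  have "\<forall>n. (X (r1 n), Y n /\<^sub>R norm (Y n)) \<in> Kx p \<times> sphere 0 1" using Xp Y0 by simp
  from seq_compactE[OF sc this] obtain l r2 where l: "l \<in> Kx p \<times> sphere 0 1" "strict_mono (r2 :: nat \<Rightarrow> nat)"
    "((\<lambda>n. (X (r1 n), Y n /\<^sub>R norm (Y n))) \<circ> r2) \<longlonglongrightarrow> l"
    by blast
  define r where "r n = r1 (r2 n) + n0" for n
  define x where "x n = X (r1 (r2 n))" for n
  define d where "d n = norm (normal_part ?W (loc (\<psi> (r n)) ?c ?c (T, x n)))" for n
  define x0 where "x0 = fst l"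
  have r: "filterlim r at_top sequentially"
  proof -
    have "filterlim (\<lambda>n. r1 (r2 n)) at_top sequentially"
      using filterlim_subseq[OF strict_mono_o[OF r1(1) l(2)]] by (simp add: o_def)
    then show ?thesis unfolding r_def
      using filterlim_compose[OF filterlim_add_const_nat_at_top[of n0]] by blast
  qed
  have dY: "d n = norm (Y (r2 n))" for n unfolding d_def Y_def r_def x_def by simp
  have xlim: "x \<longlonglongrightarrow> x0" using tendsto_fst[OF l(3)] unfolding x_def[abs_def] x0_def by (simp add: o_def)
  have \<eta>lim: "(\<lambda>n. normal_part ?W (loc (\<psi> (r n)) ?c ?c (T, x n)) /\<^sub>R d n) \<longlonglongrightarrow> snd l"
    using tendsto_snd[OF l(3)] unfolding dY by (simp add: o_def Y_def r_def x_def)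
  have d0: "d n > 0" for n unfolding dY using Y0 by simp
  have xK: "x n \<in> Kx p" for n unfolding x_def by (rule Xp)
  have x0K: "x0 \<in> Kx p" using l(1) unfolding x0_def by auto
  have x0c: "x0 \<in> cimg ?c" using x0K cb1[OF p] unfolding Kx_def by blast
  have gn: "good (r n) q" if "q \<in> F" for n q using n0[OF _ that] unfolding r_def by simp
  have mx: "?act (r n) q y \<le> ?act (r n) p (x n)" if "q \<in> F" "y \<in> Kx q" for n q y
    using PX(3)[OF that, of "r1 (r2 n)"] r1(2) unfolding r_def x_def by simp
  obtain v a where v: "v \<in> ?W" and a: "a > 0" and gain: "\<forall>R>0. (\<forall>\<^sub>F n in sequentially.
     x n + (R * d n) *\<^sub>R v \<in> ball (w p) (2 * \<rho> p) \<and>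
     a * R * (d n)\<^sup>2 \<le> ?act (r n) p (x n + (R * d n) *\<^sub>R v) - ?act (r n) p (x n) \<and>
     norm (normal_part ?W (loc (\<psi> (r n)) ?c ?c (T, x n + (R * d n) *\<^sub>R v))) \<le> 2 * d n) \<and> (\<lambda>n. x n + (R * d n) *\<^sub>R v) \<longlonglongrightarrow> x0"
    using action_gain[OF rel near_id_subseq(1)[OF r near(1)] near_id_subseq(2)[OF r near(2)[OF p]] sl(1)[OF p] wW[OF p] b3[OF p] \<rho>(1)[OF p]
      _ _ _ xlim d_def d0 \<eta>lim] gn[OF p] xK unfolding good_def Kx_def by blast
  define m0 where "m0 = cinv ?c x0"
  have m0: "m0 \<in> cdom ?c" "m0 \<in> L" "cmap ?c m0 = x0"
    using chart(6,7)[OF cA x0c] slice(4)[OF sl(1)[OF p] x0c] x0K unfolding m0_def Kx_def by auto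
  define Km where "Km q = cinv (ch q) ` cball (w q) (\<rho> q)" for q
  have Kcd: "Km q \<subseteq> cdom (ch q)" if "q \<in> F" for q
    using chart(7)[OF A(1)[OF that]] cb[OF that] ball_subset_cball unfolding Km_def by blast
  have closedKm: "closed (Km q)" if "q \<in> F" for q
  proof -
    note cb1[OF that]
    then have "compact (Km q)" unfolding Km_def
      by (intro compact_continuous_image continuous_on_subset[OF chart(4)[OF A(1)[OF that]]] compact_cball)
    then show ?thesis by (rule compact_imp_closed)
  qed
  define controls where "controls q N C \<longleftrightarrow> open N \<and> m0 \<in> N \<and> (0 :: real) \<le> C \<and>
    (\<forall>\<psi> \<kappa> m. rel_iso \<psi> \<kappa> \<longrightarrow> m \<in> L \<longrightarrow> (\<forall>t\<in>{0..T}. \<psi> t m \<in> N) \<longrightarrow>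
    \<bar>action (ch q) (Wd q) \<psi> \<kappa> (cmap (ch q) m) - action ?c ?W \<psi> \<kappa> (cmap ?c m)\<bar> \<le> C * norm (normal_part ?W (cmap ?c (\<psi> T m))) ^ 2)"
    for q N C
  have "\<exists>N C. controls q N C" if "q \<in> {q \<in> F. m0 \<in> Km q}" for q
    unfolding controls_def using local_comparison[OF sl(1)[OF p] sl(1) m0(2,1)] Kcd that by blast
  then obtain N C where controls: "\<And>q. q \<in> {q \<in> F. m0 \<in> Km q} \<Longrightarrow> controls q (N q) (C q)"
    by metis
  note NC = controls[unfolded controls_def]
  define C' where "C' = (\<Sum>q\<in>{q \<in> F. m0 \<in> Km q}. C q)"
  have C': "C q \<le> C'" if "q \<in> {q \<in> F. m0 \<in> Km q}" for q
    unfolding C'_def by (rule member_le_sum[OF that]) (use NC F(1) in auto)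
  have C'0: "0 \<le> C'" unfolding C'_def by (rule sum_nonneg) (use NC in blast)
  \<comment> \<open>the gain \<open>a R d\<^sup>2\<close> has to exceed the cost \<open>C' (2 d)\<^sup>2\<close> of changing the chart\<close>
  define R where "R = (4 * C' + 1) / a"
  have R: "R > 0" "a * R = 4 * C' + 1" unfolding R_def using a C'0 by auto
  define y where "y n = x n + (R * d n) *\<^sub>R v" for n
  define m where "m n = cinv ?c (y n)" for n
  have ylim: "y \<longlonglongrightarrow> x0" unfolding y_def[abs_def] using gain R(1) by blast
  have mlim: "m \<longlonglongrightarrow> m0" unfolding m_def[abs_def] m0_def by (rule tendsto_cinv[OF cA x0c ylim])
  have ev1: "\<forall>\<^sub>F n in sequentially. y n \<in> ball (w p) (2 * \<rho> p) \<and>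
     a * R * (d n)\<^sup>2 \<le> ?act (r n) p (y n) - ?act (r n) p (x n) \<and>
     norm (normal_part ?W (loc (\<psi> (r n)) ?c ?c (T, y n))) \<le> 2 * d n"
    using gain R(1) unfolding y_def by blast
  have ev2: "\<forall>\<^sub>F n in sequentially. \<forall>q\<in>F. m0 \<in> Km q \<or> m n \<notin> Km q"
  proof (intro eventually_ball_finite F(1) ballI)
    fix q assume q: "q \<in> F"
    show "\<forall>\<^sub>F n in sequentially. m0 \<in> Km q \<or> m n \<notin> Km q"
    proof (cases "m0 \<in> Km q")
      case False
      have "\<forall>\<^sub>F n in sequentially. m n \<in> - Km q"
        by (rule topological_tendstoD[OF mlim]) (use closedKm[OF q] False in auto)
      then show ?thesis by eventually_elim simp
    qed simp
  qed
  have ev3: "\<forall>\<^sub>F n in sequentially. \<forall>q\<in>{q \<in> F. m0 \<in> Km q}. \<forall>t\<in>{0..T}. \<psi> (r n) t (m n) \<in> N q"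
  proof (rule eventually_ball_finite)
    show "finite {q \<in> F. m0 \<in> Km q}" using F(1) by simp
    show "\<forall>q\<in>{q \<in> F. m0 \<in> Km q}. \<forall>\<^sub>F n in sequentially. \<forall>t\<in>{0..T}. \<psi> (r n) t (m n) \<in> N q"
    proof
      fix q assume q: "q \<in> {q \<in> F. m0 \<in> Km q}"
      have "open (cimg ?c \<inter> cinv ?c -` N q)" using NC[OF q] continuous_open_preimage[OF chart(4,2)[OF cA]] by blast
      moreover have "x0 \<in> cimg ?c \<inter> cinv ?c -` N q" using NC[OF q] x0c unfolding m0_def by simp
      ultimately obtain e where e: "e > 0" "cball x0 e \<subseteq> cimg ?c \<inter> cinv ?c -` N q"
        using open_contains_cball by blast
      let ?K = "cinv ?c ` cball x0 e"
      have K: "compact ?K"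
        by (rule compact_continuous_image[OF continuous_on_subset[OF chart(4)[OF cA]] compact_cball]) (use e(2) in blast)
      have KM: "?K \<subseteq> M" using chart(7,8)[OF cA] e(2) by blast
      have "\<forall>\<^sub>F n in sequentially. \<forall>t\<in>{0..T}. \<forall>m\<in>?K. \<psi> (r n) t m \<in> N q"
        by (rule near_id_compact[OF near_id_subseq(1)[OF r near(1)] K KM]) (use NC[OF q] e(2) in blast)+
      moreover have "\<forall>\<^sub>F n in sequentially. y n \<in> ball x0 e"
        by (rule topological_tendstoD[OF ylim open_ball]) (use e(1) in simp)
      ultimately show "\<forall>\<^sub>F n in sequentially. \<forall>t\<in>{0..T}. \<psi> (r n) t (m n) \<in> N q"
      proof eventually_elim
        case (elim n)
        have "m n \<in> ?K" unfolding m_def using elim(2) ball_subset_cball by blast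
        then show ?case using elim(1) by blast
      qed
    qed
  qed
  have "\<forall>\<^sub>F n in sequentially. False"
    using ev1 ev2 ev3
  proof eventually_elim
    case (elim n)
    have yc: "y n \<in> cimg ?c" using elim(1) cb(1)[OF p] ball_subset_cball by blast
    have yW: "y n \<in> ?W" unfolding y_def using xK[of n] v W unfolding Kx_def by (auto intro: subspace_add subspace_mul)
    have mL: "m n \<in> L" unfolding m_def using slice(4)[OF sl(1)[OF p] yc] yW by blast
    have cm: "cmap ?c (m n) = y n" unfolding m_def by (rule chart(6)[OF cA yc])
    obtain q where q: "q \<in> F" "m n \<in> cdom (ch q)" "cmap (ch q) (m n) \<in> ball (w q) (\<rho> q)"
      using cover[OF mL] unfolding w_def by blast
    have "m n \<in> Km q" unfolding Km_def
      using chart(5)[OF A(1)[OF q(1)] q(2)] q(3) ball_subset_cball by (metis image_eqI subsetD)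
    then have qF: "q \<in> {q \<in> F. m0 \<in> Km q}" using elim(2) q(1) by blast
    have "cmap (ch q) (m n) \<in> Kx q"
      unfolding Kx_def using slice(3)[OF sl(1)[OF q(1)] q(2)] mL q(3) by auto
    then have 1: "?act (r n) q (cmap (ch q) (m n)) \<le> ?act (r n) p (x n)" by (rule mx[OF q(1)])
    have "\<bar>?act (r n) q (cmap (ch q) (m n)) - ?act (r n) p (cmap ?c (m n))\<bar> \<le> C q * norm (normal_part ?W (cmap ?c (\<psi> (r n) T (m n)))) ^ 2"
      using NC[OF qF] rel mL elim(3) qF by blast
    moreover have "cmap ?c (\<psi> (r n) T (m n)) = loc (\<psi> (r n)) ?c ?c (T, y n)" unfolding loc_def m_def by simp
    moreover have "C q * norm (normal_part ?W (loc (\<psi> (r n)) ?c ?c (T, y n))) ^ 2 \<le> C' * (2 * d n) ^ 2"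
      using C'[OF qF] elim(1) C'0 by (intro mult_mono power_mono) auto
    ultimately have 2: "?act (r n) p (y n) - ?act (r n) q (cmap (ch q) (m n)) \<le> C' * (2 * d n) ^ 2" using cm by simp
    have "(4 * C' + 1) * (d n)\<^sup>2 \<le> C' * (2 * d n) ^ 2"
      using 1 2 elim(1) R(2) by simp
    then have "(d n)\<^sup>2 \<le> 0" by (simp add: algebra_simps power_mult_distrib)
    then show False using d0[of n] by simp
  qed
  then show False by simp
qed

end

lemma countable_pairwise_disjnt:
  assumes "pairwise disjnt P" "\<And>N. N \<in> P \<Longrightarrow> N \<subseteq> X" "countable X"
  shows "countable P"
proof -
  define f where "f N = (SOME x. x \<in> N)" for N :: "'a set"
  have f: "f N \<in> N" if "N \<in> P - {{}}" for N unfolding f_def using that by (simp add: some_in_eq)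
  have "inj_on f (P - {{}})"
  proof (rule inj_onI)
    fix N N' assume N: "N \<in> P - {{}}" "N' \<in> P - {{}}" "f N = f N'"
    then have "f N \<in> N \<inter> N'" using f by force
    then show "N = N'" using assms(1) N by (auto simp: pairwise_def disjnt_def)
  qed
  moreover have "countable (f ` (P - {{}}))"
    by (rule countable_subset[OF _ assms(3)]) (use f assms(2) in blast)
  ultimately have "countable (P - {{}})" using countable_image_inj_on by blast
  then have "countable (insert {} (P - {{}}))" by simp
  then show ?thesis by (rule countable_subset[rotated]) blast
qed

lemma zero_dimensional_countable:
  fixes A :: "('m::{t2_space, second_countable_topology}, 'e::euclidean_space) chart set"
  assumes "\<And>c. c \<in> A \<Longrightarrow> coord_chart {0} c"
  shows "countable (carrier A)"
proof -
  have single: "open (cdom c) \<and> (\<exists>x. cdom c \<subseteq> {x})" if "c \<in> A" for c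
  proof -
    have c: "open (cdom c)" "openin (top_of_set {0}) (cimg c)" "homeomorphism (cdom c) (cimg c) (cmap c) (cinv c)"
      using assms[OF that] unfolding coord_chart_def by auto
    have "cimg c \<subseteq> {0}" using openin_imp_subset[OF c(2)] .
    then have "cdom c \<subseteq> {cinv c 0}" using c(3) unfolding homeomorphism_def by fastforce
    then show ?thesis using c(1) by blast
  qed
  obtain \<F> where \<F>: "\<F> \<subseteq> cdom ` A" "countable \<F>" "\<Union>\<F> = \<Union>(cdom ` A)"
    using Lindelof[of "cdom ` A"] single by blast
  have cS: "countable S" if S: "S \<in> \<F>" for S
  proof -
    obtain x where "S \<subseteq> {x}" using \<F>(1) single S by blast
    then show ?thesis by (rule countable_subset) simp
  qed
  have "countable (\<Union>S\<in>\<F>. S)" by (rule countable_UN[OF \<F>(2) cS])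
  then show ?thesis using \<F>(3) unfolding carrier_def by simp
qed

text \<open>
  The countable atlas \<open>B\<close> has to contain the chosen slice charts, because the convergence of
  derivatives is available only in charts of \<open>B\<close>.
\<close>

lemma lagrangian_packing_countable:
  fixes A :: "('m::{t2_space, second_countable_topology}, 'e::euclidean_space) chart set"
  assumes symp: "symplectic_manifold UNIV A \<omega>" and lagr: "lagrangian UNIV A \<omega> L" and comp: "compact L"
    and disj: "pairwise disjnt P" and ham: "\<forall>N\<in>P. hamiltonian_isotopic UNIV A \<omega> L N"
  shows "countable P"
proof (rule ccontr)
  assume unc: "uncountable P"
  interpret lagrangian_setting A \<omega> L "pi / 2"
    by unfold_locales (use symp lagr in auto)
  let ?T = "pi / 2"
  have "L \<noteq> {}"
  proof
    assume "L = {}"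
    then have "P \<subseteq> {{}}" using ham unfolding hamiltonian_isotopic_def by auto
    then have "countable P" by (rule countable_subset) simp
    then show False using unc by simp
  qed
  have "\<forall>N\<in>P. \<exists>\<phi> h. ham_iso \<phi> h \<and> N = \<phi> ?T ` L"
  proof
    fix N assume "N \<in> P"
    then obtain \<zeta> where \<zeta>: "\<zeta> \<in> Ham UNIV A \<omega>" "N = \<zeta> ` L" using ham unfolding hamiltonian_isotopic_def by blast
    obtain \<phi> h where \<phi>: "ham_iso \<phi> h" "\<forall>p\<in>M. \<zeta> p = \<phi> ?T p" using Ham_ham_iso[OF \<zeta>(1)] by blast
    then have "N = \<phi> ?T ` L" using \<zeta>(2) L_M by (auto simp: subset_iff image_iff)
    then show "\<exists>\<phi> h. ham_iso \<phi> h \<and> N = \<phi> ?T ` L" using \<phi>(1) by blast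
  qed
  then obtain \<phi> h where \<phi>: "\<And>N. N \<in> P \<Longrightarrow> ham_iso (\<phi> N) (h N)" "\<And>N. N \<in> P \<Longrightarrow> N = \<phi> N ?T ` L"
    by metis
  have "\<exists>c W \<rho>. slice c W \<and> p \<in> cdom c \<and> \<rho> > 0 \<and> ball (cmap c p) (3 * \<rho>) \<subseteq> cimg c" if p: "p \<in> L" for p
  proof -
    obtain c W where c: "slice c W" "p \<in> cdom c" using ex_slice[OF p] by blast
    have "open (cimg c)" "cmap c p \<in> cimg c" using chart(2)[OF slice(1)[OF c(1)]] c(2) by auto
    then obtain e where "e > 0" "ball (cmap c p) e \<subseteq> cimg c" using open_contains_ball by blast
    then show ?thesis using c by (intro exI[of _ c] exI[of _ W] exI[of _ "e / 3"]) simp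
  qed
  then obtain ch Wd \<rho> where ch: "\<And>p. p \<in> L \<Longrightarrow> slice (ch p) (Wd p) \<and> p \<in> cdom (ch p) \<and> \<rho> p > 0 \<and> ball (cmap (ch p) p) (3 * \<rho> p) \<subseteq> cimg (ch p)"
    by metis
  define O' where "O' p = cdom (ch p) \<inter> cmap (ch p) -` ball (cmap (ch p) p) (\<rho> p)" for p
  have chA: "ch p \<in> A" if "p \<in> L" for p using slice(1) ch[OF that] by blast
  have oO: "open (O' p)" if "p \<in> L" for p
    unfolding O'_def by (rule continuous_open_preimage[OF chart(3,1)[OF chA[OF that]] open_ball])
  have pO: "p \<in> O' p" if "p \<in> L" for p using ch[OF that] unfolding O'_def by simp
  obtain F where F: "F \<subseteq> L" "finite F" "L \<subseteq> (\<Union>p\<in>F. O' p)"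
    by (rule compactE_image[OF comp, of L O']) (use oO pO in auto)
  have "F \<noteq> {}" using F(3) \<open>L \<noteq> {}\<close> by auto
  obtain \<F> where \<F>: "\<F> \<subseteq> cdom ` A" "countable \<F>" "\<Union>\<F> = \<Union>(cdom ` A)"
    using Lindelof[of "cdom ` A"] chart(1) by blast
  obtain B0 where B0: "countable B0" "B0 \<subseteq> A" "\<F> = cdom ` B0"
    using countable_subset_image[of \<F> cdom A] \<F> by blast
  define B where "B = B0 \<union> ch ` F"
  have B: "countable B" "B \<subseteq> A" "M \<subseteq> carrier B"
    using B0 F \<F>(3) chA unfolding B_def carrier_def by (auto intro: countable_finite)
  obtain N J where N: "N \<in> P" "\<And>k. J k \<in> P \<and> J k \<noteq> N" "iso_conv B (\<lambda>k. \<phi> (J k)) (\<phi> N)"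
    using isotopies_accumulate[of P \<phi> h B] unc \<phi>(1) B(1,2) by blast
  note iN = \<phi>(1)[OF N(1)] and iJ = \<phi>(1)[OF conjunct1[OF N(2)]]
  define \<psi> where "\<psi> k = relative_isotopy (\<phi> N) (\<phi> (J k))" for k
  define \<kappa> where "\<kappa> k = relative_hamiltonian (\<phi> (J k)) (h (J k)) (h N)" for k
  have relk: "rel_iso (\<psi> k) (\<kappa> k)" for k unfolding \<psi>_def \<kappa>_def by (rule rel_iso_relative_isotopy[OF iN iJ])
  have near: "near_id \<psi>"
    unfolding near_id_def \<psi>_def using relative_isotopy_conv[OF iN iJ iso_conv_subseq[OF N(3)]] by blast
  have dnear: "deriv_near_id \<psi> (ch p)" if "p \<in> F" for p
    unfolding deriv_near_id_def \<psi>_def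
    using relative_isotopy_deriv_conv[OF iN iJ iso_conv_subseq[OF N(3)] B(2,3)] that unfolding B_def by blast
  have "\<exists>n. \<exists>m\<in>L. \<psi> n ?T m \<in> L"
  proof (rule no_displacement_near_id[where F=F and ch=ch and Wd=Wd and \<rho>=\<rho>])
    show "\<exists>p\<in>F. m \<in> cdom (ch p) \<and> cmap (ch p) m \<in> ball (cmap (ch p) p) (\<rho> p)" if "m \<in> L" for m
      using F(3) that unfolding O'_def by blast
  qed (use relk near dnear F \<open>F \<noteq> {}\<close> ch in blast)+
  then obtain n m where m: "m \<in> L" "\<psi> n ?T m \<in> L" by blast
  have same: "\<phi> N ?T (\<psi> n ?T m) = \<phi> (J n) ?T m"
    unfolding \<psi>_def using relative_isotopy(2)[OF iN iJ] m(1) L_M by blast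
  have "\<phi> N ?T (\<psi> n ?T m) \<in> N"
    by (rule subsetD[OF eq_refl[OF \<phi>(2)[OF N(1), symmetric]]], rule imageI, rule m(2))
  moreover have "\<phi> (J n) ?T m \<in> J n"
    by (rule subsetD[OF eq_refl[OF \<phi>(2)[OF conjunct1[OF N(2)], symmetric]]], rule imageI, rule m(1))
  ultimately have "\<phi> (J n) ?T m \<in> N \<inter> J n" using same by simp
  then show False using disj N(1) N(2)[of n] by (auto simp: pairwise_def disjnt_def)
qed

theorem proposition1p2:
  fixes E :: "'e::euclidean_space set"
    and A :: "('m::{t2_space, second_countable_topology}, 'e) chart set"
    and \<omega> :: "('m, 'e) two_form"
    and L :: "'m set"
    and P :: "'m set set"
  assumes "symplectic_manifold E A \<omega>"
    and "lagrangian E A \<omega> L" and "compact L"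
    and "\<forall>N\<in>P. submanifold E A N"
    and "pairwise disjnt P"
    and "\<forall>N\<in>P. hamiltonian_isotopic E A \<omega> L N"
  shows "countable P"
proof -
  have sm: "smooth_manifold E A" using assms(1) unfolding symplectic_manifold_def by blast
  then consider "E = UNIV" | "E = {0}" unfolding smooth_manifold_def by blast
  then show ?thesis
  proof cases
    case 1
    then show ?thesis using lagrangian_packing_countable assms by blast
  next
    case 2
    have "countable (carrier A)"
      by (rule zero_dimensional_countable) (use sm 2 in \<open>simp add: smooth_manifold_def\<close>)
    moreover have "N \<subseteq> carrier A" if "N \<in> P" for N
      using assms(4) that unfolding submanifold_def submanifold_of_dim_def by blast
    ultimately show ?thesis using countable_pairwise_disjnt[OF assms(5)] by blast
  qed
qed

end
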